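(* Let $A$ be a finite abelian group with character group $\widehat A$, let $n\geqslant 2$, and let $$w=\sum_{1\leqslant i<j\leqslant n}\mathsf a_{ij}(ij)+\sum_{x\in A^n}\mathsf c_x\,x\in\mathbb R[A\wr\mathfrak S_n],\qquad \mathsf a_{ij}\geqslant 0,\quad \mathsf c_x=\mathsf c_{x^{-1}}\geqslant 0 .$$ Then $$\psi_{A\wr\mathfrak S_n}(w)=\min\Bigl\{\lambda_{\mathrm{rw}}(\mathsf a),\ \min_{\kappa}\lambda_{\min}(\mathcal L_\kappa)\Bigr\},$$ where the inner minimum is over all multiplicity vectors $\kappa=(\kappa_\chi)_{\chi\in\widehat A}$ (non-negative integers with $\sum_{\chi}\kappa_\chi=n$) such that $V_\kappa$ is not the trivial representation, i.e. $\kappa_{\mathrm{triv}}\neq n$.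
   Context: $A\wr\mathfrak S_n=A^n\rtimes\mathfrak S_n$ with multiplication $(g;\pi)(h;\sigma)=(g(\pi\cdot h);\pi\sigma)$, $\pi\cdot g=(g_{\pi^{-1}(1)},\dots,g_{\pi^{-1}(n)})$; $A^n$ and $\mathfrak S_n$ are regarded as subgroups, and $(ij)$ is the transposition. For a finite group $H$ and $w=\sum_h\mathsf c_h h\in\mathbb R[H]$ with $\mathsf c_h=\mathsf c_{h^{-1}}\geqslant 0$, put $\Delta_H(w)=\sum_h\mathsf c_h(1_H-h)$, and let $\psi_H(w)$ be the smallest eigenvalue of $\Delta_H(w)$, acting in the regular representation of $H$ on $\mathbb C[H]$, on the orthogonal complement of the $H$-fixed vectors. A minimum over an empty set is $+\infty$. $\lambda_{\mathrm{rw}}(\mathsf a)$ is the least eigenvalue, on the orthogonal complement of the constant vector in $\mathbb C^n$, of the weighted graph Laplacian $(L_{\mathsf a}f)(i)=\sum_{j\neq i}\mathsf a_{ij}(f(i)-f(j))$, with $\mathsf a_{ji}=\mathsf a_{ij}$. $V_\kappa$ is the irreducible representation $\mathrm{Ind}_{\prod_\chi(A\wr\mathfrak S_{\kappa_\chi})}^{A\wr\mathfrak S_n}(\boxtimes_\chi\chi^{\otimes\kappa_\chi})$ of $A\wr\mathfrak S_n$, where on $\chi^{\otimes m}$ the group $A^m$ acts by $(g_1,\dots,g_m)\mapsto\prod_i\chi(g_i)$ and $\mathfrak S_m$ acts trivially. $\Omega_\kappa=\{z=(\chi_1,\dots,\chi_n)\in\widehat A^n:\ |\{i:\chi_i=\chi\}|=\kappa_\chi\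 \forall\chi\in\widehat A\}$, with $\mathfrak S_n$ permuting coordinates. For $z=(\chi_1,\dots,\chi_n)\in\widehat A^n$ and $x=(x_1,\dots,x_n)\in A^n$, $\langle z,x\rangle=\prod_{i}\chi_i(x_i)$. $\mathcal L_\kappa$ is the operator on $\mathbb C[\Omega_\kappa]$ $$(\mathcal L_\kappa f)(z)=\sum_{1\leqslant i<j\leqslant n}\mathsf a_{ij}\bigl(f(z)-f((ij)\cdot z)\bigr)+Q(z)f(z),\qquad Q(z)=\sum_{x\in A^n}\mathsf c_x\bigl(1-\operatorname{Re}\langle z,x\rangle\bigr),$$ and $\lambda_{\min}(\mathcal L_\kappa)$ is its least eigenvalue. *)

theory Defs
  imports
    Complex_Main
    "HOL-Library.Extended_Real"
    "HOL-Algebra.Product_Groups"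
    "HOL-Algebra.Sym_Groups"
begin

section \<open>Function spaces, least eigenvalues, representations\<close>

text \<open>\<open>\<complex>[X]\<close>: complex functions on \<open>X\<close>, represented as total functions that vanish outside \<open>X\<close>.
  All operators below return functions of this kind.\<close>

definition fun_space :: "'x set \<Rightarrow> ('x \<Rightarrow> complex) set" where
  "fun_space X = {f. \<forall>x. x \<notin> X \<longrightarrow> f x = 0}"

definition orth_compl :: "'x set \<Rightarrow> ('x \<Rightarrow> complex) set \<Rightarrow> ('x \<Rightarrow> complex) set" where
  "orth_compl X V = {f \<in> fun_space X. \<forall>v\<in>V. (\<Sum>x\<in>X. f x * cnj (v x)) = 0}"

text \<open>The least eigenvalue of \<open>T\<close> on the subspace \<open>W\<close>, as an infimum in the extended reals, so that
  it is \<open>\<infinity>\<close> if there is no eigenvalue. It is only used for a self-adjoint \<open>T\<close> leaving a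
  finite-dimensional \<open>W\<close> invariant: then the eigenvalues are real and finite in number, and for
  \<open>W \<noteq> 0\<close> the infimum is attained.\<close>

definition least_eigenvalue ::
    "('x \<Rightarrow> complex) set \<Rightarrow> (('x \<Rightarrow> complex) \<Rightarrow> 'x \<Rightarrow> complex) \<Rightarrow> ereal" where
  "least_eigenvalue W T =
     (INF l \<in> {l :: real. \<exists>f\<in>W. f \<noteq> (\<lambda>_. 0) \<and> T f = (\<lambda>x. of_real l * f x)}. ereal l)"

text \<open>Left translation \<open>(h \<cdot> f)(x) = f(h\<^sup>-\<^sup>1x)\<close>. Identifying \<open>f\<close> with \<open>\<Sum>\<^sub>x f(x) x\<close>, this is left
  multiplication by \<open>h\<close> in \<open>\<complex>[H]\<close>.\<close>

definition left_translate ::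
    "('h, 'm) monoid_scheme \<Rightarrow> 'h \<Rightarrow> ('h \<Rightarrow> complex) \<Rightarrow> 'h \<Rightarrow> complex" where
  "left_translate H h f = (\<lambda>x. if x \<in> carrier H then f (inv\<^bsub>H\<^esub> h \<otimes>\<^bsub>H\<^esub> x) else 0)"

definition fixed_vectors :: "('h, 'm) monoid_scheme \<Rightarrow> ('h \<Rightarrow> complex) set" where
  "fixed_vectors H = {f \<in> fun_space (carrier H). \<forall>h\<in>carrier H. left_translate H h f = f}"

text \<open>An element \<open>w\<close> of the real group algebra is given by its coefficient function.\<close>

definition group_laplacian ::
    "('h, 'm) monoid_scheme \<Rightarrow> ('h \<Rightarrow> real) \<Rightarrow> ('h \<Rightarrow> complex) \<Rightarrow> 'h \<Rightarrow> complex" where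
  "group_laplacian H w f =
     (\<lambda>x. \<Sum>h\<in>carrier H. of_real (w h) * (f x - left_translate H h f x))"

definition psi :: "('h, 'm) monoid_scheme \<Rightarrow> ('h \<Rightarrow> real) \<Rightarrow> ereal" where
  "psi H w =
     least_eigenvalue (orth_compl (carrier H) (fixed_vectors H)) (group_laplacian H w)"

text \<open>The space of the representation induced from the one-dimensional representation \<open>\<theta>\<close> of a
  subgroup \<open>K\<close>; the group acts on it by left translation.\<close>

definition induced_space ::
    "('h, 'm) monoid_scheme \<Rightarrow> 'h set \<Rightarrow> ('h \<Rightarrow> complex) \<Rightarrow> ('h \<Rightarrow> complex) set" where
  "induced_space H K \<theta> =
     {F \<in> fun_space (carrier H).
        \<forall>x\<in>carrier H. \<forall>k\<in>K. F (x \<otimes>\<^bsub>H\<^esub> k) = inverse (\<theta> k) * F x}"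

definition is_trivial_rep ::
    "('h, 'm) monoid_scheme \<Rightarrow> ('x \<Rightarrow> complex) set
      \<Rightarrow> ('h \<Rightarrow> ('x \<Rightarrow> complex) \<Rightarrow> 'x \<Rightarrow> complex) \<Rightarrow> bool" where
  "is_trivial_rep H V \<rho> \<longleftrightarrow>
     (\<exists>v\<in>V. v \<noteq> (\<lambda>_. 0) \<and> (\<forall>u\<in>V. \<exists>c. u = (\<lambda>x. c * v x))) \<and>
     (\<forall>h\<in>carrier H. \<forall>v\<in>V. \<rho> h v = v)"


section \<open>Wreath products with the symmetric group\<close>

abbreviation power_group :: "('a, 'm) monoid_scheme \<Rightarrow> nat \<Rightarrow> (nat \<Rightarrow> 'a) monoid" where
  "power_group A n \<equiv> product_group {1..n} (\<lambda>_. A)"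

text \<open>\<open>\<pi> \<cdot> g = (g\<^bsub>\<pi>\<^sup>-\<^sup>1(1)\<^esub>, \<dots>, g\<^bsub>\<pi>\<^sup>-\<^sup>1(n)\<^esub>)\<close>\<close>

definition perm_act :: "nat \<Rightarrow> (nat \<Rightarrow> nat) \<Rightarrow> (nat \<Rightarrow> 'b) \<Rightarrow> nat \<Rightarrow> 'b" where
  "perm_act n \<pi> g = (\<lambda>i\<in>{1..n}. g (inv' \<pi> i))"

definition wreath ::
    "('a, 'm) monoid_scheme \<Rightarrow> nat \<Rightarrow> ((nat \<Rightarrow> 'a) \<times> (nat \<Rightarrow> nat)) monoid" where
  "wreath A n =
     \<lparr>carrier = carrier (power_group A n) \<times> carrier (sym_group n),
      monoid.mult = (\<lambda>(g, \<pi>) (h, \<sigma>). (g \<otimes>\<^bsub>power_group A n\<^esub> perm_act n \<pi> h, \<pi> \<otimes>\<^bsub>sym_group n\<^esub> \<sigma>)),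
      one = (\<one>\<^bsub>power_group A n\<^esub>, \<one>\<^bsub>sym_group n\<^esub>)\<rparr>"

definition ordered_pairs :: "nat \<Rightarrow> (nat \<times> nat) set" where
  "ordered_pairs n = {(i, j). 1 \<le> i \<and> i < j \<and> j \<le> n}"

text \<open>The group algebra element \<open>\<Sum>\<^sub>i\<^sub><\<^sub>j a\<^sub>i\<^sub>j (i j) + \<Sum>\<^sub>x c\<^sub>x x\<close>, with \<open>x \<in> A\<^sup>n\<close> and \<open>(i j)\<close> embedded in
  the wreath product as \<open>(x; 1)\<close> and \<open>(1; (i j))\<close>.\<close>

definition wreath_weight ::
    "('a, 'm) monoid_scheme \<Rightarrow> nat \<Rightarrow> (nat \<Rightarrow> nat \<Rightarrow> real) \<Rightarrow> ((nat \<Rightarrow> 'a) \<Rightarrow> real)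
      \<Rightarrow> (nat \<Rightarrow> 'a) \<times> (nat \<Rightarrow> nat) \<Rightarrow> real" where
  "wreath_weight A n a c h =
     (\<Sum>(i, j)\<in>ordered_pairs n.
        a i j * of_bool (h = (\<one>\<^bsub>power_group A n\<^esub>, transpose i j))) +
     (\<Sum>x\<in>carrier (power_group A n). c x * of_bool (h = (x, \<one>\<^bsub>sym_group n\<^esub>)))"


section \<open>The random walk eigenvalue\<close>

definition graph_laplacian ::
    "nat \<Rightarrow> (nat \<Rightarrow> nat \<Rightarrow> real) \<Rightarrow> (nat \<Rightarrow> complex) \<Rightarrow> nat \<Rightarrow> complex" where
  "graph_laplacian n a f =
     (\<lambda>i. if i \<in> {1..n} then \<Sum>j\<in>{1..n} - {i}. of_real (a i j) * (f i - f j) else 0)"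

definition lambda_rw :: "nat \<Rightarrow> (nat \<Rightarrow> nat \<Rightarrow> real) \<Rightarrow> ereal" where
  "lambda_rw n a =
     least_eigenvalue (orth_compl {1..n} {\<lambda>i. of_bool (i \<in> {1..n})}) (graph_laplacian n a)"


section \<open>Characters, the representations \<open>V\<^sub>\<kappa>\<close> and the operators \<open>\<L>\<^sub>\<kappa>\<close>\<close>

definition complex_units :: "complex monoid" where
  "complex_units = \<lparr>carrier = UNIV - {0}, monoid.mult = (*), one = 1\<rparr>"

definition characters :: "('a, 'm) monoid_scheme \<Rightarrow> ('a \<Rightarrow> complex) set" where
  "characters A = hom A complex_units \<inter> extensional (carrier A)"

definition trivial_character :: "('a, 'm) monoid_scheme \<Rightarrow> 'a \<Rightarrow> complex" where
  "trivial_character A = (\<lambda>x\<in>carrier A. 1)"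

definition multiplicity_vectors ::
    "('a, 'm) monoid_scheme \<Rightarrow> nat \<Rightarrow> (('a \<Rightarrow> complex) \<Rightarrow> nat) set" where
  "multiplicity_vectors A n =
     {\<kappa> \<in> extensional (characters A). (\<Sum>\<chi>\<in>characters A. \<kappa> \<chi>) = n}"

definition Omega ::
    "('a, 'm) monoid_scheme \<Rightarrow> nat \<Rightarrow> (('a \<Rightarrow> complex) \<Rightarrow> nat) \<Rightarrow> (nat \<Rightarrow> 'a \<Rightarrow> complex) set" where
  "Omega A n \<kappa> =
     {z \<in> {1..n} \<rightarrow>\<^sub>E characters A. \<forall>\<chi>\<in>characters A. card {i \<in> {1..n}. z i = \<chi>} = \<kappa> \<chi>}"

definition pairing :: "nat \<Rightarrow> (nat \<Rightarrow> 'a \<Rightarrow> complex) \<Rightarrow> (nat \<Rightarrow> 'a) \<Rightarrow> complex" where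
  "pairing n z x = (\<Prod>i\<in>{1..n}. z i (x i))"

text \<open>A labelling \<open>z\<close> of \<open>{1..n}\<close> by characters that takes each value \<open>\<chi>\<close> exactly \<open>\<kappa>\<^sub>\<chi>\<close> times cuts
  \<open>{1..n}\<close> into blocks and so embeds \<open>\<Prod>\<^sub>\<chi> (A \<wr> S\<^bsub>\<kappa>\<^sub>\<chi>\<^esub>)\<close> into \<open>A \<wr> S\<^sub>n\<close>, as the subgroup of all
  \<open>(g; \<pi>)\<close> with \<open>\<pi>\<close> preserving every block. On it the outer tensor product of the \<open>\<chi>\<^bsup>\<otimes>\<kappa>\<^sub>\<chi>\<^esup>\<close> is the
  one-dimensional representation \<open>(g; \<pi>) \<mapsto> \<Prod>\<^sub>i z\<^sub>i(g\<^sub>i)\<close>. Different labellings give conjugate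
  subgroups and isomorphic induced representations, so any one may be chosen.\<close>

definition block_subgroup ::
    "('a, 'm) monoid_scheme \<Rightarrow> nat \<Rightarrow> (nat \<Rightarrow> 'a \<Rightarrow> complex)
      \<Rightarrow> ((nat \<Rightarrow> 'a) \<times> (nat \<Rightarrow> nat)) set" where
  "block_subgroup A n z = {(g, \<pi>) \<in> carrier (wreath A n). \<forall>i\<in>{1..n}. z (\<pi> i) = z i}"

definition V_space ::
    "('a, 'm) monoid_scheme \<Rightarrow> nat \<Rightarrow> (('a \<Rightarrow> complex) \<Rightarrow> nat)
      \<Rightarrow> ((nat \<Rightarrow> 'a) \<times> (nat \<Rightarrow> nat) \<Rightarrow> complex) set" where
  "V_space A n \<kappa> =
     (let z = (SOME z. z \<in> Omega A n \<kappa>)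
      in induced_space (wreath A n) (block_subgroup A n z) (\<lambda>(g, \<pi>). pairing n z g))"

definition V_trivial ::
    "('a, 'm) monoid_scheme \<Rightarrow> nat \<Rightarrow> (('a \<Rightarrow> complex) \<Rightarrow> nat) \<Rightarrow> bool" where
  "V_trivial A n \<kappa> \<longleftrightarrow>
     is_trivial_rep (wreath A n) (V_space A n \<kappa>) (left_translate (wreath A n))"

definition Q_potential ::
    "('a, 'm) monoid_scheme \<Rightarrow> nat \<Rightarrow> ((nat \<Rightarrow> 'a) \<Rightarrow> real) \<Rightarrow> (nat \<Rightarrow> 'a \<Rightarrow> complex) \<Rightarrow> real" where
  "Q_potential A n c z =
     (\<Sum>x\<in>carrier (power_group A n). c x * (1 - Re (pairing n z x)))"

definition L_op ::
    "('a, 'm) monoid_scheme \<Rightarrow> nat \<Rightarrow> (nat \<Rightarrow> nat \<Rightarrow> real) \<Rightarrow> ((nat \<Rightarrow> 'a) \<Rightarrow> real)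
      \<Rightarrow> (('a \<Rightarrow> complex) \<Rightarrow> nat) \<Rightarrow> ((nat \<Rightarrow> 'a \<Rightarrow> complex) \<Rightarrow> complex)
      \<Rightarrow> (nat \<Rightarrow> 'a \<Rightarrow> complex) \<Rightarrow> complex" where
  "L_op A n a c \<kappa> f =
     (\<lambda>z. if z \<in> Omega A n \<kappa> then
            (\<Sum>(i, j)\<in>ordered_pairs n. of_real (a i j) * (f z - f (perm_act n (transpose i j) z)))
              + of_real (Q_potential A n c z) * f z
          else 0)"

definition lambda_min ::
    "('a, 'm) monoid_scheme \<Rightarrow> nat \<Rightarrow> (nat \<Rightarrow> nat \<Rightarrow> real) \<Rightarrow> ((nat \<Rightarrow> 'a) \<Rightarrow> real)
      \<Rightarrow> (('a \<Rightarrow> complex) \<Rightarrow> nat) \<Rightarrow> ereal" where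
  "lambda_min A n a c \<kappa> = least_eigenvalue (fun_space (Omega A n \<kappa>)) (L_op A n a c \<kappa>)"

end

(* The wreath product Laplacian commutes with right translation by A^n, so every eigenspace contains
   a common eigenvector v of these translations, which has the form v(g; p) = <p y, g> phi(p) for a
   labelling y of {1..n} by characters. On phi the Laplacian acts as the interchange operator plus
   the potential Q(p y).

   If y is not constantly trivial, let F(z) be the l^2 norm of phi on the set of all p with p y = z.
   By the triangle inequality in l^2, the Rayleigh quotient of F for L_kappa is at most that of phi.
   Conversely, eigenfunctions F of L_kappa lift to functions phi(p) = F(p z).

   If y is trivial, the claim is Aldous' spectral gap conjecture, proved as by Caputo, Liggett and
   Richthammer by removing one vertex x and comparing with the reduced network through the octopus
   inequality. For the latter put w_x = - (sum of the other w_y), so that sum w_i = 0, and let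
   M = sum w_i w_j (i j) over all i, j. With C_S = 2 (sum of the Klein four-group) - (sum of the
   3-cycles) in the group algebra of the permutations of a 4-set S, one has
     2 (sum w_i^2) M = M^2 - (sum of w_i w_j w_k w_l C_{ijkl} over distinct i, j, k, l) / 6.
   Here only w_x is negative, and M >= 0 follows from two facts: C_S is 12 times a projection, and
   so is half of (sum of C_S over the 4-subsets S of a 5-set that contain x) - (C_S for the one that
   does not). *)

theory Submission
  imports Defs "HOL-Analysis.Function_Topology" "HOL-Analysis.L2_Norm"
    "HOL-Algebra.Multiplicative_Group"
begin

section \<open>Minimal eigenvectors of symmetric operators\<close>

text \<open>The fibre norms F forget signs, so their comparison with phi cannot make use of
  orthogonality to the constants. For nontrivial y no such condition is lost: summing over g alone
  already makes every lifted function orthogonal to the constants. For trivial y all p y coincide, F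
  is a single number, and the comparison would return nothing but the excluded eigenvalue 0. This is
  why that case needs an argument of its own.

  The induction for the spectral gap is run on an eigenvector of minimal eigenvalue, not on an
  arbitrary function. If its sum over some slice {p. p k = x} is nonzero, then the sums over {p. p k
  = y}, as a function of y, are an eigenfunction of the random walk with the same eigenvalue.
  Otherwise its restriction to each slice has sum zero, and the reduced network controls the slices
  one by one.

  In the octopus identity the square M^2 is nonnegative for free; only the quartic sum needs an
  argument. Its negative part comes from quadruples through x, whose weight is minus the total
  weight times a product of three weights. That total weight is what a fourth, free index produces
  in the five-point inequality.\<close>

lemma nonneg_quadratic_imp_linear_zero:
  fixes b c :: real
  assumes "\<And>t. 0 \<le> 2 * t * b + t^2 * c"
  shows "b = 0"
proof (rule ccontr)
  assume "b \<noteq> 0"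
  \<comment> \<open>Small enough that the quadratic term is at most half of the linear one in
    absolute value, so the whole expression is at most \<open>t * b\<close>, which is
    negative.\<close>
  define t where "t = - b / (1 + \<bar>c\<bar>)"
  have "t * (1 + \<bar>c\<bar>) = - b"
    unfolding t_def by (rule nonzero_eq_divide_eq[THEN iffD1]) auto
  have *: "t^2 * (1 + \<bar>c\<bar>) = - t * b"
    unfolding power2_eq_square mult.assoc \<open>t * (1 + \<bar>c\<bar>) = - b\<close> by simp
  have "t^2 * c \<le> t^2 * (1 + \<bar>c\<bar>)"
    by (intro mult_left_mono) auto
  then have "2 * t * b + t^2 * c \<le> t * b"
    using * by linarith
  also have "t * b = - (b^2) / (1 + \<bar>c\<bar>)"
    by (simp add: t_def power2_eq_square)
  finally have "2 * t * b + t^2 * c \<le> - (b^2) / (1 + \<bar>c\<bar>)" .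
  moreover have "- (b^2) / (1 + \<bar>c\<bar>) < 0"
    using \<open>b \<noteq> 0\<close> by (simp add: add_pos_nonneg)
  ultimately show False using assms[of t] by linarith
qed

text \<open>The Rayleigh quotient attains its minimum on the unit sphere of \<open>W\<close> by
  compactness, and a minimiser is an eigenvector. Functions on \<open>X\<close> are kept as total
  functions vanishing outside, so continuity and compactness refer to the product topology on the
  full function type. The vector \<open>v\<close> encodes the constraint: \<open>v = 1\<close> gives
  functions of sum zero, \<open>v = 0\<close> all functions on \<open>X\<close>.\<close>

lemma symmetric_operator_has_minimal_eigenvector:
  fixes T :: "('x \<Rightarrow> real) \<Rightarrow> 'x \<Rightarrow> real" and v :: "'x \<Rightarrow> real" and X
  defines "W \<equiv> {f. (\<forall>x. x \<notin> X \<longrightarrow> f x = 0) \<and> (\<Sum>x\<in>X. v x * f x) = 0}"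
  assumes X: "finite X"
    and T_W: "\<And>f. f \<in> W \<Longrightarrow> T f \<in> W"
    and lin: "\<And>f g t x. T (\<lambda>x. f x + t * g x) x = T f x + t * T g x"
    and sym: "\<And>f g. f \<in> W \<Longrightarrow> g \<in> W \<Longrightarrow> (\<Sum>x\<in>X. f x * T g x) = (\<Sum>x\<in>X. T f x * g x)"
    and cont: "\<And>x. continuous_on UNIV (\<lambda>f. T f x)"
    and ne: "\<exists>f\<in>W. f \<noteq> (\<lambda>_. 0)"
  obtains l f where "f \<in> W" "f \<noteq> (\<lambda>_. 0)" "T f = (\<lambda>x. l * f x)"
    "\<And>g. g \<in> W \<Longrightarrow> (\<Sum>x\<in>X. g x * T g x) \<ge> l * (\<Sum>x\<in>X. (g x)^2)"
proof -
  have W_lin: "(\<lambda>x. f x + t * g x) \<in> W" if "f \<in> W" "g \<in> W" for f g t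
  proof -
    have "(\<Sum>x\<in>X. v x * (f x + t * g x)) = (\<Sum>x\<in>X. v x * f x) + t * (\<Sum>x\<in>X. v x * g x)"
      by (simp add: sum_distrib_left sum.distrib algebra_simps)
    then show ?thesis using that by (auto simp: W_def)
  qed
  have W_0: "(\<lambda>_. 0) \<in> W" by (simp add: W_def)
  have T_scale: "T (\<lambda>x. t * g x) = (\<lambda>x. t * T g x)" if "g \<in> W" for g t
  proof
    fix x
    have "T (\<lambda>x. 0 + t * g x) x = T (\<lambda>_. 0) x + t * T g x" by (rule lin)
    moreover have "T (\<lambda>x. 0 + 1 * 0) x = T (\<lambda>_. 0) x + 1 * T (\<lambda>_. 0) x" by (rule lin)
    ultimately show "T (\<lambda>x. t * g x) x = t * T g x" by simp
  qed
  define E where "E f = (\<Sum>x\<in>X. f x * T f x)" for f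
  define S where "S = {f \<in> W. (\<Sum>x\<in>X. (f x)^2) = 1}"
  have norm_pos: "(\<Sum>x\<in>X. (f x)^2) > 0" if "f \<in> W" "f \<noteq> (\<lambda>_. 0)" for f
  proof -
    obtain y where "f y \<noteq> 0" using \<open>f \<noteq> (\<lambda>_. 0)\<close> by auto
    then have "y \<in> X" using \<open>f \<in> W\<close> by (auto simp: W_def)
    then show ?thesis using \<open>f y \<noteq> 0\<close> X by (intro sum_pos2[of _ y]) auto
  qed
  have normalise: "\<exists>h\<in>S. \<exists>s. g = (\<lambda>x. s * h x)" if "g \<in> W" "g \<noteq> (\<lambda>_. 0)" for g
  proof -
    define r where "r = (\<Sum>x\<in>X. (g x)^2)"
    have "r > 0" using norm_pos[OF that] by (simp add: r_def)
    have "(\<lambda>x. 0 + (1 / sqrt r) * g x) \<in> W" using W_lin[OF W_0 that(1)] .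
    moreover have "(\<Sum>x\<in>X. ((1 / sqrt r) * g x)^2) = 1"
      using \<open>r > 0\<close> by (simp add: power_mult_distrib power_divide flip: sum_divide_distrib r_def)
    ultimately have "(\<lambda>x. (1 / sqrt r) * g x) \<in> S" by (simp add: S_def)
    moreover have "g = (\<lambda>x. sqrt r * ((1 / sqrt r) * g x))" using \<open>r > 0\<close> by (auto simp: fun_eq_iff)
    ultimately show ?thesis
      by (intro bexI[where x = "\<lambda>x. (1 / sqrt r) * g x"] exI[where x = "sqrt r"])
  qed
  have cc: "continuous_on UNIV (\<lambda>f::'x \<Rightarrow> real. f x)" for x by simp
  \<comment> \<open>Pinning the coordinates outside \<open>X\<close> to 0 makes \<open>B\<close> a
    product of compact sets over all coordinates, so Tychonoff's theorem applies even to an infinite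
    type; \<open>S\<close> is a closed part of it.\<close>
  define B where "B = (\<Pi>\<^sub>E x\<in>(UNIV::'x set). if x \<in> X then {-1..1::real} else {0})"
  have "compactin (product_topology (\<lambda>i. euclidean) UNIV) B"
    unfolding B_def by (subst compactin_PiE) auto
  then have B: "compact B" by (simp add: euclidean_product_topology)
  define Z where "Z = {f::'x \<Rightarrow> real. (\<Sum>x\<in>X. v x * f x) = 0} \<inter> {f. (\<Sum>x\<in>X. (f x)^2) = 1}"
  have "closed Z" unfolding Z_def
    by (intro closed_Int closed_Collect_eq continuous_intros cc)
  have "S = Z \<inter> B"
  proof -
    have "f x \<in> {-1..1}" if "(\<Sum>x\<in>X. (f x)^2) = 1" "x \<in> X" for f :: "'x \<Rightarrow> real" and x
    proof -
      have "(f x)^2 \<le> (\<Sum>x\<in>X. (f x)^2)" using X that(2) by (intro member_le_sum) auto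
      then show ?thesis using that(1) abs_le_square_iff[of "f x" 1] by auto
    qed
    then show ?thesis
      unfolding S_def Z_def B_def W_def by (fastforce simp: PiE_iff split: if_splits)
  qed
  then have "compact S" using closed_Int_compact[OF \<open>closed Z\<close> B] by simp
  moreover have "S \<noteq> {}" using ne normalise by blast
  moreover have "continuous_on S E"
    unfolding E_def
    by (rule continuous_on_subset[OF _ subset_UNIV], rule continuous_on_sum)
      (rule continuous_on_mult[OF cc cont])
  ultimately obtain f where f: "f \<in> S" "\<And>g. g \<in> S \<Longrightarrow> E f \<le> E g"
    using continuous_attains_inf[of S E] by blast
  have "f \<in> W" using f(1) by (simp add: S_def)
  define l where "l = E f"
  have nf: "(\<Sum>x\<in>X. (f x)^2) = 1" using f(1) by (simp add: S_def)
  have min: "E g \<ge> l * (\<Sum>x\<in>X. (g x)^2)" if "g \<in> W" for g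
  proof (cases "g = (\<lambda>_. 0)")
    case True then show ?thesis by (simp add: E_def)
  next
    case False
    from normalise[OF that this] obtain h s where h: "h \<in> S" "g = (\<lambda>x. s * h x)" by blast
    have "h \<in> W" "(\<Sum>x\<in>X. (h x)^2) = 1" using h(1) by (auto simp: S_def)
    then have "E g = s^2 * E h"
      by (simp add: E_def h(2) T_scale sum_distrib_left power2_eq_square mult_ac)
    moreover have "(\<Sum>x\<in>X. (g x)^2) = s^2"
      using \<open>(\<Sum>x\<in>X. (h x)^2) = 1\<close> by (simp add: h(2) power_mult_distrib flip: sum_distrib_left)
    ultimately show ?thesis using f(2)[OF h(1)] by (simp add: l_def mult.commute mult_right_mono)
  qed
  \<comment> \<open>The residual of the eigenvalue equation lies in \<open>W\<close> and is
    therefore an admissible direction. Along \<open>f + t r\<close> the first-order coefficient of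
    the energy minus \<open>l\<close> times the squared norm is twice the squared norm of
    \<open>r\<close>, and minimality of \<open>f\<close> forces it to vanish.\<close>
  define r where "r = (\<lambda>x. T f x + (- l) * f x)"
  have "r \<in> W" unfolding r_def using \<open>f \<in> W\<close> by (intro W_lin T_W)
  have "(\<Sum>x\<in>X. r x * r x) = 0"
  proof (rule nonneg_quadratic_imp_linear_zero)
    fix t :: real
    define g where "g = (\<lambda>x. f x + t * r x)"
    have "g \<in> W" unfolding g_def using \<open>f \<in> W\<close> \<open>r \<in> W\<close> by (rule W_lin)
    have Tg: "T g = (\<lambda>x. T f x + t * T r x)" unfolding g_def by (rule ext) (rule lin)
    have "E g = E f + t * (\<Sum>x\<in>X. f x * T r x) + t * (\<Sum>x\<in>X. T f x * r x) + t^2 * E r"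
      unfolding E_def Tg unfolding g_def
      by (simp add: sum_distrib_left sum.distrib algebra_simps power2_eq_square)
    then have Eg: "E g = E f + 2 * t * (\<Sum>x\<in>X. T f x * r x) + t^2 * E r"
      using sym[OF \<open>f \<in> W\<close> \<open>r \<in> W\<close>] by simp
    have "(\<Sum>x\<in>X. (g x)^2) = 1 + 2 * t * (\<Sum>x\<in>X. f x * r x) + t^2 * (\<Sum>x\<in>X. (r x)^2)"
      unfolding nf[symmetric]
      by (simp add: g_def sum_distrib_left sum.distrib algebra_simps power2_eq_square)
    then have "l * (1 + 2 * t * (\<Sum>x\<in>X. f x * r x) + t^2 * (\<Sum>x\<in>X. (r x)^2)) \<le> E g"
      using min[OF \<open>g \<in> W\<close>] by simp
    then have "0 \<le> 2 * t * ((\<Sum>x\<in>X. T f x * r x) - l * (\<Sum>x\<in>X. f x * r x))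
        + t^2 * (E r - l * (\<Sum>x\<in>X. (r x)^2))"
      unfolding Eg l_def[symmetric] by (simp add: algebra_simps)
    also have "(\<Sum>x\<in>X. T f x * r x) - l * (\<Sum>x\<in>X. f x * r x) = (\<Sum>x\<in>X. r x * r x)"
      by (simp add: r_def sum_distrib_left sum_subtractf[symmetric] algebra_simps)
    finally show "0 \<le> 2 * t * (\<Sum>x\<in>X. r x * r x) + t^2 * (E r - l * (\<Sum>x\<in>X. (r x)^2))" .
  qed
  then have "r = (\<lambda>_. 0)"
    using norm_pos[OF \<open>r \<in> W\<close>] by (auto simp: power2_eq_square)
  then have "T f = (\<lambda>x. l * f x)" by (auto simp: r_def fun_eq_iff)
  moreover have "f \<noteq> (\<lambda>_. 0)" using nf by auto
  ultimately show ?thesis using that[OF \<open>f \<in> W\<close>] min by (simp add: E_def)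
qed

section \<open>The octopus inequality\<close>

text \<open>The positive definite function that \<open>f\<close> defines on the permutations of
  \<open>V\<close>. Extended linearly, it turns an element of the group algebra into the value of a
  quadratic form at \<open>f\<close>; inequalities between group algebra elements are stated through
  it.\<close>

definition autocorr :: "'v set \<Rightarrow> (('v \<Rightarrow> 'v) \<Rightarrow> real) \<Rightarrow> ('v \<Rightarrow> 'v) \<Rightarrow> real" where
  "autocorr V f \<sigma> = (\<Sum>p | p permutes V. f p * f (\<sigma> \<circ> p))"

lemma sum_permutes_comp_left:
  assumes "\<sigma> permutes V"
  shows "(\<Sum>p | p permutes V. F (\<sigma> \<circ> p)) = (\<Sum>p | p permutes V. F p)"
  by (rule sum.reindex_bij_witness[where i = "\<lambda>p. inv' \<sigma> \<circ> p" and j = "\<lambda>p. \<sigma> \<circ> p"])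
    (use assms in \<open>auto simp: permutes_compose permutes_inv permutes_inv_o comp_assoc[symmetric]\<close>)

lemma sum_translates_product:
  assumes "\<sigma> permutes V"
  shows "(\<Sum>p | p permutes V. f (\<sigma> \<circ> p) * f (\<rho> \<circ> \<sigma> \<circ> p)) = autocorr V f \<rho>"
  unfolding autocorr_def
  using sum_permutes_comp_left[OF assms, of "\<lambda>p. f p * f (\<rho> \<circ> p)"] by (simp add: comp_assoc)

text \<open>Transports a permutation of a small fixed type to \<open>V\<close> along an injection,
  so that an identity between permutations of four or five points, checked once by enumeration,
  holds for any distinct points of \<open>V\<close>.\<close>

definition emb :: "('p \<Rightarrow> 'v) \<Rightarrow> ('p \<Rightarrow> 'p) \<Rightarrow> 'v \<Rightarrow> 'v" where
  "emb h \<sigma> v = (if v \<in> range h then h (\<sigma> (inv' h v)) else v)"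

lemma emb_apply [simp]: "inj h \<Longrightarrow> emb h \<sigma> (h i) = h (\<sigma> i)"
  by (simp add: emb_def)

lemma emb_comp: "inj h \<Longrightarrow> emb h (\<sigma> \<circ> \<rho>) = emb h \<sigma> \<circ> emb h \<rho>"
  by (auto simp: fun_eq_iff emb_def)

lemma emb_id: "inj h \<Longrightarrow> emb h id = id"
  by (auto simp: fun_eq_iff emb_def)

lemma emb_transpose: "inj h \<Longrightarrow> emb h (transpose i j) = transpose (h i) (h j)"
  by (auto simp: fun_eq_iff emb_def transpose_def inj_eq)

lemma emb_permutes:
  assumes "inj h" "range h \<subseteq> V" "bij \<sigma>"
  shows "emb h \<sigma> permutes V"
proof -
  have "emb h \<sigma> \<circ> emb h (inv' \<sigma>) = id" "emb h (inv' \<sigma>) \<circ> emb h \<sigma> = id"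
    using emb_comp[OF assms(1), of \<sigma> "inv' \<sigma>"] emb_comp[OF assms(1), of "inv' \<sigma>" \<sigma>] assms(3)
    by (simp_all add: emb_id[OF assms(1)] bij_is_surj bij_is_inj surj_iff[THEN iffD1])
  then have "bij (emb h \<sigma>)" by (metis o_bij)
  moreover have "\<And>x. x \<notin> V \<Longrightarrow> emb h \<sigma> x = x" using assms(2) by (auto simp: emb_def)
  ultimately show ?thesis unfolding permutes_def bij_iff by blast
qed

text \<open>The hypothesis on \<open>u\<close> says \<open>u u\<^sup>* = K u\<close>
    in the group algebra, so the form is \<open>1 / K\<close> times the
  squared norm of the image of \<open>f\<close> under \<open>u\<close>.\<close>

lemma projection_form_nonneg:
  fixes h :: "'p::finite \<Rightarrow> 'v" and u :: "('p \<Rightarrow> 'p) \<Rightarrow> real"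
  assumes "inj h" "range h \<subseteq> V"
    and u: "\<And>s. bij s \<Longrightarrow> (\<Sum>p | bij p. u p * u (s \<circ> p)) = K * u s" and "K > 0"
  shows "0 \<le> (\<Sum>p | bij p. u p * autocorr V f (emb h p))"
proof -
  let ?B = "{p::'p \<Rightarrow> 'p. bij p}" and ?S = "{p. p permutes V}"
  define g where "g \<pi> = (\<Sum>p\<in>?B. u p * f (emb h p \<circ> \<pi>))" for \<pi>
  have "(\<Sum>\<pi>\<in>?S. (g \<pi>)^2)
      = (\<Sum>\<pi>\<in>?S. \<Sum>p\<in>?B. \<Sum>r\<in>?B. u p * u r * (f (emb h p \<circ> \<pi>) * f (emb h r \<circ> \<pi>)))"
    by (simp add: g_def power2_eq_square sum_product mult_ac)
  also have "\<dots> = (\<Sum>p\<in>?B. \<Sum>r\<in>?B. u p * u r * (\<Sum>\<pi>\<in>?S. f (emb h p \<circ> \<pi>) * f (emb h r \<circ> \<pi>)))"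
    by (subst sum.swap, intro sum.cong refl, subst sum.swap, simp add: sum_distrib_left)
  also have "\<dots> = (\<Sum>p\<in>?B. \<Sum>s\<in>?B. u p * u (s \<circ> p) * autocorr V f (emb h s))"
  proof (rule sum.cong[OF refl])
    fix p assume "p \<in> ?B"
    then have "bij p" by simp
    \<comment> \<open>With \<open>r = s \<circ> p\<close> the inner product depends on
      \<open>s\<close> alone, because left multiplication by \<open>emb h p\<close> permutes the
      permutations of \<open>V\<close>.\<close>
    have "(\<Sum>r\<in>?B. u p * u r * (\<Sum>\<pi>\<in>?S. f (emb h p \<circ> \<pi>) * f (emb h r \<circ> \<pi>)))
        = (\<Sum>s\<in>?B. u p * u (s \<circ> p) * (\<Sum>\<pi>\<in>?S. f (emb h p \<circ> \<pi>) * f (emb h (s \<circ> p) \<circ> \<pi>)))"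
    proof (rule sum.reindex_bij_witness[where j = "\<lambda>r. r \<circ> inv' p" and i = "\<lambda>s. s \<circ> p"])
      show "\<And>a. a \<in> ?B \<Longrightarrow> a \<circ> inv' p \<circ> p = a" "\<And>b. b \<in> ?B \<Longrightarrow> b \<circ> p \<circ> inv' p = b"
        using \<open>bij p\<close> by (auto simp: comp_assoc bij_is_inj bij_is_surj surj_iff[THEN iffD1])
      show "\<And>a. a \<in> ?B \<Longrightarrow> a \<circ> inv' p \<in> ?B" "\<And>b. b \<in> ?B \<Longrightarrow> b \<circ> p \<in> ?B"
        using \<open>bij p\<close> by (auto simp: bij_comp bij_imp_bij_inv)
    qed (use \<open>bij p\<close> in \<open>auto simp: comp_assoc bij_is_inj bij_is_surj surj_iff[THEN iffD1]\<close>)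
    also have "\<dots> = (\<Sum>s\<in>?B. u p * u (s \<circ> p) * autocorr V f (emb h s))"
      using emb_permutes[OF assms(1,2) \<open>bij p\<close>]
      by (simp add: emb_comp[OF assms(1)] sum_translates_product)
    finally show "(\<Sum>r\<in>?B. u p * u r * (\<Sum>\<pi>\<in>?S. f (emb h p \<circ> \<pi>) * f (emb h r \<circ> \<pi>))) = \<dots>" .
  qed
  also have "\<dots> = (\<Sum>s\<in>?B. (\<Sum>p\<in>?B. u p * u (s \<circ> p)) * autocorr V f (emb h s))"
    by (subst sum.swap) (simp add: sum_distrib_right)
  also have "\<dots> = K * (\<Sum>s\<in>?B. u s * autocorr V f (emb h s))"
    by (simp add: u sum_distrib_left mult_ac)
  finally have "K * (\<Sum>s\<in>?B. u s * autocorr V f (emb h s)) = (\<Sum>\<pi>\<in>?S. (g \<pi>)^2)" ..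
  then have "0 \<le> K * (\<Sum>s\<in>?B. u s * autocorr V f (emb h s))"
    by (simp add: sum_nonneg)
  then show ?thesis using \<open>K > 0\<close> by (simp add: zero_le_mult_iff)
qed

section \<open>The quadruple element \<open>C_S\<close> as a quadratic form\<close>

definition three_cycles :: "(('v \<Rightarrow> 'v) \<Rightarrow> real) \<Rightarrow> 'v \<Rightarrow> 'v \<Rightarrow> 'v \<Rightarrow> real" where
  "three_cycles q i j k =
     q (transpose i j \<circ> transpose j k) + q (transpose k j \<circ> transpose j i)"

text \<open>The coefficients 2 on the Klein four-group, -1 on the eight 3-cycles and 0 on
  transpositions and 4-cycles are the character of the two-dimensional irreducible representation of
  the symmetric group on four points. Hence \<open>C_S\<close> is 24 / 2 = 12 times the central
  projection onto the isotypic component of that representation.\<close>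

definition quad_form :: "(('v \<Rightarrow> 'v) \<Rightarrow> real) \<Rightarrow> 'v \<Rightarrow> 'v \<Rightarrow> 'v \<Rightarrow> 'v \<Rightarrow> real" where
  "quad_form q i j k l =
     2 * (q id + q (transpose i j \<circ> transpose k l) + q (transpose i k \<circ> transpose j l)
            + q (transpose i l \<circ> transpose j k))
       - (three_cycles q i j k + three_cycles q i j l + three_cycles q i k l
           + three_cycles q j k l)"

lemma quad_form_emb:
  assumes "inj h"
  shows "quad_form (\<lambda>\<sigma>. q (emb h \<sigma>)) i j k l = quad_form q (h i) (h j) (h k) (h l)"
  using assms by (simp add: quad_form_def three_cycles_def emb_comp emb_id emb_transpose)

lemma of_int_sum_list_map: "of_int (\<Sum>x\<leftarrow>xs. g x) = (\<Sum>x\<leftarrow>xs. of_int (g x))"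
  by (induction xs) auto

section \<open>Four points: positivity by enumerating 24 permutations\<close>

datatype pt4 = Q0 | Q1 | Q2 | Q3

lemma UNIV_pt4: "(UNIV :: pt4 set) = {Q0, Q1, Q2, Q3}"
  by (auto intro: pt4.exhaust)

instance pt4 :: finite
  by standard (simp add: UNIV_pt4)

fun fn4 :: "pt4 \<times> pt4 \<times> pt4 \<times> pt4 \<Rightarrow> pt4 \<Rightarrow> pt4" where
  "fn4 (a, b, c, d) p = (case p of Q0 \<Rightarrow> a | Q1 \<Rightarrow> b | Q2 \<Rightarrow> c | Q3 \<Rightarrow> d)"

definition points4 where "points4 = [Q0, Q1, Q2, Q3]"

lemma set_points4: "set points4 = UNIV"
  by (simp add: points4_def UNIV_pt4)

definition tuples4 :: "(pt4 \<times> pt4 \<times> pt4 \<times> pt4) list" where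
  "tuples4 = [(a, b, c, d). a \<leftarrow> points4, b \<leftarrow> points4, b \<noteq> a, c \<leftarrow> points4, c \<noteq> a, c \<noteq> b,
      d \<leftarrow> points4, d \<noteq> a, d \<noteq> b, d \<noteq> c]"

lemma in_tuples4: "(a, b, c, d) \<in> set tuples4 \<longleftrightarrow> distinct [a, b, c, d]"
  by (auto simp: tuples4_def set_points4)

lemma distinct_tuples4: "distinct tuples4"
  by code_simp

lemma fn4_eta: "fn4 (p Q0, p Q1, p Q2, p Q3) = p"
  by (rule ext) (simp split: pt4.split)

lemma bij_pt4: "{p. bij p} = fn4 ` set tuples4"
proof (intro equalityI subsetI)
  fix p :: "pt4 \<Rightarrow> pt4" assume "p \<in> {p. bij p}"
  then have "inj p" by (simp add: bij_is_inj)
  then have "(p Q0, p Q1, p Q2, p Q3) \<in> set tuples4"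
    by (simp add: in_tuples4 inj_eq)
  then show "p \<in> fn4 ` set tuples4" by (metis fn4_eta image_eqI)
next
  fix p assume "p \<in> fn4 ` set tuples4"
  then obtain a b c d where p: "p = fn4 (a, b, c, d)" "distinct [a, b, c, d]"
    by (auto simp: in_tuples4)
  have "inj p"
  proof (rule injI)
    fix x y show "p x = p y \<Longrightarrow> x = y" using p(2) by (cases x; cases y) (auto simp: p(1))
  qed
  then show "p \<in> {p. bij p}" by (simp add: bij_def finite_UNIV_inj_surj)
qed

lemma inj_fn4: "inj fn4"
proof (rule injI)
  fix s t assume "fn4 s = fn4 t"
  then have "fn4 s p = fn4 t p" for p by simp
  from this[of Q0] this[of Q1] this[of Q2] this[of Q3] show "s = t"
    by (cases s; cases t) simp
qed

lemma sum_bij_pt4: "(\<Sum>p | bij p. g p) = (\<Sum>t\<leftarrow>tuples4. g (fn4 t))"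
  unfolding bij_pt4
  by (subst sum.reindex)
    (simp_all add: inj_on_subset[OF inj_fn4] sum.distinct_set_conv_list distinct_tuples4)

fun comp4 where
  "comp4 s (a, b, c, d) = (fn4 s a, fn4 s b, fn4 s c, fn4 s d)"

lemma fn4_comp4: "fn4 s \<circ> fn4 t = fn4 (comp4 s t)"
  by (cases t) (auto simp: fun_eq_iff split: pt4.split)

text \<open>The coefficients of \<open>quad_form\<close>, read off the tuple of values. A
  permutation with square 1 is the identity or a double transposition if it fixes all or none of
  \<open>Q0\<close>, \<open>Q1\<close>, \<open>Q2\<close>, and a transposition otherwise. Any other
  permutation is a 3-cycle if it has a fixed point and a 4-cycle if not. Integer values make the
  convolution identity a finite computation.\<close>

fun coeff4 :: "pt4 \<times> pt4 \<times> pt4 \<times> pt4 \<Rightarrow> int" where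
  "coeff4 (a, b, c, d) =
     (if comp4 (a, b, c, d) (a, b, c, d) = (Q0, Q1, Q2, Q3)
      then (if (a = Q0) = (b = Q1) \<and> (a = Q0) = (c = Q2) then 2 else 0)
      else if a = Q0 \<or> b = Q1 \<or> c = Q2 \<or> d = Q3 then - 1 else 0)"

lemma coeff4_square:
  "\<forall>s\<in>set tuples4. (\<Sum>p\<leftarrow>tuples4. coeff4 p * coeff4 (comp4 s p)) = 12 * coeff4 s"
  by code_simp

lemma sum_coeff4:
  "(\<Sum>t\<leftarrow>tuples4. of_int (coeff4 t) * q (fn4 t)) = quad_form q Q0 Q1 Q2 Q3"
proof -
  have comp: "q (f \<circ> g) = q (fn4 (f (g Q0), f (g Q1), f (g Q2), f (g Q3)))" for f g
    using fn4_eta[of "f \<circ> g"] by simp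
  have id: "q id = q (fn4 (Q0, Q1, Q2, Q3))"
    using fn4_eta[of id] by simp
  show ?thesis
    unfolding quad_form_def three_cycles_def comp id
    apply (simp only: transpose_def if_True if_False pt4.distinct refl)
    apply (simp only: tuples4_def points4_def list.map concat.simps append.simps prod.case if_True
        if_False pt4.distinct refl not_False_eq_True not_True_eq_False)
    apply (simp only: list.map sum_list_simps coeff4.simps comp4.simps fn4.simps prod.inject
        pt4.simps if_True if_False simp_thms)
    apply simp
    done
qed

lemma autocorr_quad_form_nonneg:
  assumes "distinct [i, j, k, l]" "{i, j, k, l} \<subseteq> V"
  shows "0 \<le> quad_form (autocorr V f) i j k l"
proof -
  define h where "h p = (case p of Q0 \<Rightarrow> i | Q1 \<Rightarrow> j | Q2 \<Rightarrow> k | Q3 \<Rightarrow> l)" for p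
  define u where "u p = real_of_int (coeff4 (p Q0, p Q1, p Q2, p Q3))" for p
  have u: "u (fn4 t) = of_int (coeff4 t)" for t by (cases t) (simp add: u_def)
  have "inj h"
  proof (rule injI)
    fix x y show "h x = h y \<Longrightarrow> x = y" using assms(1) by (cases x; cases y) (auto simp: h_def)
  qed
  moreover have "range h \<subseteq> V" using assms(2) by (auto simp: h_def split: pt4.splits)
  moreover have "(\<Sum>p | bij p. u p * u (s \<circ> p)) = 12 * u s" if "bij s" for s
  proof -
    have "s \<in> fn4 ` set tuples4" using that bij_pt4 by blast
    then obtain t where t: "t \<in> set tuples4" "s = fn4 t" by blast
    have "(\<Sum>p | bij p. u p * u (s \<circ> p))
        = of_int (\<Sum>p\<leftarrow>tuples4. coeff4 p * coeff4 (comp4 t p))"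
      by (simp add: sum_bij_pt4 t(2) fn4_comp4 u of_int_sum_list_map del: fn4.simps coeff4.simps)
    then show ?thesis using coeff4_square t by (simp add: u del: fn4.simps coeff4.simps)
  qed
  ultimately have "0 \<le> (\<Sum>p | bij p. u p * autocorr V f (emb h p))"
    by (intro projection_form_nonneg[where K = 12]) auto
  also have "\<dots> = (\<Sum>t\<leftarrow>tuples4. of_int (coeff4 t) * autocorr V f (emb h (fn4 t)))"
    unfolding sum_bij_pt4 u ..
  also have "\<dots> = quad_form (\<lambda>\<sigma>. autocorr V f (emb h \<sigma>)) Q0 Q1 Q2 Q3"
    by (rule sum_coeff4)
  also have "\<dots> = quad_form (autocorr V f) i j k l"
    unfolding quad_form_emb[OF \<open>inj h\<close>] by (simp add: h_def)
  finally show ?thesis .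
qed

section \<open>Five points: positivity by enumerating 120 permutations\<close>

datatype pt5 = P0 | P1 | P2 | P3 | P4

lemma UNIV_pt5: "(UNIV :: pt5 set) = {P0, P1, P2, P3, P4}"
  by (auto intro: pt5.exhaust)

instance pt5 :: finite
  by standard (simp add: UNIV_pt5)

fun fn5 :: "pt5 \<times> pt5 \<times> pt5 \<times> pt5 \<times> pt5 \<Rightarrow> pt5 \<Rightarrow> pt5" where
  "fn5 (a, b, c, d, e) p = (case p of P0 \<Rightarrow> a | P1 \<Rightarrow> b | P2 \<Rightarrow> c | P3 \<Rightarrow> d | P4 \<Rightarrow> e)"

definition points5 where "points5 = [P0, P1, P2, P3, P4]"

lemma set_points5: "set points5 = UNIV"
  by (simp add: points5_def UNIV_pt5)

definition tuples5 :: "(pt5 \<times> pt5 \<times> pt5 \<times> pt5 \<times> pt5) list" where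
  "tuples5 = [(a, b, c, d, e). a \<leftarrow> points5, b \<leftarrow> points5, b \<noteq> a, c \<leftarrow> points5, c \<noteq> a, c \<noteq> b,
      d \<leftarrow> points5, d \<noteq> a, d \<noteq> b, d \<noteq> c,
      e \<leftarrow> points5, e \<noteq> a, e \<noteq> b, e \<noteq> c, e \<noteq> d]"

lemma in_tuples5: "(a, b, c, d, e) \<in> set tuples5 \<longleftrightarrow> distinct [a, b, c, d, e]"
  by (auto simp: tuples5_def set_points5)

lemma distinct_tuples5: "distinct tuples5"
  by code_simp

lemma fn5_eta: "fn5 (p P0, p P1, p P2, p P3, p P4) = p"
  by (rule ext) (simp split: pt5.split)

lemma bij_pt5: "{p. bij p} = fn5 ` set tuples5"
proof (intro equalityI subsetI)
  fix p :: "pt5 \<Rightarrow> pt5" assume "p \<in> {p. bij p}"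
  then have "inj p" by (simp add: bij_is_inj)
  then have "(p P0, p P1, p P2, p P3, p P4) \<in> set tuples5"
    by (simp add: in_tuples5 inj_eq)
  then show "p \<in> fn5 ` set tuples5" by (metis fn5_eta image_eqI)
next
  fix p assume "p \<in> fn5 ` set tuples5"
  then obtain a b c d e where p: "p = fn5 (a, b, c, d, e)" "distinct [a, b, c, d, e]"
    by (auto simp: in_tuples5)
  have "inj p"
  proof (rule injI)
    fix x y show "p x = p y \<Longrightarrow> x = y" using p(2) by (cases x; cases y) (auto simp: p(1))
  qed
  then show "p \<in> {p. bij p}" by (simp add: bij_def finite_UNIV_inj_surj)
qed

lemma inj_fn5: "inj fn5"
proof (rule injI)
  fix s t assume "fn5 s = fn5 t"
  then have "fn5 s p = fn5 t p" for p by simp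
  from this[of P0] this[of P1] this[of P2] this[of P3] this[of P4] show "s = t"
    by (cases s; cases t) simp
qed

lemma sum_bij_pt5: "(\<Sum>p | bij p. g p) = (\<Sum>t\<leftarrow>tuples5. g (fn5 t))"
  unfolding bij_pt5
  by (subst sum.reindex)
    (simp_all add: inj_on_subset[OF inj_fn5] sum.distinct_set_conv_list distinct_tuples5)

fun comp5 where
  "comp5 s (a, b, c, d, e) = (fn5 s a, fn5 s b, fn5 s c, fn5 s d, fn5 s e)"

lemma fn5_comp5: "fn5 s \<circ> fn5 t = fn5 (comp5 s t)"
  by (cases t) (auto simp: fun_eq_iff split: pt5.split)

text \<open>\<open>P0\<close> is the distinguished point and \<open>m\<close> the number of fixed
  points. The identity gets (4 * 2 - 2) / 2 = 3. A 3-cycle (\<open>m = 2\<close>) lies in two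
  4-subsets: both contain \<open>P0\<close> if it moves \<open>P0\<close>, giving (-1 - 1) / 2 = -1,
  while the two contributions cancel if it fixes \<open>P0\<close>. A double transposition
  (\<open>m = 1\<close> and square 1) lies in one 4-subset, its support, and gets 1 or -1 according
  to whether that contains \<open>P0\<close>.\<close>

fun coeff5 :: "pt5 \<times> pt5 \<times> pt5 \<times> pt5 \<times> pt5 \<Rightarrow> int" where
  "coeff5 (a, b, c, d, e) =
     (let m = length (filter id [a = P0, b = P1, c = P2, d = P3, e = P4])
      in if m = 5 then 3
         else if m = 2 then (if a = P0 then 0 else - 1)
         else if m = 1 \<and> comp5 (a, b, c, d, e) (a, b, c, d, e) = (P0, P1, P2, P3, P4)
           then (if a = P0 then - 1 else 1)
         else 0)"

text \<open>The five elements \<open>C_S\<close> add up to a central element. It acts as 24 on the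
  five-dimensional irreducible representations of shapes (3,2) and (2,2,1), the ones whose
  restriction to four points contains the two-dimensional representation, and as 0 on the others.
  Half of it is 12 times a projection whose range contains that of \<open>C_S / 12\<close> for the
  set without \<open>P0\<close>, and a difference of such nested projections is a
  projection.\<close>

lemma coeff5_square:
  "\<forall>s\<in>set tuples5. (\<Sum>p\<leftarrow>tuples5. coeff5 p * coeff5 (comp5 s p)) = 12 * coeff5 s"
  by code_simp

lemma sum_coeff5:
  "2 * (\<Sum>t\<leftarrow>tuples5. of_int (coeff5 t) * q (fn5 t)) =
     quad_form q P0 P2 P3 P4 + quad_form q P0 P1 P3 P4 + quad_form q P0 P1 P2 P4
       + quad_form q P0 P1 P2 P3 - quad_form q P1 P2 P3 P4"
proof -
  have comp: "q (f \<circ> g) = q (fn5 (f (g P0), f (g P1), f (g P2), f (g P3), f (g P4)))" for f g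
    using fn5_eta[of "f \<circ> g"] by simp
  have id: "q id = q (fn5 (P0, P1, P2, P3, P4))"
    using fn5_eta[of id] by simp
  show ?thesis
    unfolding quad_form_def three_cycles_def comp id
    apply (simp only: transpose_def if_True if_False pt5.distinct refl)
    apply (simp only: tuples5_def points5_def list.map concat.simps append.simps prod.case if_True
        if_False pt5.distinct refl not_False_eq_True not_True_eq_False)
    apply (simp only: list.map sum_list_simps coeff5.simps comp5.simps fn5.simps prod.inject
        pt5.simps if_True if_False simp_thms)
    apply simp
    done
qed

lemma autocorr_quad_form_le:
  fixes f :: "('v \<Rightarrow> 'v) \<Rightarrow> real"
  assumes "distinct [x, i, j, k, l]" "{x, i, j, k, l} \<subseteq> V"
  defines "c \<equiv> quad_form (autocorr V f)"
  shows "c i j k l \<le> c x j k l + c x i k l + c x i j l + c x i j k"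
proof -
  define h where "h p = (case p of P0 \<Rightarrow> x | P1 \<Rightarrow> i | P2 \<Rightarrow> j | P3 \<Rightarrow> k | P4 \<Rightarrow> l)" for p
  define u where "u p = real_of_int (coeff5 (p P0, p P1, p P2, p P3, p P4))" for p
  have u: "u (fn5 t) = of_int (coeff5 t)" for t by (cases t) (simp add: u_def)
  have "inj h"
  proof (rule injI)
    fix a b show "h a = h b \<Longrightarrow> a = b" using assms(1) by (cases a; cases b) (auto simp: h_def)
  qed
  moreover have "range h \<subseteq> V" using assms(2) by (auto simp: h_def split: pt5.splits)
  moreover have "(\<Sum>p | bij p. u p * u (s \<circ> p)) = 12 * u s" if "bij s" for s
  proof -
    have "s \<in> fn5 ` set tuples5" using that bij_pt5 by blast
    then obtain t where t: "t \<in> set tuples5" "s = fn5 t" by blast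
    have "(\<Sum>p | bij p. u p * u (s \<circ> p))
        = of_int (\<Sum>p\<leftarrow>tuples5. coeff5 p * coeff5 (comp5 t p))"
      by (simp add: sum_bij_pt5 t(2) fn5_comp5 u of_int_sum_list_map del: fn5.simps coeff5.simps)
    then show ?thesis using coeff5_square t by (simp add: u del: fn5.simps coeff5.simps)
  qed
  ultimately have "0 \<le> (\<Sum>p | bij p. u p * autocorr V f (emb h p))"
    by (intro projection_form_nonneg[where K = 12]) auto
  also have "\<dots> = (\<Sum>t\<leftarrow>tuples5. of_int (coeff5 t) * autocorr V f (emb h (fn5 t)))"
    unfolding sum_bij_pt5 u ..
  \<comment> \<open>The factor 2 undoes the halving built into \<open>coeff5\<close>.\<close>
  finally have "0 \<le> 2 * (\<Sum>t\<leftarrow>tuples5. of_int (coeff5 t) * autocorr V f (emb h (fn5 t)))"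
    by simp
  then show ?thesis
    unfolding sum_coeff5[where q = "\<lambda>\<sigma>. autocorr V f (emb h \<sigma>)"] quad_form_emb[OF \<open>inj h\<close>]
    by (simp add: h_def c_def)
qed

section \<open>Index symmetries and the expansion of the square of \<open>M\<close>\<close>

lemma transpose_cycle:
  assumes "distinct [i, j, k]"
  shows "transpose i j \<circ> transpose j k = transpose j k \<circ> transpose k i"
  using assms by (auto simp: fun_eq_iff transpose_def)

lemma transpose_disjoint_commute:
  assumes "distinct [i, j, k, l]"
  shows "transpose i j \<circ> transpose k l = transpose k l \<circ> transpose i j"
  using assms by (auto simp: fun_eq_iff transpose_def)

lemma three_cycles_rotate: "distinct [i, j, k] \<Longrightarrow> three_cycles q i j k = three_cycles q j k i"
  using transpose_cycle[of i j k] transpose_cycle[of i k j]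
  by (auto simp: three_cycles_def transpose_commute)

lemma three_cycles_reverse: "three_cycles q i j k = three_cycles q k j i"
  by (simp add: three_cycles_def)

text \<open>Extended by zero, so that a sum over distinct quadruples becomes an unrestricted sum in
  which indices can be renamed freely.\<close>

definition distinct_quad_form where
  "distinct_quad_form q i j k l = (if distinct [i, j, k, l] then quad_form q i j k l else 0)"

text \<open>\<open>C_S\<close> depends only on the set \<open>S\<close>; the three adjacent swaps
  generate all reorderings of the four indices.\<close>

lemma distinct_quad_form_swap:
  "distinct_quad_form q i j k l = distinct_quad_form q j i k l" (is ?a)
  "distinct_quad_form q i j k l = distinct_quad_form q i k j l" (is ?b)
  "distinct_quad_form q i j k l = distinct_quad_form q i j l k" (is ?c)
proof -
  have "?a \<and> ?b \<and> ?c"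
  proof (cases "distinct [i, j, k, l]")
    case True
    have t: "three_cycles q a b c = three_cycles q b a c" "three_cycles q a b c
        = three_cycles q a c b"
      if "distinct [a, b, c]" for a b c
      using three_cycles_rotate[of a b c q] three_cycles_rotate[of b c a q]
          three_cycles_reverse[of q] that
      by auto
    have d: "q (transpose i k \<circ> transpose j l) = q (transpose j l \<circ> transpose i k)"
      "q (transpose i l \<circ> transpose j k) = q (transpose j k \<circ> transpose i l)"
      using True transpose_disjoint_commute[of i k j l] transpose_disjoint_commute[of i l j k]
          by auto
    have tt: "three_cycles q i j k = three_cycles q j i k" "three_cycles q i j k
        = three_cycles q i k j"
      "three_cycles q i j l = three_cycles q j i l" "three_cycles q j k l = three_cycles q k j l"
      "three_cycles q j k l = three_cycles q j l k" "three_cycles q i k l = three_cycles q i l k"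
      using True by (auto intro!: t)
    have "quad_form q i j k l = quad_form q j i k l"
      unfolding quad_form_def transpose_commute[of j i] by (simp add: d tt(1,3))
    moreover have "quad_form q i j k l = quad_form q i k j l"
      unfolding quad_form_def transpose_commute[of k j] by (simp add: tt(2,4))
    moreover have "quad_form q i j k l = quad_form q i j l k"
      unfolding quad_form_def transpose_commute[of l k] by (simp add: tt(5,6))
    ultimately show ?thesis using True by (auto simp: distinct_quad_form_def)
  qed (auto simp: distinct_quad_form_def)
  then show ?a ?b ?c by auto
qed

text \<open>The values on coinciding indices are chosen such that the next lemma holds for all indices.\<close>

definition triple_form where
  "triple_form q i j k =
     (if distinct [i, j, k] then three_cycles q i j k
      else if i = j \<and> j = k then - q id else q id)"

lemma triple_form_swap:
  "triple_form q i j k = triple_form q j i k"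
  "triple_form q i j k = triple_form q i k j"
  using three_cycles_rotate[of i j k q] three_cycles_rotate[of j k i q] three_cycles_reverse[of q]
  by (auto simp: triple_form_def)

text \<open>The expansion of \<open>M^2\<close> before summation. For distinct indices it is the
  definition of \<open>quad_form\<close>. At coinciding indices the products of transpositions
  degenerate to 3-cycles, transpositions or the identity, and the values of
  \<open>triple_form\<close> absorb everything except the six terms on the right with a single
  transposition. On the left, \<open>q id\<close> and each \<open>triple_form\<close> involve at
  most three indices, so they will disappear against weights of sum zero.\<close>

lemma quad_form_decomposition:
  assumes comm: "\<And>i j k l. {i, j, k, l} \<subseteq> V
      \<Longrightarrow> q (transpose i j \<circ> transpose k l) = q (transpose k l \<circ> transpose i j)"
    and "{i, j, k, l} \<subseteq> V"
  shows "2 * (q id + q (transpose i j \<circ> transpose k l) + q (transpose i k \<circ> transpose j l)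
      + q (transpose i l \<circ> transpose j k))
     - (triple_form q i j k + triple_form q i j l + triple_form q i k l + triple_form q j k l)
   = distinct_quad_form q i j k l
     + 2 * (of_bool (i = j) * q (transpose k l) + of_bool (i = k) * q (transpose j l)
          + of_bool (i = l) * q (transpose j k) + of_bool (j = k) * q (transpose i l)
          + of_bool (j = l) * q (transpose i k) + of_bool (k = l) * q (transpose i j))"
    (is "?L i j k l = ?R i j k l")
proof -
  define P where "P i j k l \<longleftrightarrow> ?L i j k l = ?R i j k l" for i j k l
  have swap: "P i j k l = P j i k l" "P i j k l = P i k j l" "P i j k l = P i j l k"
    if "{i, j, k, l} \<subseteq> V" for i j k l
  proof -
    define r where "r i j k l = q (transpose i j \<circ> transpose k l)" for i j k l
    have r: "r a b c d = r b a c d" "r a b c d = r a b d c" for a b c d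
      by (simp_all only: r_def transpose_commute)
    have c: "r i k j l = r j l i k" "r i l j k = r j k i l"
      unfolding r_def using that by (auto intro!: comm)
    have "?L i j k l = ?L j i k l"
      unfolding r_def[symmetric]
      by (simp add: c r(1)[of i j k l] triple_form_swap(1)[of q i j k] triple_form_swap(1)[of q i
          j l])
    moreover have "?L i j k l = ?L i k j l"
      unfolding r_def[symmetric]
      by (simp add: r(2)[of i l j k] triple_form_swap(2)[of q i j k] triple_form_swap(1)[of q j k
          l])
    moreover have "?L i j k l = ?L i j l k"
      unfolding r_def[symmetric]
      by (simp add: r(2)[of i j k l] triple_form_swap(2)[of q j k l] triple_form_swap(2)[of q i k
          l])
    ultimately have L: "?L i j k l = ?L j i k l" "?L i j k l = ?L i k j l" "?L i j k l = ?L i j l k"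
      by blast+
    have R: "?R i j k l = ?R j i k l" "?R i j k l = ?R i k j l" "?R i j k l = ?R i j l k"
      by (simp_all add: distinct_quad_form_swap(1)[of q j i k l]
          distinct_quad_form_swap(2)[of q i k j l] distinct_quad_form_swap(3)[of q i j l k]
              transpose_commute[of j i]
          transpose_commute[of k j] transpose_commute[of l k] eq_commute[of j i] eq_commute[of k j]
          eq_commute[of l k])
    show "P i j k l = P j i k l" unfolding P_def L(1) R(1) ..
    show "P i j k l = P i k j l" unfolding P_def L(2) R(2) ..
    show "P i j k l = P i j l k" unfolding P_def L(3) R(3) ..
  qed
  \<comment> \<open>By the adjacent swaps any coincidence can be moved to the first two indices. For
    distinct \<open>i\<close>, \<open>k\<close>, \<open>l\<close> the products that remain are the
    3-cycles on these points, and \<open>comm\<close> makes \<open>q\<close> agree on a 3-cycle and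
    its inverse.\<close>
  have two_equal: "P i i k l" if "{i, k, l} \<subseteq> V" for i k l
  proof (cases "distinct [i, k, l]")
    case True
    have d: "distinct [i, k, l]" "distinct [k, l, i]" using True by auto
    have ikl: "q (transpose i k \<circ> transpose k l) = q (transpose i k \<circ> transpose i l)"
      unfolding trans[OF transpose_cycle[OF d(1)] transpose_cycle[OF d(2)]] transpose_commute[of l
          i]
      using that by (intro comm) auto
    have ilk: "q (transpose l k \<circ> transpose k i) = q (transpose i k \<circ> transpose i l)"
      unfolding ikl[symmetric] transpose_commute[of l k] transpose_commute[of k i]
      using that by (intro comm) auto
    define r e where "r = q (transpose i k \<circ> transpose i l)" and "e = q id"
    have "q (transpose i l \<circ> transpose i k) = r"
      unfolding r_def using that by (intro comm) auto
    moreover have "three_cycles q i k l = 2 * r"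
      unfolding three_cycles_def ikl ilk r_def by (rule mult_2[symmetric])
    ultimately show ?thesis
      unfolding P_def triple_form_def distinct_quad_form_def r_def[symmetric] e_def[symmetric]
        transpose_same id_o
      using True by simp
  next
    case False
    define e where "e = q id"
    note defs = P_def triple_form_def distinct_quad_form_def
    note reduce = transpose_same id_o o_id transpose_comp_involutory transpose_commute[of k i]
      e_def[symmetric]
    from False consider "i = k" | "i = l" | "k = l" by auto
    then show ?thesis
    proof cases
      case 1
      then show ?thesis unfolding defs by (cases "i = l") (simp_all only: reduce, simp_all)
    next
      case 2
      then show ?thesis unfolding defs by (cases "i = k") (simp_all only: reduce, simp_all)
    next
      case 3
      then show ?thesis unfolding defs by (cases "i = k") (simp_all only: reduce, simp_all)
    qed
  qed
  have "P i j k l"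
  proof (cases "distinct [i, j, k, l]")
    case True
    define r e where "r a b c d = q (transpose a b \<circ> transpose c d)" and "e = q id" for a b c d
    show ?thesis
      unfolding P_def distinct_quad_form_def triple_form_def quad_form_def
        r_def[symmetric] e_def[symmetric]
      using True by simp
  next
    case False
    have V: "i \<in> V" "j \<in> V" "k \<in> V" "l \<in> V" using assms(2) by auto
    consider "i = j" | "i = k" | "i = l" | "j = k" | "j = l" | "k = l" using False by auto
    then show ?thesis
    proof cases
      case 1 then show ?thesis using two_equal V by simp
    next
      case 2
      have "P i j i l = P i i j l" using swap(2) V by simp
      then show ?thesis using 2 two_equal V by simp
    next
      case 3
      have "P i j k i = P i j i k" "P i j i k = P i i j k" using swap(2,3) V by simp_all
      then show ?thesis using 3 two_equal V by simp
    next
      case 4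
      have "P i j j l = P j i j l" "P j i j l = P j j i l" using swap(1,2) V by simp_all
      then show ?thesis using 4 two_equal V by simp
    next
      case 5
      have "P i j k j = P i j j k" "P i j j k = P j i j k" "P j i j k = P j j i k"
        using swap(1,2,3) V by simp_all
      then show ?thesis using 5 two_equal V by simp
    next
      case 6
      have "P i j k k = P i k j k" "P i k j k = P k i j k" "P k i j k = P k i k j" "P k i k j
          = P k k i j"
        using swap(1,2,3) V by simp_all
      then show ?thesis using 6 two_equal V by simp
    qed
  qed
  then show ?thesis by (simp only: P_def)
qed

definition sum4 :: "'v set \<Rightarrow> ('v \<Rightarrow> real) \<Rightarrow> ('v \<Rightarrow> 'v \<Rightarrow> 'v \<Rightarrow> 'v \<Rightarrow> real) \<Rightarrow> real" where
  "sum4 V w F = (\<Sum>i\<in>V. \<Sum>j\<in>V. \<Sum>k\<in>V. \<Sum>l\<in>V. w i * w j * w k * w l * F i j k l)"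

lemma sum4_swap:
  "sum4 V w (\<lambda>i j k l. F j i k l) = sum4 V w F"
  "sum4 V w (\<lambda>i j k l. F i k j l) = sum4 V w F"
  "sum4 V w (\<lambda>i j k l. F i j l k) = sum4 V w F"
proof -
  show "sum4 V w (\<lambda>i j k l. F j i k l) = sum4 V w F"
    unfolding sum4_def by (subst sum.swap) (simp only: mult_ac)
  show "sum4 V w (\<lambda>i j k l. F i k j l) = sum4 V w F"
    unfolding sum4_def by (rule sum.cong[OF refl], subst sum.swap) (simp only: mult_ac)
  show "sum4 V w (\<lambda>i j k l. F i j l k) = sum4 V w F"
    unfolding sum4_def
    by (rule sum.cong[OF refl], rule sum.cong[OF refl], subst sum.swap) (simp only: mult_ac)
qed

lemma sum4_add: "sum4 V w (\<lambda>i j k l. F i j k l + G i j k l) = sum4 V w F + sum4 V w G"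
  by (simp add: sum4_def sum.distrib distrib_left)

lemma sum4_diff: "sum4 V w (\<lambda>i j k l. F i j k l - G i j k l) = sum4 V w F - sum4 V w G"
  by (simp add: sum4_def sum_subtractf right_diff_distrib)

lemma sum4_cmult: "sum4 V w (\<lambda>i j k l. t * F i j k l) = t * sum4 V w F"
  by (simp add: sum4_def sum_distrib_left mult_ac)

lemma sum4_cong:
  "(\<And>i j k l. {i, j, k, l} \<subseteq> V \<Longrightarrow> F i j k l = G i j k l) \<Longrightarrow> sum4 V w F = sum4 V w G"
  by (simp add: sum4_def)

lemma sum4_mono:
  assumes "\<And>i. i \<in> V \<Longrightarrow> 0 \<le> w i"
    and "\<And>i j k l. {i, j, k, l} \<subseteq> V \<Longrightarrow> F i j k l \<le> G i j k l"
  shows "sum4 V w F \<le> sum4 V w G"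
  unfolding sum4_def using assms by (intro sum_mono mult_left_mono mult_nonneg_nonneg) auto

lemma sum4_independent_of_last:
  assumes "(\<Sum>i\<in>V. w i) = 0"
  shows "sum4 V w (\<lambda>i j k l. G i j k) = 0"
proof -
  have "sum4 V w (\<lambda>i j k l. G i j k) = (\<Sum>i\<in>V. \<Sum>j\<in>V. \<Sum>k\<in>V. w i * w j * w k * G i j k * (\<Sum>l\<in>V. w l))"
    by (simp only: sum4_def sum_distrib_left sum_distrib_right mult_ac)
  then show ?thesis by (simp add: assms)
qed

lemma sum4_last_equal:
  assumes "finite V"
  shows "sum4 V w (\<lambda>i j k l. of_bool (k = l) * H i j)
    = (\<Sum>i\<in>V. (w i)^2) * (\<Sum>i\<in>V. \<Sum>j\<in>V. w i * w j * H i j)"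
proof -
  have "(\<Sum>k\<in>V. \<Sum>l\<in>V. w i * w j * w k * w l * (of_bool (k = l) * H i j))
      = (\<Sum>k\<in>V. (w k)^2) * (w i * w j * H i j)" if "i \<in> V" "j \<in> V" for i j
  proof -
    have "(\<Sum>l\<in>V. w i * w j * w k * w l * (of_bool (k = l) * H i j)) = (w k)^2 * (w i * w j * H i j)"
      if "k \<in> V" for k
    proof -
      have "(\<Sum>l\<in>V. w i * w j * w k * w l * (of_bool (k = l) * H i j))
          = (\<Sum>l\<in>V. if k = l then (w k)^2 * (w i * w j * H i j) else 0)"
        by (intro sum.cong) (auto simp: power2_eq_square)
      then show ?thesis using assms \<open>k \<in> V\<close> by simp
    qed
    then show ?thesis by (simp add: sum_distrib_right)
  qed
  then show ?thesis by (simp add: sum4_def sum_distrib_left)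
qed

text \<open>The three ways to pair four indices have equal weighted sums after renaming, which gives
  the factor 2 * 3 on the left. Each of the six coincidence terms contributes the sum of squares
  times the value of \<open>M\<close>, which gives 2 * 6 on the right. All terms that leave an index
  free vanish because the weights sum to zero.\<close>

lemma weighted_square_expansion:
  assumes "finite V" and zero: "(\<Sum>i\<in>V. w i) = 0"
    and comm: "\<And>i j k l. {i, j, k, l} \<subseteq> V
      \<Longrightarrow> q (transpose i j \<circ> transpose k l) = q (transpose k l \<circ> transpose i j)"
  shows "6 * sum4 V w (\<lambda>i j k l. q (transpose i j \<circ> transpose k l))
    = sum4 V w (distinct_quad_form q)
      + 12 * ((\<Sum>i\<in>V. (w i)^2) * (\<Sum>i\<in>V. \<Sum>j\<in>V. w i * w j * q (transpose i j)))"
proof -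
  let ?S = "sum4 V w"
  define r where "r i j k l = q (transpose i j \<circ> transpose k l)" for i j k l
  define e where "e = q id"
  define t where "t i j = q (transpose i j)" for i j
  define M where "M = (\<Sum>i\<in>V. (w i)^2) * (\<Sum>i\<in>V. \<Sum>j\<in>V. w i * w j * t i j)"
  have r: "?S (\<lambda>i j k l. r i k j l) = ?S r" "?S (\<lambda>i j k l. r i l j k) = ?S r"
    using sum4_swap(2)[of V w r] sum4_swap(3)[of V w "\<lambda>i j k l. r i k j l"] by simp_all
  have "?S (\<lambda>i j k l. e) = 0" by (rule sum4_independent_of_last[OF zero, where G = "\<lambda>_ _ _. e"])
  moreover have "?S (\<lambda>i j k l. triple_form q i j k) = 0" by (rule sum4_independent_of_last[OF zero])
  moreover have "?S (\<lambda>i j k l. triple_form q i j l) = 0" "?S (\<lambda>i j k l. triple_form q i k l) = 0"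
    "?S (\<lambda>i j k l. triple_form q j k l) = 0"
    using sum4_swap(3)[of V w "\<lambda>i j k l. triple_form q i j k"]
      sum4_swap(2)[of V w "\<lambda>i j k l. triple_form q i j l"]
      sum4_swap(1)[of V w "\<lambda>i j k l. triple_form q i k l"]
      sum4_independent_of_last[OF zero, of "triple_form q"] by simp_all
  ultimately have L: "?S (\<lambda>i j k l. 2 * (e + r i j k l + r i k j l + r i l j k)
      - (triple_form q i j k + triple_form q i j l + triple_form q i k l + triple_form q j k l))
          = 6 * ?S r"
    by (simp only: sum4_add sum4_diff sum4_cmult r) simp
  have
    kl: "?S (\<lambda>i j k l. of_bool (k = l) * t i j) = M"
    unfolding M_def by (rule sum4_last_equal[OF \<open>finite V\<close>])
  have
    jl: "?S (\<lambda>i j k l. of_bool (j = l) * t i k) = M"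
    using sum4_swap(2)[of V w "\<lambda>i j k l. of_bool (k = l) * t i j"] kl by simp
  have
    il: "?S (\<lambda>i j k l. of_bool (i = l) * t j k) = M"
    using sum4_swap(1)[of V w "\<lambda>i j k l. of_bool (j = l) * t i k"] jl by simp
  have
    jk: "?S (\<lambda>i j k l. of_bool (j = k) * t i l) = M"
    using sum4_swap(3)[of V w "\<lambda>i j k l. of_bool (j = l) * t i k"] jl by simp
  have
    ik: "?S (\<lambda>i j k l. of_bool (i = k) * t j l) = M"
    using sum4_swap(1)[of V w "\<lambda>i j k l. of_bool (j = k) * t i l"] jk by simp
  have
    ij: "?S (\<lambda>i j k l. of_bool (i = j) * t k l) = M"
    using sum4_swap(2)[of V w "\<lambda>i j k l. of_bool (i = k) * t j l"] ik by simp
  have "?S (\<lambda>i j k l. 2 * (e + r i j k l + r i k j l + r i l j k)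
      - (triple_form q i j k + triple_form q i j l + triple_form q i k l + triple_form q j k l))
    = ?S (\<lambda>i j k l. distinct_quad_form q i j k l
     + 2 * (of_bool (i = j) * t k l + of_bool (i = k) * t j l
          + of_bool (i = l) * t j k + of_bool (j = k) * t i l
          + of_bool (j = l) * t i k + of_bool (k = l) * t i j))"
    unfolding r_def e_def t_def
    by (rule sum4_cong, rule quad_form_decomposition[where q = q and V = V], rule comm)
  also have "\<dots> = ?S (distinct_quad_form q) + 2 * (6 * M)"
    by (simp only: sum4_add sum4_cmult ij ik il jk jl kl) simp
  finally have "6 * ?S r = ?S (distinct_quad_form q) + 12 * M" unfolding L by simp
  then show ?thesis unfolding M_def r_def t_def .
qed

text \<open>\<open>autocorr V f\<close> agrees at mutually inverse permutations, and the two
  products are inverse to each other.\<close>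

lemma autocorr_transpose_comm:
  assumes "{i, j, k, l} \<subseteq> V"
  shows "autocorr V f (transpose i j \<circ> transpose k l)
    = autocorr V f (transpose k l \<circ> transpose i j)"
proof -
  have "transpose k l \<circ> transpose i j permutes V"
    using assms by (intro permutes_compose permutes_swap_id) auto
  from sum_translates_product[OF this, where \<rho> = "transpose i j \<circ> transpose k l" and f = f]
  have "(\<Sum>p | p permutes V. f (transpose k l \<circ> transpose i j \<circ> p) * f p)
      = autocorr V f (transpose i j \<circ> transpose k l)"
    by (simp add: comp_def)
  then show ?thesis unfolding autocorr_def by (simp add: mult.commute)
qed

text \<open>The value of \<open>M^2\<close>. Transpositions are self-inverse, so \<open>M\<close> is
  self-adjoint and this value is the squared norm of \<open>g\<close>, the image of \<open>f\<close>
  under \<open>M\<close>.\<close>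

lemma autocorr_sum4_nonneg:
  "0 \<le> sum4 V w (\<lambda>i j k l. autocorr V f (transpose i j \<circ> transpose k l))"
proof -
  let ?P = "{p. p permutes V}"
  define g where "g p = (\<Sum>i\<in>V. \<Sum>j\<in>V. w i * w j * f (transpose i j \<circ> p))" for p
  have ac: "autocorr V f (transpose i j \<circ> transpose k l)
      = (\<Sum>p\<in>?P. f (transpose i j \<circ> p) * f (transpose k l \<circ> p))"
    if "k \<in> V" "l \<in> V" for i j k l
  proof -
    have "transpose k l permutes V" using that by (rule permutes_swap_id)
    from sum_translates_product[OF this, where \<rho> = "transpose i j \<circ> transpose k l" and f = f]
    show ?thesis by (simp add: comp_def mult.commute)
  qed
  have "0 \<le> (\<Sum>p\<in>?P. g p * g p)" by (intro sum_nonneg) simp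
  also have "(\<Sum>p\<in>?P. g p * g p) = (\<Sum>p\<in>?P. \<Sum>i\<in>V. \<Sum>j\<in>V. \<Sum>k\<in>V. \<Sum>l\<in>V.
      w i * w j * w k * w l * (f (transpose i j \<circ> p) * f (transpose k l \<circ> p)))"
    unfolding g_def sum_distrib_right unfolding sum_distrib_left by (simp only: mult_ac)
  also have "\<dots> = (\<Sum>i\<in>V. \<Sum>j\<in>V. \<Sum>k\<in>V. \<Sum>l\<in>V. \<Sum>p\<in>?P.
      w i * w j * w k * w l * (f (transpose i j \<circ> p) * f (transpose k l \<circ> p)))"
    by (subst sum.swap, rule sum.cong[OF refl], subst sum.swap, rule sum.cong[OF refl],
        subst sum.swap, rule sum.cong[OF refl], subst sum.swap, rule refl)
  also have "\<dots> = sum4 V w (\<lambda>i j k l. autocorr V f (transpose i j \<circ> transpose k l))"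
    unfolding sum4_def by (intro sum.cong refl) (simp only: ac sum_distrib_left)
  finally show ?thesis .
qed

section \<open>Swap energies and the octopus inequality\<close>

definition swap_energy :: "'v set \<Rightarrow> (('v \<Rightarrow> 'v) \<Rightarrow> real) \<Rightarrow> 'v \<Rightarrow> 'v \<Rightarrow> real" where
  "swap_energy V f i j = (\<Sum>p | p permutes V. (f p - f (transpose i j \<circ> p))^2)"

text \<open>The sum runs over all permutations, so each pair \<open>p\<close>,
  \<open>transpose i j \<circ> p\<close> is counted twice: \<open>swap_energy\<close> is twice the
  Dirichlet form of a single transposition.\<close>

lemma swap_energy_eq:
  assumes "i \<in> V" "j \<in> V"
  shows "swap_energy V f i j
    = 2 * autocorr V f id - 2 * autocorr V f (transpose i j)"
proof -
  have "(\<Sum>p | p permutes V. (f (transpose i j \<circ> p))^2) = (\<Sum>p | p permutes V. (f p)^2)"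
    using sum_permutes_comp_left[OF permutes_swap_id[OF assms], of "\<lambda>p. (f p)^2"] .
  moreover have "(\<Sum>p\<in>P. (f p - g p)^2)
      = (\<Sum>p\<in>P. (f p)^2) + (\<Sum>p\<in>P. (g p)^2) - 2 * (\<Sum>p\<in>P. f p * g p)" for g and P
    by (simp add: power2_diff sum.distrib sum_subtractf sum_distrib_left mult.assoc)
  moreover have "autocorr V f id = (\<Sum>p | p permutes V. (f p)^2)"
    by (simp add: autocorr_def power2_eq_square)
  ultimately show ?thesis
    unfolding swap_energy_def by (simp add: autocorr_def)
qed

text \<open>Up to the division by the total weight, the left side is the energy of the network that
  arises on \<open>U\<close> when the star at \<open>x\<close> with conductances \<open>b\<close> is
  eliminated. Written with weights \<open>w\<close> of sum zero, the difference of the two sides is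
  twice the value of \<open>M\<close>.\<close>

lemma octopus:
  assumes "finite U" "x \<notin> U" and b: "\<And>y. y \<in> U \<Longrightarrow> 0 \<le> b y"
  defines "V \<equiv> insert x U"
  shows "(\<Sum>y\<in>U. \<Sum>z\<in>U. b y * b z * swap_energy V f y z)
    \<le> 2 * (\<Sum>y\<in>U. b y) * (\<Sum>y\<in>U. b y * swap_energy V f x y)"
proof -
  define s where "s = (\<Sum>y\<in>U. b y)"
  define w where "w y = (if y = x then - s else b y)" for y
  define q where "q = autocorr V f"
  define D where "D = distinct_quad_form q"
  have V: "finite V" using \<open>finite U\<close> by (simp add: V_def)
  have wU: "w y = b y" if "y \<in> U" for y using that \<open>x \<notin> U\<close> by (auto simp: w_def)
  have wx: "w x = - s" by (simp add: w_def)
  have sum_w: "(\<Sum>y\<in>V. w y) = 0"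
    using \<open>finite U\<close> \<open>x \<notin> U\<close> by (simp add: V_def wx wU s_def)
  have D_swap: "D i j k l = D j i k l" "D i j k l = D i k j l" "D i j k l = D i j l k" for i j k l
    unfolding D_def by (rule distinct_quad_form_swap)+
  have D_eq: "D i i k l = 0" "D i j i l = 0" "D i j k i = 0" "D i j j l = 0" "D i j k j = 0"
    "D i j k k = 0" for i j k l
    by (simp_all add: D_def distinct_quad_form_def)
  have D_nonneg: "0 \<le> D i j k l" if "{i, j, k, l} \<subseteq> V" for i j k l
    using autocorr_quad_form_nonneg[of i j k l V f] that
    by (simp add: D_def distinct_quad_form_def q_def)
  have D_le: "D i j k l \<le> D x j k l + D x i k l + D x i j l + D x i j k"
    if "{i, j, k, l} \<subseteq> U" for i j k l
  proof (cases "distinct [i, j, k, l]")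
    case True
    moreover have "x \<notin> {i, j, k, l}" using that \<open>x \<notin> U\<close> by auto
    moreover have "{x, i, j, k, l} \<subseteq> V" using that by (auto simp: V_def)
    ultimately show ?thesis
      using autocorr_quad_form_le[of x i j k l V f]
      by (simp add: D_def distinct_quad_form_def q_def)
  next
    case False
    then have "D i j k l = 0" by (auto simp: D_def distinct_quad_form_def)
    moreover have "0 \<le> D x j k l" "0 \<le> D x i k l" "0 \<le> D x i j l" "0 \<le> D x i j k"
      using that by (auto intro!: D_nonneg simp: V_def)
    ultimately show ?thesis by linarith
  qed
  \<comment> \<open>At most one of four distinct indices is \<open>x\<close>. Each of its four
    possible positions contributes \<open>- s * T\<close>. On quadruples inside \<open>U\<close>,
    \<open>D_le\<close> replaces \<open>D\<close> by four terms that each leave one index free; that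
    index sums to \<open>s\<close>, so the bound is \<open>4 * (s * T)\<close>, which cancels the
    rest exactly.\<close>
  have "sum4 V w D \<le> 0"
  proof -
    define T where "T = (\<Sum>j\<in>U. \<Sum>k\<in>U. \<Sum>l\<in>U. b j * b k * b l * D x j k l)"
    have split: "(\<Sum>y\<in>V. F y) = F x + (\<Sum>y\<in>U. F y)" for F :: "'a \<Rightarrow> real"
      using \<open>finite U\<close> \<open>x \<notin> U\<close> by (simp add: V_def)
    have "sum4 V w D = sum4 U b D
        + (\<Sum>j\<in>U. \<Sum>k\<in>U. \<Sum>l\<in>U. - s * b j * b k * b l * D x j k l)
        + (\<Sum>i\<in>U. \<Sum>k\<in>U. \<Sum>l\<in>U. b i * - s * b k * b l * D i x k l)
        + (\<Sum>i\<in>U. \<Sum>j\<in>U. \<Sum>l\<in>U. b i * b j * - s * b l * D i j x l)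
        + (\<Sum>i\<in>U. \<Sum>j\<in>U. \<Sum>k\<in>U. b i * b j * b k * - s * D i j k x)"
      unfolding sum4_def split D_eq wx
      by (simp add: sum.distrib wU del: mult_minus_left mult_minus_right)
    also have "(\<Sum>j\<in>U. \<Sum>k\<in>U. \<Sum>l\<in>U. - s * b j * b k * b l * D x j k l) = - s * T"
      by (simp add: T_def sum_distrib_left sum_negf mult_ac)
    also have "(\<Sum>i\<in>U. \<Sum>k\<in>U. \<Sum>l\<in>U. b i * - s * b k * b l * D i x k l) = - s * T"
      unfolding D_swap(1)[of _ x] by (simp add: T_def sum_distrib_left sum_negf mult_ac)
    also have "(\<Sum>i\<in>U. \<Sum>j\<in>U. \<Sum>l\<in>U. b i * b j * - s * b l * D i j x l) = - s * T"
      unfolding D_swap(2)[of _ _ x] D_swap(1)[of _ x]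
      by (simp add: T_def sum_distrib_left sum_negf mult_ac)
    also have "(\<Sum>i\<in>U. \<Sum>j\<in>U. \<Sum>k\<in>U. b i * b j * b k * - s * D i j k x) = - s * T"
      unfolding D_swap(3)[of _ _ _ x] D_swap(2)[of _ _ x] D_swap(1)[of _ x]
      by (simp add: T_def sum_distrib_left sum_negf mult_ac)
    finally have "sum4 V w D = sum4 U b D - 4 * (s * T)" by simp
    moreover have "sum4 U b D \<le> sum4 U b (\<lambda>i j k l. D x j k l + D x i k l + D x i j l + D x i j k)"
      by (rule sum4_mono) (use b D_le in auto)
    moreover have s4: "sum4 U b (\<lambda>i j k l. D x j k l) = s * T"
    proof -
      have "sum4 U b (\<lambda>i j k l. D x j k l) = (\<Sum>i\<in>U. b i * T)"
        by (simp add: sum4_def T_def sum_distrib_left mult_ac)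
      then show ?thesis by (simp add: s_def sum_distrib_right)
    qed
    moreover have "sum4 U b (\<lambda>i j k l. D x i k l) = s * T"
      using sum4_swap(1)[of U b "\<lambda>i j k l. D x j k l"] s4 by simp
    moreover from this have "sum4 U b (\<lambda>i j k l. D x i j l) = s * T"
      using sum4_swap(2)[of U b "\<lambda>i j k l. D x i k l"] by simp
    moreover from this have "sum4 U b (\<lambda>i j k l. D x i j k) = s * T"
      using sum4_swap(3)[of U b "\<lambda>i j k l. D x i j l"] by simp
    ultimately show ?thesis unfolding sum4_add by linarith
  qed
  define M where "M = (\<Sum>i\<in>V. \<Sum>j\<in>V. w i * w j * q (transpose i j))"
  have "0 \<le> 6 * sum4 V w (\<lambda>i j k l. q (transpose i j \<circ> transpose k l))"
    using autocorr_sum4_nonneg[of V w f] by (simp add: q_def)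
  also have "\<dots> = sum4 V w D + 12 * ((\<Sum>i\<in>V. (w i)^2) * M)"
    unfolding D_def M_def q_def
    by (rule weighted_square_expansion[where q = "autocorr V f", OF V sum_w])
      (rule autocorr_transpose_comm)
  finally have "0 \<le> (\<Sum>i\<in>V. (w i)^2) * M" using \<open>sum4 V w D \<le> 0\<close> by linarith
  have "0 \<le> M"
  \<comment> \<open>The factor \<open>\<Sum>i\<in>V. (w i)^2\<close> can be cancelled unless all
    weights vanish, and then \<open>M\<close> is 0 itself.\<close>
  proof (cases "\<forall>i\<in>V. w i = 0")
    case True then show ?thesis by (simp add: M_def)
  next
    case False
    then have "0 < (\<Sum>i\<in>V. (w i)^2)" using V by (auto intro: sum_pos2)
    then show ?thesis using \<open>0 \<le> (\<Sum>i\<in>V. (w i)^2) * M\<close> by (simp add: zero_le_mult_iff)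
  qed
  \<comment> \<open>The constant part \<open>2 * q id\<close> of the swap energy drops out because
    the weights sum to zero.\<close>
  have "(\<Sum>j\<in>V. w i * w j * swap_energy V f i j) = - 2 * (\<Sum>j\<in>V. w i * w j * q (transpose i j))"
    if "i \<in> V" for i
  proof -
    have "(\<Sum>j\<in>V. w i * w j * swap_energy V f i j)
        = (\<Sum>j\<in>V. 2 * q id * w i * w j - 2 * (w i * w j * q (transpose i j)))"
      using that by (intro sum.cong) (simp_all add: swap_energy_eq q_def algebra_simps)
    also have "\<dots> = 2 * q id * w i * (\<Sum>j\<in>V. w j) - 2 * (\<Sum>j\<in>V. w i * w j * q (transpose i j))"
      by (simp only: sum_subtractf sum_distrib_left)
    finally show ?thesis by (simp add: sum_w)
  qed
  then have "(\<Sum>i\<in>V. \<Sum>j\<in>V. w i * w j * swap_energy V f i j) = - 2 * M"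
    by (simp add: M_def sum_distrib_left sum_negf)
  then have "(\<Sum>i\<in>V. \<Sum>j\<in>V. w i * w j * swap_energy V f i j) \<le> 0"
    using \<open>0 \<le> M\<close> by simp
  moreover have "(\<Sum>i\<in>V. \<Sum>j\<in>V. w i * w j * swap_energy V f i j)
      = (\<Sum>y\<in>U. \<Sum>z\<in>U. b y * b z * swap_energy V f y z)
        - 2 * s * (\<Sum>y\<in>U. b y * swap_energy V f x y)"
  proof -
    define E where "E y = swap_energy V f x y" for y
    have "swap_energy V f y x = E y" "swap_energy V f x y = E y" for y
      unfolding E_def by (simp_all add: swap_energy_def transpose_commute)
    moreover have "E x = 0" by (simp add: E_def swap_energy_def)
    moreover have split: "(\<Sum>y\<in>V. F y) = F x + (\<Sum>y\<in>U. F y)" for F :: "'a \<Rightarrow> real"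
      using \<open>finite U\<close> \<open>x \<notin> U\<close> by (simp add: V_def)
    ultimately have "(\<Sum>i\<in>V. \<Sum>j\<in>V. w i * w j * swap_energy V f i j)
        = (\<Sum>y\<in>U. \<Sum>z\<in>U. b y * b z * swap_energy V f y z)
          + (\<Sum>y\<in>U. b y * - s * E y) + (\<Sum>y\<in>U. - s * b y * E y)"
      by (simp add: split wx wU sum.distrib del: mult_minus_left mult_minus_right)
    moreover have "(\<Sum>y\<in>U. b y * - s * E y) = - s * (\<Sum>y\<in>U. b y * E y)"
      "(\<Sum>y\<in>U. - s * b y * E y) = - s * (\<Sum>y\<in>U. b y * E y)"
      by (simp_all add: sum_distrib_left sum_negf mult_ac)
    ultimately show ?thesis by (simp add: E_def)
  qed
  ultimately show ?thesis by (simp add: s_def)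
qed

section \<open>The spectral gap of the interchange process\<close>

text \<open>This energy and the next run over ordered pairs. For symmetric \<open>a\<close>,
  \<open>rw_energy\<close> is 2 times the quadratic form of the graph Laplacian, and
  \<open>ip_energy\<close> is 4 times that of the interchange generator with each unordered pair
  taken once.\<close>

definition rw_energy :: "'v set \<Rightarrow> ('v \<Rightarrow> 'v \<Rightarrow> real) \<Rightarrow> ('v \<Rightarrow> real) \<Rightarrow> real" where
  "rw_energy V a g = (\<Sum>i\<in>V. \<Sum>j\<in>V. a i j * (g i - g j)^2)"

definition ip_energy :: "'v set \<Rightarrow> ('v \<Rightarrow> 'v \<Rightarrow> real) \<Rightarrow> (('v \<Rightarrow> 'v) \<Rightarrow> real) \<Rightarrow> real" where
  "ip_energy V a f = (\<Sum>i\<in>V. \<Sum>j\<in>V. a i j * swap_energy V f i j)"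

lemma swap_energy_nonneg: "0 \<le> swap_energy V f i j"
  unfolding swap_energy_def by (intro sum_nonneg) simp

lemma swap_energy_same [simp]: "swap_energy V f i i = 0"
  by (simp add: swap_energy_def)

lemma swap_energy_commute: "swap_energy V f i j = swap_energy V f j i"
  by (simp add: swap_energy_def transpose_commute)

text \<open>Splits the permutations by the point \<open>k\<close> that is sent to \<open>x\<close>.
  The transposition stands on the right because the generator multiplies by
  \<open>transpose i j\<close> on the left, which for \<open>i\<close>, \<open>j\<close> in
  \<open>U\<close> affects only the factor \<open>\<sigma>\<close>. Passing to inverses exchanges
  the two sides.\<close>

lemma sum_permutes_insert_right:
  assumes "finite U" "x \<notin> U"
  shows "(\<Sum>p | p permutes insert x U. F p)
    = (\<Sum>k\<in>insert x U. \<Sum>\<sigma> | \<sigma> permutes U. F (\<sigma> \<circ> transpose x k))"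
proof -
  have "(\<Sum>p | p permutes insert x U. F p) = (\<Sum>p | p permutes insert x U. F (inv' p))"
    by (rule sum_permutations_inverse)
  also have "\<dots> = (\<Sum>k\<in>insert x U. \<Sum>\<sigma> | \<sigma> permutes U. F (inv' (transpose x k \<circ> \<sigma>)))"
    by (rule sum_over_permutations_insert[OF assms])
  also have "\<dots> = (\<Sum>k\<in>insert x U. \<Sum>\<sigma> | \<sigma> permutes U. F (inv' \<sigma> \<circ> transpose x k))"
    by (intro sum.cong refl arg_cong[where f = F]) (simp add: o_inv_distrib permutes_bij)
  also have "\<dots> = (\<Sum>k\<in>insert x U. \<Sum>\<sigma> | \<sigma> permutes U. F (\<sigma> \<circ> transpose x k))"
    by (rule sum.cong[OF refl], rule sum_permutations_inverse[symmetric])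
  finally show ?thesis .
qed

lemma sum_permutes_slice:
  assumes "x \<notin> U" "k \<in> insert x U"
  shows "(\<Sum>\<sigma> | \<sigma> permutes U. F (\<sigma> \<circ> transpose x k))
    = (\<Sum>p | p permutes insert x U \<and> p k = x. F p)"
proof (rule sum.reindex_bij_witness[where i = "\<lambda>p. p \<circ> transpose x k" and j = "\<lambda>\<sigma>. \<sigma>
    \<circ> transpose x k"])
  fix \<sigma> assume \<sigma>: "\<sigma> \<in> {\<sigma>. \<sigma> permutes U}"
  then have "\<sigma> permutes insert x U" by (simp add: permutes_imp_permutes_insert)
  moreover have "transpose x k permutes insert x U" using assms(2) by (intro permutes_swap_id) auto
  ultimately show "\<sigma> \<circ> transpose x k \<in> {p. p permutes insert x U \<and> p k = x}"
    using \<sigma> assms(1) by (auto intro: permutes_compose permutes_not_in)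
next
  fix p assume p: "p \<in> {p. p permutes insert x U \<and> p k = x}"
  have "transpose x k permutes insert x U" using assms(2) by (intro permutes_swap_id) auto
  then have "p \<circ> transpose x k permutes insert x U" using p by (auto intro: permutes_compose)
  then show "p \<circ> transpose x k \<in> {\<sigma>. \<sigma> permutes U}"
    using p by (auto intro: permutes_superset)
qed (simp_all add: comp_assoc)

lemma sum_product_diff_swap:
  assumes "\<And>p. p \<in> P \<Longrightarrow> t p \<in> P" "\<And>p. p \<in> P \<Longrightarrow> t (t p) = p"
  shows "2 * (\<Sum>p\<in>P. f p * (f p - f (t p))) = (\<Sum>p\<in>P. (f p - f (t p))^2 :: real)"
proof -
  have "(\<Sum>p\<in>P. f p * (f p - f (t p))) = (\<Sum>p\<in>P. f (t p) * (f (t p) - f p))"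
    by (rule sum.reindex_bij_witness[where i = t and j = t]) (use assms in auto)
  then have "2 * (\<Sum>p\<in>P. f p * (f p - f (t p)))
      = (\<Sum>p\<in>P. f p * (f p - f (t p))) + (\<Sum>p\<in>P. f (t p) * (f (t p) - f p))"
    by simp
  also have "\<dots> = (\<Sum>p\<in>P. (f p - f (t p))^2)"
    unfolding sum.distrib[symmetric] by (intro sum.cong) (simp_all add: power2_eq_square
        algebra_simps)
  finally show ?thesis .
qed

text \<open>Eliminating \<open>x\<close> does not lower the gap. Extended to \<open>x\<close> by the
  weighted mean of its neighbouring values, \<open>g\<close> has the same energy in the full network
  as in the reduced one (the star-mesh transformation), and subtracting the mean afterwards does not
  decrease the squared norm.\<close>

lemma reduced_network_rw_energy:
  fixes a :: "'v \<Rightarrow> 'v \<Rightarrow> real"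
  assumes "finite U" "x \<notin> U" and b: "\<And>y. y \<in> U \<Longrightarrow> 0 \<le> a x y"
    and sym: "\<And>y. y \<in> U \<Longrightarrow> a y x = a x y"
    and rw: "\<And>g. (\<Sum>y\<in>insert x U. g y) = 0
      \<Longrightarrow> \<mu> * (\<Sum>y\<in>insert x U. (g y)^2) \<le> rw_energy (insert x U) a g"
    and "0 \<le> \<mu>" and g: "(\<Sum>y\<in>U. g y) = 0"
  shows "\<mu> * (\<Sum>y\<in>U. (g y)^2) \<le> rw_energy U (\<lambda>y z. a y z + a x y * a x z / (\<Sum>y\<in>U. a x y)) g"
proof -
  define s where "s = (\<Sum>y\<in>U. a x y)"
  define S1 where "S1 = (\<Sum>y\<in>U. a x y * g y)"
  define S2 where "S2 = (\<Sum>y\<in>U. a x y * (g y)^2)"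
  \<comment> \<open>The value at \<open>x\<close> that minimises the energy. If
    \<open>s = 0\<close>, then \<open>x\<close> is isolated and the default value 0 of the quotient
    does no harm.\<close>
  define h where "h = S1 / s"
  \<comment> \<open>The mean of the extension: \<open>g\<close> sums to zero over \<open>U\<close>,
    so only the value at \<open>x\<close> contributes.\<close>
  define m where "m = h / card (insert x U)"
  define G where "G y = (if y = x then h - m else g y - m)" for y
  have GU: "G y = g y - m" if "y \<in> U" for y using that assms(2) by (auto simp: G_def)
  have Gx: "G x = h - m" by (simp add: G_def)
  have split: "(\<Sum>y\<in>insert x U. F y) = F x + (\<Sum>y\<in>U. F y)" for F :: "'v \<Rightarrow> real"
    using assms(1,2) by simp
  have "real (card (insert x U)) * m = h" using assms(1) by (simp add: m_def)
  then have "(\<Sum>y\<in>insert x U. G y) = 0"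
    using assms(1,2) g by (simp add: Gx GU sum_subtractf algebra_simps)
  from rw[OF this] have "\<mu> * (\<Sum>y\<in>insert x U. (G y)^2) \<le> rw_energy (insert x U) a G" .
  moreover have "(\<Sum>y\<in>U. (g y)^2) \<le> (\<Sum>y\<in>insert x U. (G y)^2)"
  proof -
    have "(\<Sum>y\<in>U. (g y - m)^2) = (\<Sum>y\<in>U. (g y)^2 + m^2 - (2 * m) * g y)"
      by (intro sum.cong refl) (simp add: power2_diff)
    also have "\<dots> = (\<Sum>y\<in>U. (g y)^2) + (\<Sum>y\<in>U. m^2) - (2 * m) * (\<Sum>y\<in>U. g y)"
      by (simp only: sum.distrib sum_subtractf sum_distrib_left)
    finally have "(\<Sum>y\<in>U. (g y - m)^2) = (\<Sum>y\<in>U. (g y)^2) + (\<Sum>y\<in>U. m^2)" using g by simp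
    then show ?thesis by (simp add: split Gx GU)
  qed
  ultimately have "\<mu> * (\<Sum>y\<in>U. (g y)^2) \<le> rw_energy (insert x U) a G"
    using \<open>0 \<le> \<mu>\<close> by (meson mult_left_mono order_trans)
  also have "rw_energy (insert x U) a G = rw_energy U a g + 2 * (\<Sum>y\<in>U. a x y * (h - g y)^2)"
    by (simp add: rw_energy_def split Gx GU sum.distrib sym power2_commute[of _ h])
  \<comment> \<open>The variance of \<open>g\<close> under the weights \<open>a x y\<close>, once as
    deviation from the mean and once as a double sum of squared differences. Both sides equal
    \<open>2 * S2 - 2 * S1^2 / s\<close>.\<close>
  also have "2 * (\<Sum>y\<in>U. a x y * (h - g y)^2) = (\<Sum>y\<in>U. \<Sum>z\<in>U. a x y * a x z / s * (g y - g z)^2)"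
  proof (cases "s = 0")
    case True
    then have "\<forall>y\<in>U. a x y = 0" using sum_nonneg_eq_0_iff[OF assms(1), of "a x"] b by
        (simp add: s_def)
    then show ?thesis by simp
  next
    case False
    have "(\<Sum>y\<in>U. a x y * (h - g y)^2)
        = (\<Sum>y\<in>U. h^2 * a x y - (2 * h) * (a x y * g y) + a x y * (g y)^2)"
      by (intro sum.cong refl) (simp add: power2_diff algebra_simps)
    also have "\<dots> = h^2 * s - (2 * h) * S1 + S2"
      by (simp only: s_def S1_def S2_def sum.distrib sum_subtractf sum_distrib_left)
    also have "\<dots> = S2 - S1^2 / s" using False by (simp add: h_def power2_eq_square)
    finally have "2 * (\<Sum>y\<in>U. a x y * (h - g y)^2) = 2 * S2 - 2 * S1^2 / s" by simp
    moreover have "(\<Sum>y\<in>U. \<Sum>z\<in>U. a x y * a x z / s * (g y - g z)^2)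
        = (\<Sum>y\<in>U. \<Sum>z\<in>U. (1 / s) * ((a x y * (g y)^2) * a x z + a x y * (a x z * (g z)^2)
             - 2 * ((a x y * g y) * (a x z * g z))))"
      by (intro sum.cong refl) (simp add: power2_diff field_simps power2_eq_square False)
    moreover have "\<dots> = (1 / s) * (S2 * s + s * S2 - 2 * (S1 * S1))"
      unfolding S1_def S2_def s_def sum_product
      by (simp only: sum.distrib sum_subtractf sum_distrib_left distrib_left right_diff_distrib)
    moreover have "\<dots> = 2 * S2 - 2 * S1^2 / s"
      using False by (simp add: field_simps power2_eq_square)
    ultimately show ?thesis by (simp only:)
  qed
  also have "rw_energy U a g + \<dots> = rw_energy U (\<lambda>y z. a y z + a x y * a x z / s) g"
    by (simp add: rw_energy_def sum.distrib distrib_right)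
  finally show ?thesis by (simp add: s_def)
qed

text \<open>A transposition moves only \<open>y = i\<close> and \<open>y = j\<close>, and these two
  terms add up to \<open>(g i - g j)^2\<close>. So the operator built from transpositions of the
  points has the quadratic form of the weighted graph.\<close>

lemma sum_swap_diff_eq_rw_energy:
  assumes "finite V"
  shows "(\<Sum>y\<in>V. g y * (\<Sum>i\<in>V. \<Sum>j\<in>V. a i j * (g y - g (transpose i j y)))) = rw_energy V a g"
proof -
  have "(\<Sum>y\<in>V. g y * (g y - g (transpose i j y))) = (g i - g j)^2" if "i \<in> V" "j \<in> V" for i j
  proof (cases "i = j")
    case True then show ?thesis by simp
  next
    case False
    have "(\<Sum>y\<in>V. g y * (g y - g (transpose i j y)))
        = (\<Sum>y\<in>{i, j}. g y * (g y - g (transpose i j y)))"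
      using that assms by (intro sum.mono_neutral_right) auto
    then show ?thesis using False by (simp add: power2_eq_square algebra_simps)
  qed
  then have "rw_energy V a g = (\<Sum>i\<in>V. \<Sum>j\<in>V. a i j * (\<Sum>y\<in>V. g y * (g y - g (transpose i j y))))"
    by (simp add: rw_energy_def)
  also have "\<dots> = (\<Sum>i\<in>V. \<Sum>j\<in>V. \<Sum>y\<in>V. g y * (a i j * (g y - g (transpose i j y))))"
    by (simp only: sum_distrib_left mult_ac)
  also have "\<dots> = (\<Sum>y\<in>V. \<Sum>i\<in>V. \<Sum>j\<in>V. g y * (a i j * (g y - g (transpose i j y))))"
    by (subst sum.swap, subst (2) sum.swap) (rule refl)
  finally show ?thesis by (simp only: sum_distrib_left)
qed

lemma ip_energy_eq:
  "2 * (\<Sum>p | p permutes V. f p * (\<Sum>i\<in>V. \<Sum>j\<in>V. a i j * (f p - f (transpose i j \<circ> p))))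
      = ip_energy V a f"
proof -
  let ?P = "{p. p permutes V}"
  define X where "X i j = (\<Sum>p\<in>?P. f p * (f p - f (transpose i j \<circ> p)))" for i j
  have X: "2 * X i j = swap_energy V f i j" if "i \<in> V" "j \<in> V" for i j
    unfolding swap_energy_def X_def
    by (rule sum_product_diff_swap)
      (use permutes_swap_id[OF that] in \<open>auto simp: comp_assoc[symmetric] intro: permutes_compose\<close>)
  have "(\<Sum>p\<in>?P. f p * (\<Sum>i\<in>V. \<Sum>j\<in>V. a i j * (f p - f (transpose i j \<circ> p))))
      = (\<Sum>p\<in>?P. \<Sum>i\<in>V. \<Sum>j\<in>V. a i j * (f p * (f p - f (transpose i j \<circ> p))))"
    by (simp only: sum_distrib_left mult.left_commute)
  also have "\<dots> = (\<Sum>i\<in>V. \<Sum>j\<in>V. \<Sum>p\<in>?P. a i j * (f p * (f p - f (transpose i j \<circ> p))))"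
    by (subst sum.swap, rule sum.cong[OF refl], rule sum.swap)
  also have "\<dots> = (\<Sum>i\<in>V. \<Sum>j\<in>V. a i j * X i j)"
    by (simp only: sum_distrib_left X_def)
  finally show ?thesis
    unfolding ip_energy_def
    by (simp only: sum_distrib_left) (intro sum.cong refl, simp add: X[symmetric])
qed

text \<open>The operator sums over ordered pairs, so its quadratic form is half of
  \<open>ip_energy\<close>; hence the factor 2 in front of \<open>l\<close>.\<close>

lemma interchange_operator_has_minimal_eigenvector:
  fixes a :: "'v \<Rightarrow> 'v \<Rightarrow> real"
  assumes V: "finite V" and ne: "\<exists>f :: ('v \<Rightarrow> 'v) \<Rightarrow> real. (\<Sum>p | p permutes V. f p)
      = 0 \<and> (\<exists>p. p permutes V \<and> f p \<noteq> 0)"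
  obtains l f where "(\<Sum>p | p permutes V. f p) = 0" "\<exists>p. p permutes V \<and> f p \<noteq> (0::real)"
    "\<And>p. p permutes V \<Longrightarrow> (\<Sum>i\<in>V. \<Sum>j\<in>V. a i j * (f p - f (transpose i j \<circ> p))) = l * f p"
    "\<And>g. (\<Sum>p | p permutes V. g p) = 0 \<Longrightarrow> 2 * l * (\<Sum>p | p permutes V. (g p)^2) \<le> ip_energy V a g"
proof -
  let ?P = "{p. p permutes V}"
  define T where "T f p = (if p permutes V
      then \<Sum>i\<in>V. \<Sum>j\<in>V. a i j * (f p - f (transpose i j \<circ> p)) else 0)"
          for f :: "('v \<Rightarrow> 'v) \<Rightarrow> real" and p
  define W where "W = {f::('v \<Rightarrow> 'v) \<Rightarrow> real. (\<forall>p. p \<notin> ?P \<longrightarrow> f p = 0) \<and> (\<Sum>p\<in>?P. 1 * f p) = 0}"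
  have P: "finite ?P" using V by (rule finite_permutations)
  have perm: "transpose i j \<circ> p permutes V" if "i \<in> V" "j \<in> V" "p permutes V" for i j p
    using that by (intro permutes_compose permutes_swap_id)
  have form: "(\<Sum>p\<in>?P. f p * T g p) = (\<Sum>i\<in>V. \<Sum>j\<in>V. a i j * (\<Sum>p\<in>?P. f p * (g p - g (transpose i j
      \<circ> p))))"
    for f g
  proof -
    have "(\<Sum>p\<in>?P. f p * T g p) = (\<Sum>p\<in>?P. \<Sum>i\<in>V. \<Sum>j\<in>V. a i j * (f p * (g p - g (transpose i j \<circ> p))))"
      unfolding T_def by (intro sum.cong refl) (simp add: sum_distrib_left mult_ac)
    also have "\<dots> = (\<Sum>i\<in>V. \<Sum>j\<in>V. \<Sum>p\<in>?P. a i j * (f p * (g p - g (transpose i j \<circ> p))))"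
      by (subst sum.swap, rule sum.cong[OF refl], rule sum.swap)
    finally show ?thesis by (simp only: sum_distrib_left)
  qed
  have energy: "2 * (\<Sum>p\<in>?P. f p * T f p) = ip_energy V a f" for f
    unfolding ip_energy_eq[symmetric] by (simp add: T_def)
  have reindex: "(\<Sum>p\<in>?P. f p * g (transpose i j \<circ> p)) = (\<Sum>p\<in>?P. f (transpose i j \<circ> p) * g p)"
    if "i \<in> V" "j \<in> V" for i j and f g :: "('v \<Rightarrow> 'v) \<Rightarrow> real"
    using sum_permutes_comp_left[OF permutes_swap_id[OF that], of "\<lambda>p. f (transpose i j \<circ> p) * g p"]
    by (simp add: comp_assoc[symmetric])
  have sym: "(\<Sum>p\<in>?P. f p * T g p) = (\<Sum>p\<in>?P. T f p * g p)" for f g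
  proof -
    have "(\<Sum>p\<in>?P. T f p * g p) = (\<Sum>p\<in>?P. g p * T f p)" by (simp only: mult.commute)
    also have "\<dots> = (\<Sum>p\<in>?P. f p * T g p)"
    proof -
      have "(\<Sum>p\<in>?P. g p * (f p - f (transpose i j \<circ> p))) = (\<Sum>p\<in>?P. f p * (g p - g (transpose i j
          \<circ> p)))"
        if "i \<in> V" "j \<in> V" for i j
        using reindex[OF that, of f g] by (simp add: right_diff_distrib sum_subtractf mult.commute)
      note E = this
      show ?thesis
        unfolding form
        by (rule sum.cong[OF refl], rule sum.cong[OF refl], rule arg_cong2[where f
            = "(*)", OF refl], rule E)
    qed
    finally show ?thesis ..
  qed
  obtain f0 where f0: "(\<Sum>p\<in>?P. f0 p) = (0::real)" "\<exists>p. p permutes V \<and> f0 p \<noteq> 0" using ne by blast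
  obtain l f where lf: "f \<in> W" "f \<noteq> (\<lambda>_. 0)" "T f = (\<lambda>x. l * f x)"
    "\<And>g. g \<in> W \<Longrightarrow> (\<Sum>x\<in>?P. g x * T g x) \<ge> l * (\<Sum>x\<in>?P. (g x)^2)"
  proof (rule symmetric_operator_has_minimal_eigenvector[of ?P "\<lambda>_. 1" T, folded W_def])
    fix f assume "f \<in> W"
    have "(\<Sum>p\<in>?P. 1 * T f p) = 0"
      unfolding form
      by (intro sum.neutral ballI) (simp add: sum_subtractf sum_permutes_comp_left permutes_swap_id)
    then show "T f \<in> W" by (auto simp: W_def T_def)
  next
    fix f g t x
    show "T (\<lambda>x. f x + t * g x) x = T f x + t * T g x"
      by (simp add: T_def sum_distrib_left sum.distrib[symmetric] algebra_simps)
  next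
    fix p
    have "continuous_on UNIV (\<lambda>f::('v \<Rightarrow> 'v) \<Rightarrow> real. f q)" for q by simp
    then show "continuous_on UNIV (\<lambda>f. T f p)"
      unfolding T_def by (cases "p permutes V") (auto intro!: continuous_intros)
  next
    show "\<exists>f\<in>W. f \<noteq> (\<lambda>_. 0)"
      using f0 by (intro bexI[of _ "\<lambda>p. if p permutes V then f0 p else 0"])
          (auto simp: W_def fun_eq_iff)
  qed (use P sym in auto)
  show ?thesis
  proof (rule that[of f l])
    show "(\<Sum>p\<in>?P. f p) = 0" "\<exists>p. p permutes V \<and> f p \<noteq> 0"
      using lf(1,2) by (auto simp: W_def fun_eq_iff)
    show "(\<Sum>i\<in>V. \<Sum>j\<in>V. a i j * (f p - f (transpose i j \<circ> p))) = l * f p" if "p permutes V" for p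
      using fun_cong[OF lf(3), of p] that by (simp add: T_def)
    fix g assume g: "(\<Sum>p\<in>?P. g p) = (0::real)"
    define g' where "g' p = (if p permutes V then g p else 0)" for p
    have "g' \<in> W" using g by (simp add: W_def g'_def)
    then have "l * (\<Sum>p\<in>?P. (g' p)^2) \<le> (\<Sum>p\<in>?P. g' p * T g' p)" by (rule lf(4))
    then have "2 * l * (\<Sum>p\<in>?P. (g' p)^2) \<le> ip_energy V a g'" using energy[of g'] by simp
    moreover have "ip_energy V a g' = ip_energy V a g"
      unfolding ip_energy_def swap_energy_def
      by (intro sum.cong refl arg_cong2[where f = "(*)"]) (simp add: g'_def perm)
    ultimately show "2 * l * (\<Sum>p\<in>?P. (g p)^2) \<le> ip_energy V a g"
      by (simp add: g'_def)
  qed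
qed

text \<open>In the normalisation of the energies \<open>\<mu>\<close> stands for twice a lower bound
  of the random walk gap, and the conclusion gives the same lower bound for the interchange process.
  It stays fixed in the induction while \<open>a\<close> and \<open>f\<close> vary, because the
  reduced network satisfies the hypothesis with the same constant.\<close>

theorem aldous_spectral_gap:
  fixes a :: "'v \<Rightarrow> 'v \<Rightarrow> real"
  assumes "finite V"
    and "\<And>i j. i \<in> V \<Longrightarrow> j \<in> V \<Longrightarrow> a i j = a j i"
    and "\<And>i j. i \<in> V \<Longrightarrow> j \<in> V \<Longrightarrow> i \<noteq> j \<Longrightarrow> 0 \<le> a i j"
    and "\<And>g. (\<Sum>y\<in>V. g y) = 0 \<Longrightarrow> \<mu> * (\<Sum>y\<in>V. (g y)^2) \<le> rw_energy V a g"
    and "(\<Sum>p | p permutes V. f p) = 0"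
  shows "2 * \<mu> * (\<Sum>p | p permutes V. (f p)^2) \<le> ip_energy V a f"
proof (cases "0 \<le> \<mu>")
  case False
  have "0 \<le> a i j * swap_energy V f i j" if "i \<in> V" "j \<in> V" for i j
    using that assms(3) swap_energy_nonneg[of V f i j] by (cases "i = j") auto
  then have "0 \<le> ip_energy V a f" unfolding ip_energy_def by (intro sum_nonneg)
  moreover have "2 * \<mu> * (\<Sum>p | p permutes V. (f p)^2) \<le> 0"
    using False by (simp add: mult_nonpos_nonneg sum_nonneg)
  ultimately show ?thesis by linarith
next
  case True
  show ?thesis
    using assms
  proof (induction V arbitrary: a f)
    case empty
    then show ?case by (simp add: ip_energy_def)
  next
    case (insert x U a f)
    define V where "V = insert x U"
    note IH = insert.IH and sym = insert.prems(1)[folded V_def] and nonneg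
        = insert.prems(2)[folded V_def]
      and rw = insert.prems(3)[folded V_def] and f = insert.prems(4)[folded V_def]
    have V: "finite V" using insert.hyps by (simp add: V_def)
    have "2 * \<mu> * (\<Sum>p | p permutes V. (f p)^2) \<le> ip_energy V a f"
    proof (cases "\<exists>p. p permutes V \<and> f p \<noteq> 0")
      case False
      then have "(\<Sum>p | p permutes V. (f p)^2) = 0" by (intro sum.neutral) auto
      moreover have "swap_energy V f i j = 0" if "i \<in> V" "j \<in> V" for i j
        unfolding swap_energy_def using False that
        by (intro sum.neutral) (auto simp: permutes_compose permutes_swap_id)
      ultimately show ?thesis by (simp add: ip_energy_def)
    next
      case True
      have ex: "\<exists>f::('v \<Rightarrow> 'v) \<Rightarrow> real. (\<Sum>p | p permutes V. f p) = 0 \<and> (\<exists>p. p permutes V \<and> f p \<noteq> 0)"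
        using True f by blast
      obtain l f0 where f0: "(\<Sum>p | p permutes V. f0 p) = 0" "\<exists>p. p permutes V \<and> f0 p \<noteq> (0::real)"
        and eig: "\<And>p. p permutes V \<Longrightarrow>
          (\<Sum>i\<in>V. \<Sum>j\<in>V. a i j * (f0 p - f0 (transpose i j \<circ> p))) = l * f0 p"
        and min: "\<And>g. (\<Sum>p | p permutes V. g p) = 0
          \<Longrightarrow> 2 * l * (\<Sum>p | p permutes V. (g p)^2) \<le> ip_energy V a g"
        by (rule interchange_operator_has_minimal_eigenvector[OF V ex, of a]) (rule that;
            assumption)
      have "\<mu> \<le> l"
      proof (cases "\<exists>k\<in>V. (\<Sum>p | p permutes V \<and> p k = x. f0 p) \<noteq> 0")
        case True
        then obtain k where k: "k \<in> V" "(\<Sum>p | p permutes V \<and> p k = x. f0 p) \<noteq> 0" by blast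
        let ?P = "\<lambda>y. {p. p permutes V \<and> p k = y}"
        \<comment> \<open>Sums out everything but the position \<open>p k\<close> of particle
          \<open>k\<close>. Left multiplication by \<open>transpose i j\<close> moves this position
          as in the random walk, so the eigenvalue equation is inherited; the case assumption says
          \<open>g x \<noteq> 0\<close>.\<close>
        define g where "g y = (\<Sum>p\<in>?P y. f0 p)" for y
        have fin: "finite {p. p permutes V}" using V by (rule finite_permutations)
        have "(\<Sum>y\<in>V. g y) = (\<Sum>p | p permutes V. f0 p)"
        proof -
          have "(\<lambda>p. p k) ` {p. p permutes V} \<subseteq> V" using k(1) by (auto simp: permutes_in_image)
          from sum.group[OF fin V this, of f0] show ?thesis by (simp add: g_def)
        qed
        then have "(\<Sum>y\<in>V. g y) = 0" using f0(1) by simp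
        have swap: "(\<Sum>p\<in>?P y. f0 (transpose i j \<circ> p)) = g (transpose i j y)"
          if "i \<in> V" "j \<in> V" for i j y
          unfolding g_def
          by (rule sum.reindex_bij_witness[where i = "\<lambda>p. transpose i j \<circ> p" and j
              = "\<lambda>p. transpose i j \<circ> p"])
            (use permutes_swap_id[OF that] in \<open>auto simp: comp_assoc[symmetric] intro:
                permutes_compose\<close>)
        have "(\<Sum>i\<in>V. \<Sum>j\<in>V. a i j * (g y - g (transpose i j y))) = l * g y" if "y \<in> V" for y
        proof -
          have "l * g y = (\<Sum>p\<in>?P y. \<Sum>i\<in>V. \<Sum>j\<in>V. a i j * (f0 p - f0 (transpose i j \<circ> p)))"
            by (simp add: g_def sum_distrib_left eig)
          also have "\<dots> = (\<Sum>i\<in>V. \<Sum>j\<in>V. \<Sum>p\<in>?P y. a i j * (f0 p - f0 (transpose i j \<circ> p)))"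
            by (subst sum.swap, rule sum.cong[OF refl], rule sum.swap)
          also have "\<dots> = (\<Sum>i\<in>V. \<Sum>j\<in>V. a i j * (g y - g (transpose i j y)))"
            by (intro sum.cong refl) (simp add: sum_distrib_left[symmetric] sum_subtractf swap
                flip: g_def)
          finally show ?thesis ..
        qed
        then have "rw_energy V a g = (\<Sum>y\<in>V. g y * (l * g y))"
          unfolding sum_swap_diff_eq_rw_energy[OF V, symmetric] by simp
        also have "\<dots> = l * (\<Sum>y\<in>V. (g y)^2)"
          by (simp add: sum_distrib_left power2_eq_square mult_ac)
        finally have "\<mu> * (\<Sum>y\<in>V. (g y)^2) \<le> l * (\<Sum>y\<in>V. (g y)^2)"
          using rw[OF \<open>(\<Sum>y\<in>V. g y) = 0\<close>] by simp
        moreover have "0 < (\<Sum>y\<in>V. (g y)^2)"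
          using V k(2) by (intro sum_pos2[of _ x]) (auto simp: V_def g_def)
        ultimately show ?thesis by simp
      next
        case False
        define s where "s = (\<Sum>y\<in>U. a x y)"
        define a' where "a' y z = a y z + a x y * a x z / s" for y z
        define F where "F k \<sigma> = f0 (\<sigma> \<circ> transpose x k)" for k \<sigma>
        have decomp: "(\<Sum>p | p permutes V. G p) = (\<Sum>k\<in>V. \<Sum>\<sigma> | \<sigma> permutes U. G (\<sigma> \<circ> transpose x k))"
          for G :: "('v \<Rightarrow> 'v) \<Rightarrow> real"
          unfolding V_def by (rule sum_permutes_insert_right[OF insert.hyps])
        have b: "0 \<le> a x y" if "y \<in> U" for y
          using nonneg[of x y] that insert.hyps(2) by (auto simp: V_def)
        then have "0 \<le> s" unfolding s_def by (rule sum_nonneg)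
        have slices: "2 * \<mu> * (\<Sum>\<sigma> | \<sigma> permutes U. (F k \<sigma>)^2) \<le> ip_energy U a' (F k)" if "k \<in> V"
            for k
        proof (rule IH)
          show "a' i j = a' j i" if "i \<in> U" "j \<in> U" for i j
            using sym[of i j] that by (simp add: a'_def V_def)
          show "0 \<le> a' i j" if "i \<in> U" "j \<in> U" "i \<noteq> j" for i j
            using nonneg[of i j] that b[of i] b[of j] \<open>0 \<le> s\<close> by (simp add: a'_def V_def)
          show "\<mu> * (\<Sum>y\<in>U. (g y)^2) \<le> rw_energy U a' g" if "(\<Sum>y\<in>U. g y) = 0" for g
            unfolding a'_def s_def
            by (rule reduced_network_rw_energy[OF insert.hyps b _ rw[unfolded V_def] \<open>0 \<le> \<mu>\<close> that])
              (use sym[of _ x] in \<open>auto simp: V_def\<close>)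
          have "(\<Sum>\<sigma> | \<sigma> permutes U. F k \<sigma>) = (\<Sum>p | p permutes V \<and> p k = x. f0 p)"
            unfolding F_def V_def
            by (rule sum_permutes_slice) (use insert.hyps \<open>k \<in> V\<close> in \<open>auto simp: V_def\<close>)
          then show "(\<Sum>\<sigma> | \<sigma> permutes U. F k \<sigma>) = 0" using False \<open>k \<in> V\<close> by simp
        qed
        have "2 * \<mu> * (\<Sum>p | p permutes V. (f0 p)^2)
            = (\<Sum>k\<in>V. 2 * \<mu> * (\<Sum>\<sigma> | \<sigma> permutes U. (F k \<sigma>)^2))"
          unfolding decomp F_def by (simp add: sum_distrib_left)
        also have "\<dots> \<le> (\<Sum>k\<in>V. ip_energy U a' (F k))" by (intro sum_mono slices)
        also have "\<dots> = (\<Sum>i\<in>U. \<Sum>j\<in>U. \<Sum>k\<in>V. a' i j * swap_energy U (F k) i j)"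
          unfolding ip_energy_def by (subst sum.swap, rule sum.cong[OF refl], rule sum.swap)
        \<comment> \<open>Swaps of two points of \<open>U\<close> preserve every slice, so the slice
          energies add up to the energy on all of \<open>V\<close>.\<close>
        also have "\<dots> = (\<Sum>i\<in>U. \<Sum>j\<in>U. a' i j * swap_energy V f0 i j)"
          unfolding swap_energy_def decomp F_def by (simp add: sum_distrib_left comp_assoc)
        also have "\<dots> = (\<Sum>i\<in>U. \<Sum>j\<in>U. a i j * swap_energy V f0 i j)
            + (\<Sum>i\<in>U. \<Sum>j\<in>U. a x i * a x j * swap_energy V f0 i j) / s"
          by (simp add: a'_def distrib_right sum.distrib sum_divide_distrib)
        \<comment> \<open>The octopus inequality pays for the conductances created by the reduction
          with the edges at \<open>x\<close>; the factor 2 provides both orientations of each such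
          edge.\<close>
        also have "\<dots> \<le> (\<Sum>i\<in>U. \<Sum>j\<in>U. a i j * swap_energy V f0 i j)
            + 2 * (\<Sum>y\<in>U. a x y * swap_energy V f0 x y)"
        proof -
          have "(\<Sum>i\<in>U. \<Sum>j\<in>U. a x i * a x j * swap_energy V f0 i j)
              \<le> s * (2 * (\<Sum>y\<in>U. a x y * swap_energy V f0 x y))"
            using octopus[OF insert.hyps, of "a x" f0] b by (simp add: V_def s_def mult_ac)
          moreover have "0 \<le> (\<Sum>y\<in>U. a x y * swap_energy V f0 x y)"
            by (intro sum_nonneg mult_nonneg_nonneg b swap_energy_nonneg)
          ultimately have "(\<Sum>i\<in>U. \<Sum>j\<in>U. a x i * a x j * swap_energy V f0 i j) / s
              \<le> 2 * (\<Sum>y\<in>U. a x y * swap_energy V f0 x y)"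
            using \<open>0 \<le> s\<close> by (cases "s = 0") (auto simp: divide_le_eq mult_ac)
          then show ?thesis by simp
        qed
        also have "\<dots> = ip_energy V a f0"
        proof -
          have split: "(\<Sum>y\<in>V. G y) = G x + (\<Sum>y\<in>U. G y)" for G :: "'v \<Rightarrow> real"
            using insert.hyps by (simp add: V_def)
          have "a y x * swap_energy V f0 y x = a x y * swap_energy V f0 x y" if "y \<in> U" for y
            using sym[of y x] swap_energy_commute[of V f0 y x] that by (simp add: V_def)
          then show ?thesis by (simp add: ip_energy_def split sum.distrib)
        qed
        also have "\<dots> = 2 * l * (\<Sum>p | p permutes V. (f0 p)^2)"
          unfolding ip_energy_eq[symmetric]
          by (simp add: eig sum_distrib_left power2_eq_square mult_ac)
        finally have "\<mu> * (\<Sum>p | p permutes V. (f0 p)^2) \<le> l * (\<Sum>p | p permutes V. (f0 p)^2)" by simp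
        moreover have "0 < (\<Sum>p | p permutes V. (f0 p)^2)"
        proof -
          obtain p where "p permutes V" "f0 p \<noteq> 0" using f0(2) by blast
          then show ?thesis using finite_permutations[OF V] by (intro sum_pos2[of _ p]) auto
        qed
        ultimately show ?thesis by simp
      qed
      then have "2 * \<mu> * (\<Sum>p | p permutes V. (f p)^2) \<le> 2 * l * (\<Sum>p | p permutes V. (f p)^2)"
        by (intro mult_right_mono sum_nonneg) auto
      also have "\<dots> \<le> ip_energy V a f" by (rule min[OF f])
      finally show ?thesis .
    qed
    then show ?case by (simp add: V_def)
  qed
qed

section \<open>The wreath product\<close>

locale finite_wreath = comm_group A for A (structure) +
  fixes n :: nat
  assumes finite_A: "finite (carrier A)"
begin

declare One_nat_def [simp del]

abbreviation "B \<equiv> power_group A n"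
abbreviation "G \<equiv> wreath A n"
abbreviation "Perms \<equiv> {p. p permutes {1..n}}"

lemmas product_group_simps =
  carrier_product_group mult_product_group one_product_group inv_product_group

lemma group_B: "group B"
  by (rule product_group) (rule is_group)

lemma B_inv_apply: "g \<in> carrier B \<Longrightarrow> i \<in> {1..n} \<Longrightarrow> (inv\<^bsub>B\<^esub> g) i = inv (g i)"
  by (simp add: is_group)

lemma B_apply: "g \<in> carrier B \<Longrightarrow> i \<in> {1..n} \<Longrightarrow> g i \<in> carrier A"
  by (auto simp: PiE_iff)

lemma B_eqI:
  "g \<in> carrier B \<Longrightarrow> h \<in> carrier B \<Longrightarrow> (\<And>i. i \<in> {1..n} \<Longrightarrow> g i = h i) \<Longrightarrow> g = h"
  unfolding carrier_product_group by (rule PiE_ext)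

lemma B_comm: "g \<in> carrier B \<Longrightarrow> h \<in> carrier B \<Longrightarrow> g \<otimes>\<^bsub>B\<^esub> h = h \<otimes>\<^bsub>B\<^esub> g"
  by (auto simp: B_apply m_comm intro!: restrict_ext)

lemma comm_group_B: "comm_group B"
  by (rule group.group_comm_groupI[OF group_B B_comm])

lemma finite_B: "finite (carrier B)"
  unfolding carrier_product_group using finite_A by (intro finite_PiE) auto

lemma finite_Perms: "finite Perms"
  by (rule finite_permutations) simp

lemma carrier_G: "carrier G = carrier B \<times> Perms"
  by (simp add: wreath_def sym_group_def)

lemma finite_G: "finite (carrier G)"
  unfolding carrier_G using finite_B finite_Perms by (rule finite_cartesian_product)

lemma mult_G: "(g, \<pi>) \<otimes>\<^bsub>G\<^esub> (h, \<sigma>) = (g \<otimes>\<^bsub>B\<^esub> perm_act n \<pi> h, \<pi> \<circ> \<sigma>)"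
  by (simp add: wreath_def sym_group_def)

lemma one_G: "\<one>\<^bsub>G\<^esub> = (\<one>\<^bsub>B\<^esub>, id)"
  by (simp add: wreath_def sym_group_def)

lemma perm_inv_in: "\<pi> \<in> Perms \<Longrightarrow> i \<in> {1..n} \<Longrightarrow> inv' \<pi> i \<in> {1..n}"
  by (metis mem_Collect_eq permutes_in_image permutes_inv)

lemma perm_in: "\<pi> \<in> Perms \<Longrightarrow> i \<in> {1..n} \<Longrightarrow> \<pi> i \<in> {1..n}"
  by (metis mem_Collect_eq permutes_in_image)

lemma perm_act_apply: "i \<in> {1..n} \<Longrightarrow> perm_act n \<pi> g i = g (inv' \<pi> i)"
  by (simp add: perm_act_def)

lemma perm_act_PiE: "\<pi> \<in> Perms \<Longrightarrow> g \<in> {1..n} \<rightarrow>\<^sub>E X \<Longrightarrow> perm_act n \<pi> g \<in> {1..n} \<rightarrow>\<^sub>E X"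
  using perm_inv_in by (auto simp: perm_act_def)

lemma perm_act_B: "\<pi> \<in> Perms \<Longrightarrow> g \<in> carrier B \<Longrightarrow> perm_act n \<pi> g \<in> carrier B"
  unfolding carrier_product_group by (rule perm_act_PiE)

lemma perm_act_comp:
  assumes "\<pi> \<in> Perms" "\<sigma> \<in> Perms"
  shows "perm_act n (\<pi> \<circ> \<sigma>) g = perm_act n \<pi> (perm_act n \<sigma> g)"
proof -
  have "inv' (\<pi> \<circ> \<sigma>) = inv' \<sigma> \<circ> inv' \<pi>"
    using assms by (intro o_inv_distrib) (auto simp: permutes_bij)
  then show ?thesis
    using perm_inv_in[OF assms(1)] by (auto simp: perm_act_def intro!: restrict_ext)
qed

lemma perm_act_id: "g \<in> {1..n} \<rightarrow>\<^sub>E X \<Longrightarrow> perm_act n id g = g"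
  by (auto simp: perm_act_def PiE_iff extensional_def fun_eq_iff)

lemma perm_act_one: "\<pi> \<in> Perms \<Longrightarrow> perm_act n \<pi> \<one>\<^bsub>B\<^esub> = \<one>\<^bsub>B\<^esub>"
  using perm_inv_in by (auto simp: perm_act_def intro!: restrict_ext)

lemma perm_act_mult:
  "\<pi> \<in> Perms \<Longrightarrow> perm_act n \<pi> (g \<otimes>\<^bsub>B\<^esub> h) = perm_act n \<pi> g \<otimes>\<^bsub>B\<^esub> perm_act n \<pi> h"
  using perm_inv_in by (auto simp: perm_act_def intro!: restrict_ext)

lemma perm_act_inverse:
  assumes "\<pi> \<in> Perms" "g \<in> {1..n} \<rightarrow>\<^sub>E X"
  shows "perm_act n \<pi> (perm_act n (inv' \<pi>) g) = g"
proof -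
  have "inv' \<pi> \<in> Perms" using assms(1) by (simp add: permutes_inv)
  then have "perm_act n \<pi> (perm_act n (inv' \<pi>) g) = perm_act n (\<pi> \<circ> inv' \<pi>) g"
    using assms(1) by (simp only: perm_act_comp)
  also have "\<pi> \<circ> inv' \<pi> = id" using assms(1) by (simp add: permutes_inv_o)
  finally show ?thesis unfolding perm_act_id[OF assms(2)] .
qed

lemma transpose_Perms: "i \<in> {1..n} \<Longrightarrow> j \<in> {1..n} \<Longrightarrow> transpose i j \<in> Perms"
  by (simp add: permutes_swap_id)

lemma comp_Perms: "\<pi> \<in> Perms \<Longrightarrow> \<sigma> \<in> Perms \<Longrightarrow> \<pi> \<circ> \<sigma> \<in> Perms"
  by (simp add: permutes_compose)

lemma id_Perms: "id \<in> Perms"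
  by (simp add: permutes_id)

lemma inv_Perms: "\<pi> \<in> Perms \<Longrightarrow> inv' \<pi> \<in> Perms"
  by (simp add: permutes_inv)

lemma group_G: "group G"
proof (rule groupI)
  interpret B: group B by (rule group_B)
  show "x \<otimes>\<^bsub>G\<^esub> y \<in> carrier G" if "x \<in> carrier G" "y \<in> carrier G" for x y
    using that B.m_closed perm_act_B comp_Perms
    by (cases x; cases y) (simp add: mult_G carrier_G del: product_group_simps)
  show "\<one>\<^bsub>G\<^esub> \<in> carrier G"
    using B.one_closed id_Perms by (simp add: one_G carrier_G del: product_group_simps)
  show "(x \<otimes>\<^bsub>G\<^esub> y) \<otimes>\<^bsub>G\<^esub> z = x \<otimes>\<^bsub>G\<^esub> (y \<otimes>\<^bsub>G\<^esub> z)"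
    if "x \<in> carrier G" "y \<in> carrier G" "z \<in> carrier G" for x y z
  proof -
    obtain g \<pi> h \<sigma> k \<rho> where x: "x = (g, \<pi>)" "y = (h, \<sigma>)" "z = (k, \<rho>)"
        by (cases x; cases y; cases z)
    then have c: "g \<in> carrier B" "h \<in> carrier B" "k \<in> carrier B" "\<pi> \<in> Perms" "\<sigma> \<in> Perms" "\<rho> \<in> Perms"
      using that by (auto simp: carrier_G simp del: carrier_product_group)
    show ?thesis
      unfolding x mult_G perm_act_comp[OF c(4,5)] perm_act_mult[OF c(4)]
      using c by (simp add: B.m_assoc perm_act_B comp_assoc del: product_group_simps)
  qed
  show "\<one>\<^bsub>G\<^esub> \<otimes>\<^bsub>G\<^esub> x = x" if xG: "x \<in> carrier G" for x
  proof -
    obtain g \<pi> where x: "x = (g, \<pi>)" "g \<in> carrier B"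
      using xG by (auto simp: carrier_G simp del: carrier_product_group)
    have "perm_act n id g = g" using x(2) unfolding carrier_product_group by (rule perm_act_id)
    then show ?thesis using x by (simp add: one_G mult_G del: product_group_simps)
  qed
  show "\<exists>y\<in>carrier G. y \<otimes>\<^bsub>G\<^esub> x = \<one>\<^bsub>G\<^esub>" if xG: "x \<in> carrier G" for x
  proof -
    obtain g \<pi> where x: "x = (g, \<pi>)" "g \<in> carrier B" "\<pi> \<in> Perms"
      using xG by (auto simp: carrier_G simp del: carrier_product_group)
    \<comment> \<open>The base part of \<open>(h; \<rho>)(g; \<pi>)\<close> is
      \<open>h (\<rho> \<cdot> g)\<close>; with \<open>\<rho>\<close> the inverse of
      \<open>\<pi>\<close>, \<open>h\<close> has to be the inverse of
      \<open>\<rho> \<cdot> g\<close>.\<close>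
    define h where "h = perm_act n (inv' \<pi>) (inv\<^bsub>B\<^esub> g)"
    have ig: "inv\<^bsub>B\<^esub> g \<in> carrier B" using x(2) by (rule B.inv_closed)
    have "(h, inv' \<pi>) \<in> carrier G"
      using perm_act_B[OF inv_Perms[OF x(3)] ig] inv_Perms[OF x(3)]
      by (simp add: h_def carrier_G del: carrier_product_group)
    moreover have "h \<otimes>\<^bsub>B\<^esub> perm_act n (inv' \<pi>) g = \<one>\<^bsub>B\<^esub>"
      unfolding h_def perm_act_mult[OF inv_Perms[OF x(3)], symmetric]
      using x(2) inv_Perms[OF x(3)] B.l_inv perm_act_one by (simp del: product_group_simps)
    then have "(h, inv' \<pi>) \<otimes>\<^bsub>G\<^esub> x = \<one>\<^bsub>G\<^esub>"
      using x(3) by (simp add: x(1) mult_G one_G permutes_inv_o del: product_group_simps)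
    ultimately show ?thesis by blast
  qed
qed

lemma left_translate_transpose:
  assumes "i \<in> {1..n}" "j \<in> {1..n}" "(g, \<pi>) \<in> carrier G"
  shows "left_translate G (\<one>\<^bsub>B\<^esub>, transpose i j) f (g, \<pi>)
    = f (perm_act n (transpose i j) g, transpose i j \<circ> \<pi>)"
proof -
  interpret B: group B by (rule group_B)
  interpret G: group G by (rule group_G)
  have t: "transpose i j \<in> Perms" using assms by (intro transpose_Perms)
  have gB: "g \<in> carrier B" using assms(3) by (simp add: carrier_G del: carrier_product_group)
  have c: "(\<one>\<^bsub>B\<^esub>, transpose i j) \<in> carrier G"
    using t B.one_closed by (simp add: carrier_G del: product_group_simps)
  have "(\<one>\<^bsub>B\<^esub>, transpose i j) \<otimes>\<^bsub>G\<^esub> (\<one>\<^bsub>B\<^esub>, transpose i j) = \<one>\<^bsub>G\<^esub>"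
    unfolding mult_G one_G perm_act_one[OF t] using B.one_closed B.l_one
    by (simp del: product_group_simps)
  then have "inv\<^bsub>G\<^esub> (\<one>\<^bsub>B\<^esub>, transpose i j) = (\<one>\<^bsub>B\<^esub>, transpose i j)"
    using c c by (rule G.inv_equality)
  then show ?thesis
    using assms(3) B.l_one[OF perm_act_B[OF t gB]]
    by (simp add: left_translate_def mult_G del: product_group_simps)
qed

lemma left_translate_base:
  assumes "y \<in> carrier B" "(g, \<pi>) \<in> carrier G"
  shows "left_translate G (y, id) f (g, \<pi>) = f (inv\<^bsub>B\<^esub> y \<otimes>\<^bsub>B\<^esub> g, \<pi>)"
proof -
  interpret B: group B by (rule group_B)
  interpret G: group G by (rule group_G)
  have gB: "g \<in> carrier B" using assms(2) by (simp add: carrier_G del: carrier_product_group)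
  have id: "perm_act n id h = h" if "h \<in> carrier B" for h
    using that unfolding carrier_product_group by (rule perm_act_id)
  have c: "(y, id) \<in> carrier G" "(inv\<^bsub>B\<^esub> y, id) \<in> carrier G"
    using assms(1) B.inv_closed id_Perms by (simp_all add: carrier_G del: carrier_product_group)
  have "(inv\<^bsub>B\<^esub> y, id) \<otimes>\<^bsub>G\<^esub> (y, id) = \<one>\<^bsub>G\<^esub>"
    unfolding mult_G one_G id[OF assms(1)] B.l_inv[OF assms(1)] by simp
  then have "inv\<^bsub>G\<^esub> (y, id) = (inv\<^bsub>B\<^esub> y, id)"
    using c by (rule G.inv_equality)
  then show ?thesis
    using assms(2) id[OF gB]
    by (simp add: left_translate_def mult_G del: product_group_simps)
qed

end

section \<open>Common eigenvectors of commuting operators\<close>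

text \<open>Bridge between the sums over \<open>i < j\<close> in the definitions and the double sums
  in the energies.\<close>

lemma sum_ordered_pairs:
  fixes h :: "nat \<Rightarrow> nat \<Rightarrow> 'b::field_char_0"
  assumes sym: "\<And>i j. i \<in> {1..n} \<Longrightarrow> j \<in> {1..n} \<Longrightarrow> h i j = h j i"
    and diag: "\<And>i. i \<in> {1..n} \<Longrightarrow> h i i = 0"
  shows "(\<Sum>(i, j)\<in>ordered_pairs n. h i j) = (\<Sum>i\<in>{1..n}. \<Sum>j\<in>{1..n}. h i j) / 2"
proof -
  let ?I = "{1..n}"
  let ?D = "(\<lambda>i. (i, i)) ` ?I" and ?R = "(\<lambda>(i, j). (j, i)) ` ordered_pairs n"
  have fin: "finite (ordered_pairs n)"
    by (rule finite_subset[of _ "?I \<times> ?I"]) (auto simp: ordered_pairs_def)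
  have "?I \<times> ?I = ordered_pairs n \<union> ?R \<union> ?D"
    by (auto simp: ordered_pairs_def image_iff)
  moreover have "(ordered_pairs n \<union> ?R) \<inter> ?D = {}" "ordered_pairs n \<inter> ?R = {}"
    by (auto simp: ordered_pairs_def)
  ultimately have "(\<Sum>(i, j)\<in>?I \<times> ?I. h i j)
      = (\<Sum>(i, j)\<in>ordered_pairs n. h i j) + (\<Sum>(i, j)\<in>?R. h i j) + (\<Sum>(i, j)\<in>?D. h i j)"
    using fin by (simp add: sum.union_disjoint)
  moreover have "(\<Sum>(i, j)\<in>?R. h i j) = (\<Sum>(i, j)\<in>ordered_pairs n. h i j)"
    by (subst sum.reindex) (auto simp: inj_on_def ordered_pairs_def sym intro!: sum.cong)
  moreover have "(\<Sum>(i, j)\<in>?D. h i j) = 0"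
    using diag by (intro sum.neutral) auto
  ultimately show ?thesis by (simp add: sum.cartesian_product)
qed

text \<open>A function fixed by all left translations takes its value at the identity everywhere on
  the group, so the fixed vectors are the constants.\<close>

lemma orth_compl_fixed_vectors:
  assumes "group H"
  shows "orth_compl (carrier H) (fixed_vectors H)
      = {f \<in> fun_space (carrier H). (\<Sum>x\<in>carrier H. f x) = 0}"
proof -
  interpret group H by fact
  define u :: "'a \<Rightarrow> complex" where "u x = of_bool (x \<in> carrier H)" for x
  have u: "u \<in> fixed_vectors H"
    by (auto simp: fixed_vectors_def fun_space_def left_translate_def u_def fun_eq_iff)
  have const: "v = (\<lambda>x. v \<one>\<^bsub>H\<^esub> * u x)" if "v \<in> fixed_vectors H" for v
  proof
    fix x
    show "v x = v \<one>\<^bsub>H\<^esub> * u x"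
    proof (cases "x \<in> carrier H")
      case True
      then have "left_translate H x v x = v x" using that by (simp add: fixed_vectors_def)
      then show ?thesis using True by (simp add: left_translate_def u_def)
    qed (use that in \<open>simp add: fixed_vectors_def fun_space_def u_def\<close>)
  qed
  have "(\<forall>v\<in>fixed_vectors H. (\<Sum>x\<in>carrier H. f x * cnj (v x)) = 0) \<longleftrightarrow> (\<Sum>x\<in>carrier H. f x) = 0" for f
  proof
    assume "\<forall>v\<in>fixed_vectors H. (\<Sum>x\<in>carrier H. f x * cnj (v x)) = 0"
    then have "(\<Sum>x\<in>carrier H. f x * cnj (u x)) = 0" using u by blast
    then show "(\<Sum>x\<in>carrier H. f x) = 0" by (simp add: u_def)
  next
    assume f: "(\<Sum>x\<in>carrier H. f x) = 0"
    show "\<forall>v\<in>fixed_vectors H. (\<Sum>x\<in>carrier H. f x * cnj (v x)) = 0"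
    proof
      fix v assume "v \<in> fixed_vectors H"
      then have "(\<Sum>x\<in>carrier H. f x * cnj (v x)) = (\<Sum>x\<in>carrier H. f x * cnj (v \<one>\<^bsub>H\<^esub>))"
        by (intro sum.cong refl) (subst const, auto simp: u_def)
      also have "\<dots> = 0" by (simp add: f flip: sum_distrib_right)
      finally show "(\<Sum>x\<in>carrier H. f x * cnj (v x)) = 0" .
    qed
  qed
  then show ?thesis by (auto simp: orth_compl_def)
qed

lemma sum_powers_root_of_unity:
  fixes z :: complex
  assumes "z ^ m = 1" "z \<noteq> 1"
  shows "(\<Sum>k<m. z ^ k) = 0"
  using assms by (simp add: geometric_sum)

text \<open>An operator with \<open>T^m = 1\<close> on \<open>N\<close> is an action of the cyclic
  group of order \<open>m\<close>. The vector \<open>S j m\<close> is \<open>m\<close> times the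
  component of \<open>f\<close> with eigenvalue \<open>inverse (z ^ j)\<close>; the components add
  up to \<open>f\<close>, so one of them is nonzero.\<close>

lemma finite_order_operator_has_eigenvector:
  fixes T :: "('x \<Rightarrow> complex) \<Rightarrow> 'x \<Rightarrow> complex"
  assumes lin: "\<And>f g s t. T (\<lambda>x. s * f x + t * g x) = (\<lambda>x. s * T f x + t * T g x)"
    and N_lin: "\<And>f g s t. f \<in> N \<Longrightarrow> g \<in> N \<Longrightarrow> (\<lambda>x. s * f x + t * g x) \<in> N"
    and T_N: "\<And>f. f \<in> N \<Longrightarrow> T f \<in> N"
    and "m > 0" and order: "\<And>f. f \<in> N \<Longrightarrow> (T ^^ m) f = f"
    and f: "f \<in> N" "f \<noteq> (\<lambda>_. 0)"
  obtains v s where "v \<in> N" "v \<noteq> (\<lambda>_. 0)" "T v = (\<lambda>x. s * v x)"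
proof -
  define z where "z = cis (2 * pi / m)"
  have zm: "z ^ m = 1" using \<open>m > 0\<close> by (simp add: z_def DeMoivre)
  have z_ne: "z ^ k \<noteq> 1" if "0 < k" "k < m" for k
  proof
    assume "z ^ k = 1"
    then have "cis (2 * pi * real k / real m) = cis (2 * pi * real 0 / real m)"
      by (simp add: z_def DeMoivre mult_ac)
    then show False
      using bij_betw_imp_inj_on[OF bij_betw_roots_unity[OF \<open>m > 0\<close>]] that
      by (auto dest!: inj_onD[where x = k and y = 0])
  qed
  define S where "S j k = (\<lambda>x. \<Sum>i<k. z ^ (j * i) * (T ^^ i) f x)" for j k
  have T0: "T (\<lambda>_. 0) = (\<lambda>_. 0)" using lin[of 0 "\<lambda>_. 0" 0 "\<lambda>_. 0"] by simp
  have T_pow: "(T ^^ i) f \<in> N" for i using f(1) T_N by (induction i) auto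
  have S_N: "S j k \<in> N" for j k
  proof (induction k)
    case 0
    show ?case using N_lin[OF f(1) f(1), of 0 0] by (simp add: S_def)
  next
    case (Suc k)
    show ?case using N_lin[OF Suc T_pow, of 1 "z ^ (j * k)" k] by (simp add: S_def)
  qed
  have T_S: "T (S j k) = (\<lambda>x. \<Sum>i<k. z ^ (j * i) * (T ^^ Suc i) f x)" for j k
  proof (induction k)
    case 0 then show ?case using T0 by (simp add: S_def)
  next
    case (Suc k)
    have "S j (Suc k) = (\<lambda>x. 1 * S j k x + z ^ (j * k) * (T ^^ k) f x)" by (simp add: S_def)
    then have "T (S j (Suc k)) = (\<lambda>x. 1 * T (S j k) x + z ^ (j * k) * T ((T ^^ k) f) x)"
      by (simp only: lin)
    then show ?case by (simp add: Suc)
  qed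
  have eig: "T (S j m) = (\<lambda>x. inverse (z ^ j) * S j m x)" for j
  proof
    fix x
    have "z \<noteq> 0" by (simp add: z_def)
    define t where "t i = z ^ (j * i) * (T ^^ i) f x" for i
    \<comment> \<open>The index shift produced by \<open>T\<close> wraps around, since
      \<open>z^(j m) = 1\<close> and \<open>T^m f = f\<close>.\<close>
    have "t m = t 0" using order[OF f(1)] zm by (simp add: t_def power_mult mult.commute[of j])
    have "z ^ j * T (S j m) x = (\<Sum>i<m. t (Suc i))"
      by (simp add: T_S t_def sum_distrib_left power_add mult_ac)
    also have "\<dots> = (\<Sum>i<m. t i)"
      using sum.lessThan_Suc_shift[of t m] \<open>t m = t 0\<close> by simp
    finally show "T (S j m) x = inverse (z ^ j) * S j m x"
      using \<open>z \<noteq> 0\<close> by (simp add: S_def t_def field_simps)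
  qed
  have "\<exists>j. S j m \<noteq> (\<lambda>_. 0)"
  proof (rule ccontr)
    assume "\<not> ?thesis"
    then have S0: "S j m x = 0" for j x by (simp add: fun_eq_iff)
    have "of_nat m * f x = 0" for x
    proof -
      \<comment> \<open>Fourier inversion: for \<open>i \<noteq> 0\<close> the powers of
        \<open>z ^ i\<close> cancel, and only the term \<open>i = 0\<close> survives.\<close>
      have "(\<Sum>j<m. S j m x) = (\<Sum>i<m. (\<Sum>j<m. (z ^ i) ^ j) * (T ^^ i) f x)"
        unfolding S_def by (subst sum.swap) (simp add: sum_distrib_right sum_distrib_left
            mult.commute flip: power_mult)
      also have "\<dots> = (\<Sum>i<m. if i = 0 then of_nat m * f x else 0)"
      proof (rule sum.cong[OF refl])
        fix i assume "i \<in> {..<m}"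
        have "(z ^ i) ^ m = 1" by (metis mult.commute power_mult power_one zm)
        then show "(\<Sum>j<m. (z ^ i) ^ j) * (T ^^ i) f x = (if i = 0 then of_nat m * f x else 0)"
          using \<open>i \<in> {..<m}\<close> z_ne[of i] by (auto simp: sum_powers_root_of_unity)
      qed
      also have "\<dots> = of_nat m * f x" using \<open>m > 0\<close> by simp
      finally show ?thesis by (simp add: S0)
    qed
    then show False using f(2) \<open>m > 0\<close> by auto
  qed
  then show thesis using that S_N eig by blast
qed

text \<open>Induction over sets of group elements. Commuting operators preserve the joint eigenspace
  \<open>M\<close> of those already treated, and each has finite order because the order of the
  group annihilates every element, so it has an eigenvector inside \<open>M\<close>.\<close>

lemma abelian_action_has_common_eigenvector:
  fixes R :: "'g \<Rightarrow> ('x \<Rightarrow> complex) \<Rightarrow> 'x \<Rightarrow> complex"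
  assumes "comm_group H" and fin: "finite (carrier H)"
    and lin: "\<And>h f g s t. R h (\<lambda>x. s * f x + t * g x) = (\<lambda>x. s * R h f x + t * R h g x)"
    and N_lin: "\<And>f g s t. f \<in> N \<Longrightarrow> g \<in> N \<Longrightarrow> (\<lambda>x. s * f x + t * g x) \<in> N"
    and R_N: "\<And>h f. h \<in> carrier H \<Longrightarrow> f \<in> N \<Longrightarrow> R h f \<in> N"
    and R_mult: "\<And>g h f. g \<in> carrier H \<Longrightarrow> h \<in> carrier H \<Longrightarrow> f \<in> N \<Longrightarrow> R (g \<otimes>\<^bsub>H\<^esub> h) f = R g (R h f)"
    and R_one: "\<And>f. f \<in> N \<Longrightarrow> R \<one>\<^bsub>H\<^esub> f = f"
    and ne: "\<exists>f\<in>N. f \<noteq> (\<lambda>_. 0)"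
  obtains v \<chi> where "v \<in> N" "v \<noteq> (\<lambda>_. 0)" "\<chi> \<in> hom H complex_units"
    "\<And>h. h \<in> carrier H \<Longrightarrow> R h v = (\<lambda>x. \<chi> h * v x)"
proof -
  interpret comm_group H by fact
  have scale: "R h (\<lambda>x. s * f x) = (\<lambda>x. s * R h f x)" for h s f
    using lin[of h s f 0 f] by simp
  have "\<exists>v\<in>N. v \<noteq> (\<lambda>_. 0) \<and> (\<forall>h\<in>S. \<exists>s. R h v = (\<lambda>x. s * v x))" if "S \<subseteq> carrier H" for S
    using finite_subset[OF that fin] that
  proof (induction S rule: finite_induct)
    case empty then show ?case using ne by auto
  next
    case (insert h S)
    from insert obtain f where f: "f \<in> N" "f \<noteq> (\<lambda>_. 0)" "\<forall>g\<in>S. \<exists>s. R g f = (\<lambda>x. s * f x)" by blast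
    then obtain s where s: "\<And>g. g \<in> S \<Longrightarrow> R g f = (\<lambda>x. s g * f x)" by metis
    define M where "M = {v \<in> N. \<forall>g\<in>S. R g v = (\<lambda>x. s g * v x)}"
    have h: "h \<in> carrier H" and S: "\<And>g. g \<in> S \<Longrightarrow> g \<in> carrier H" using insert.prems by auto
    have pow: "(R h ^^ k) v = R (h [^]\<^bsub>H\<^esub> k) v \<and> (R h ^^ k) v \<in> N" if "v \<in> N" for k :: nat and v
    proof (induction k)
      case 0 then show ?case using that by (simp add: R_one)
    next
      case (Suc k)
      have "(R h ^^ Suc k) v = R h (R (h [^]\<^bsub>H\<^esub> k) v)" using Suc by simp
      also have "\<dots> = R (h \<otimes>\<^bsub>H\<^esub> h [^]\<^bsub>H\<^esub> k) v" using h that by (intro R_mult[symmetric]) auto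
      also have "h \<otimes>\<^bsub>H\<^esub> h [^]\<^bsub>H\<^esub> k = h [^]\<^bsub>H\<^esub> Suc k" using h by (simp add: m_comm)
      finally have "(R h ^^ Suc k) v = R (h [^]\<^bsub>H\<^esub> Suc k) v" .
      moreover have "(R h ^^ Suc k) v \<in> N" using R_N[OF h conjunct2[OF Suc]] by simp
      ultimately show ?case by blast
    qed
    obtain v t where "v \<in> M" "v \<noteq> (\<lambda>_. 0)" "R h v = (\<lambda>x. t * v x)"
    proof (rule finite_order_operator_has_eigenvector[of "R h" M "order H" f])
      show "(\<lambda>x. p * u x + q * v x) \<in> M" if "u \<in> M" "v \<in> M" for u v p q
        using that by (auto simp: M_def N_lin lin algebra_simps)
      show "R h v \<in> M" if "v \<in> M" for v
      proof -
        have "R g (R h v) = (\<lambda>x. s g * R h v x)" if "g \<in> S" for g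
        proof -
          have "v \<in> N" "R g v = (\<lambda>x. s g * v x)" using \<open>v \<in> M\<close> that by (auto simp: M_def)
          then have "R g (R h v) = R h (R g v)"
            using R_mult[OF S[OF that] h, of v] R_mult[OF h S[OF that], of v] m_comm[OF h S[OF
                that]] by simp
          then show ?thesis by (simp add: \<open>R g v = (\<lambda>x. s g * v x)\<close> scale)
        qed
        then show ?thesis using that R_N[OF h] by (auto simp: M_def)
      qed
      show "order H > 0" using fin by (simp add: order_gt_0_iff_finite)
      show "(R h ^^ order H) v = v" if "v \<in> M" for v
        using that pow[of v "order H"] pow_order_eq_1[OF h] by (simp add: M_def R_one)
      show "f \<in> M" using f s by (simp add: M_def)
    qed (use f lin in auto)
    then have "v \<in> N" "\<forall>g\<in>insert h S. \<exists>s. R g v = (\<lambda>x. s * v x)" by (auto simp: M_def)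
    with \<open>v \<noteq> (\<lambda>_. 0)\<close> show ?case by blast
  qed
  from this[OF subset_refl] obtain v where v: "v \<in> N" "v \<noteq> (\<lambda>_. 0)"
    "\<forall>h\<in>carrier H. \<exists>s. R h v = (\<lambda>x. s * v x)" by blast
  then obtain \<chi> where \<chi>: "\<And>h. h \<in> carrier H \<Longrightarrow> R h v = (\<lambda>x. \<chi> h * v x)" by metis
  obtain x where x: "v x \<noteq> 0" using v(2) by auto
  have mult: "\<chi> (g \<otimes>\<^bsub>H\<^esub> h) = \<chi> g * \<chi> h" if "g \<in> carrier H" "h \<in> carrier H" for g h
  proof -
    have "(\<lambda>x. \<chi> (g \<otimes>\<^bsub>H\<^esub> h) * v x) = R g (R h v)"
      using R_mult[OF that v(1)] \<chi>[OF m_closed[OF that]] by simp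
    also have "\<dots> = (\<lambda>x. \<chi> h * (\<chi> g * v x))" by (simp add: \<chi> that scale)
    finally have "\<chi> (g \<otimes>\<^bsub>H\<^esub> h) * v x = \<chi> h * (\<chi> g * v x)" by (rule fun_cong)
    then show ?thesis using x by simp
  qed
  have one: "\<chi> \<one>\<^bsub>H\<^esub> = 1"
    using fun_cong[OF \<chi>[OF one_closed], of x] R_one[OF v(1)] x by simp
  have "\<chi> h \<noteq> 0" if "h \<in> carrier H" for h
    using mult[OF that inv_closed[OF that]] one that by auto
  then have "\<chi> \<in> hom H complex_units"
    using mult by (auto simp: hom_def complex_units_def)
  then show thesis using that v \<chi> by blast
qed

section \<open>Characters and labellings\<close>

text \<open>Ensures that each \<open>Omega A n \<kappa>\<close> is nonempty, and hence that the
  labelling selected in \<open>V_space\<close> exists.\<close>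

lemma ex_labelling_with_fibre_cards:
  assumes "finite C" "finite S" "card S = (\<Sum>\<chi>\<in>C. \<kappa> \<chi>)"
  shows "\<exists>z\<in>S \<rightarrow>\<^sub>E C. \<forall>\<chi>\<in>C. card {i \<in> S. z i = \<chi>} = \<kappa> \<chi>"
  using assms
proof (induction C arbitrary: S rule: finite_induct)
  case empty
  then show ?case by auto
next
  case (insert \<chi> C)
  have "\<kappa> \<chi> \<le> card S" using insert by simp
  then obtain T where T: "T \<subseteq> S" "card T = \<kappa> \<chi>" by (meson obtain_subset_with_card_n)
  have "card (S - T) = (\<Sum>\<chi>\<in>C. \<kappa> \<chi>)"
    using insert T by (simp add: card_Diff_subset finite_subset)
  then obtain z where z: "z \<in> (S - T) \<rightarrow>\<^sub>E C" "\<And>\<psi>. \<psi> \<in> C \<Longrightarrow> card {i \<in> S - T. z i = \<psi>} = \<kappa> \<psi>"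
    using insert.IH[of "S - T"] insert.prems by auto
  define z' where "z' i = (if i \<in> T then \<chi> else z i)" for i
  have "z' \<in> S \<rightarrow>\<^sub>E insert \<chi> C"
    using z(1) T(1) by (auto simp: z'_def PiE_iff extensional_def)
  moreover have "{i \<in> S. z' i = \<chi>} = T"
    using z(1) T(1) insert.hyps(2) by (auto simp: z'_def PiE_iff)
  moreover have "{i \<in> S. z' i = \<psi>} = {i \<in> S - T. z i = \<psi>}" if "\<psi> \<in> C" for \<psi>
    using that insert.hyps(2) by (auto simp: z'_def)
  ultimately show ?case using T(2) z(2) by (intro bexI[of _ z']) auto
qed

lemma sum_of_bool_eq_mult:
  fixes D :: "'x \<Rightarrow> complex"
  assumes "finite X" "h0 \<in> X"
  shows "(\<Sum>h\<in>X. of_real (r * of_bool (h = h0)) * D h) = of_real r * D h0"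
proof -
  have "(\<Sum>h\<in>X. of_real (r * of_bool (h = h0)) * D h) = (\<Sum>h\<in>X. if h
      = h0 then of_real r * D h0 else 0)"
    by (intro sum.cong) auto
  then show ?thesis using assms by simp
qed

section \<open>Characters of \<open>A\<close> and of its power, and triviality of the induced
  representations\<close>

context finite_wreath
begin

lemma char_hom: "\<chi> \<in> characters A \<Longrightarrow> \<chi> \<in> hom A complex_units"
  by (simp add: characters_def)

lemma char_mult: "\<chi> \<in> characters A \<Longrightarrow> a \<in> carrier A \<Longrightarrow> b \<in> carrier A \<Longrightarrow> \<chi> (a \<otimes> b) = \<chi> a * \<chi> b"
  using hom_mult[OF char_hom] by (simp add: complex_units_def)

lemma char_nonzero: "\<chi> \<in> characters A \<Longrightarrow> a \<in> carrier A \<Longrightarrow> \<chi> a \<noteq> 0"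
  using hom_in_carrier[OF char_hom] by (simp add: complex_units_def)

lemma char_one: "\<chi> \<in> characters A \<Longrightarrow> \<chi> \<one> = 1"
  using char_mult[of \<chi> \<one> \<one>] char_nonzero[of \<chi> \<one>] by simp

lemma char_order: "\<chi> \<in> characters A \<Longrightarrow> a \<in> carrier A \<Longrightarrow> \<chi> a ^ order A = 1"
proof -
  assume *: "\<chi> \<in> characters A" "a \<in> carrier A"
  have "\<chi> (a [^] k) = \<chi> a ^ k" for k :: nat
    by (induction k) (use * in \<open>simp_all add: char_one char_mult\<close>)
  from this[of "order A"] show ?thesis using * by (simp add: pow_order_eq_1 char_one)
qed

lemma order_A_pos: "order A > 0"
  using finite_A by (simp add: order_gt_0_iff_finite)

text \<open>Values of characters are roots of unity, so they have modulus 1 and their inverses are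
  their conjugates.\<close>

lemma char_inv: "\<chi> \<in> characters A \<Longrightarrow> a \<in> carrier A \<Longrightarrow> \<chi> (inv a) = cnj (\<chi> a)"
proof -
  assume *: "\<chi> \<in> characters A" "a \<in> carrier A"
  have "norm (\<chi> a) ^ order A = 1" using char_order[OF *] by (metis norm_one norm_power)
  then have "norm (\<chi> a) = 1" using power_eq_imp_eq_base[of "norm (\<chi> a)" "order A" 1] order_A_pos
      by simp
  then have "\<chi> a * cnj (\<chi> a) = 1" using complex_norm_square[of "\<chi> a"] by simp
  moreover have "\<chi> a * \<chi> (inv a) = 1"
    using * char_mult[of \<chi> a "inv a"] by (simp add: char_one)
  ultimately show ?thesis using char_nonzero[OF *] by (metis mult_left_cancel)
qed

lemma finite_characters: "finite (characters A)"
proof (rule finite_subset)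
  show "characters A \<subseteq> carrier A \<rightarrow>\<^sub>E {z. z ^ order A = 1}"
  proof
    fix \<chi> assume "\<chi> \<in> characters A"
    then show "\<chi> \<in> carrier A \<rightarrow>\<^sub>E {z. z ^ order A = 1}"
      using char_order by (auto simp: PiE_iff characters_def)
  qed
  show "finite (carrier A \<rightarrow>\<^sub>E {z::complex. z ^ order A = 1})"
    using finite_A order_A_pos by (intro finite_PiE) (auto intro: finite_roots_unity)
qed

lemma trivial_character_in: "trivial_character A \<in> characters A"
  by (auto simp: characters_def trivial_character_def hom_def complex_units_def)

lemma nontrivial_char:
  assumes "\<chi> \<in> characters A" "\<chi> \<noteq> trivial_character A"
  obtains a where "a \<in> carrier A" "\<chi> a \<noteq> 1"
proof -
  have "\<exists>a\<in>carrier A. \<chi> a \<noteq> 1"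
  proof (rule ccontr)
    assume "\<not> ?thesis"
    then have "\<chi> = trivial_character A"
      using assms(1) by (auto simp: trivial_character_def characters_def extensional_def fun_eq_iff)
    then show False using assms(2) by simp
  qed
  then show thesis using that by blast
qed

abbreviation "Labels \<equiv> {1..n} \<rightarrow>\<^sub>E characters A"

lemma pairing_mult:
  "z \<in> Labels \<Longrightarrow> g \<in> carrier B \<Longrightarrow> h \<in> carrier B
    \<Longrightarrow> pairing n z (g \<otimes>\<^bsub>B\<^esub> h) = pairing n z g * pairing n z h"
  unfolding pairing_def prod.distrib[symmetric]
  by (intro prod.cong refl) (auto simp: B_apply char_mult PiE_iff)

lemma pairing_one: "z \<in> Labels \<Longrightarrow> pairing n z \<one>\<^bsub>B\<^esub> = 1"
  unfolding pairing_def by (intro prod.neutral) (auto simp: char_one PiE_iff)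

lemma pairing_inv: "z \<in> Labels \<Longrightarrow> g \<in> carrier B \<Longrightarrow> pairing n z (inv\<^bsub>B\<^esub> g) = cnj (pairing n z g)"
  unfolding pairing_def cnj_prod
  by (intro prod.cong refl) (use B_inv_apply B_apply
      in \<open>auto simp: char_inv PiE_iff simp del: inv_product_group\<close>)

lemma pairing_perm_act:
  assumes "\<pi> \<in> Perms"
  shows "pairing n (perm_act n \<pi> z) (perm_act n \<pi> g) = pairing n z g"
proof -
  have "pairing n (perm_act n \<pi> z) (perm_act n \<pi> g) = (\<Prod>i\<in>{1..n}. z (inv' \<pi> i) (g (inv' \<pi> i)))"
    unfolding pairing_def by (intro prod.cong refl) (simp add: perm_act_apply)
  also have "\<dots> = pairing n z g"
    unfolding pairing_def
    using prod.permute[of "inv' \<pi>" "{1..n}" "\<lambda>i. z i (g i)"] permutes_inv[of \<pi> "{1..n}"] assms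
    by (simp add: o_def)
  finally show ?thesis .
qed

lemma pairing_trivial: "(\<And>i. i \<in> {1..n} \<Longrightarrow> z i = trivial_character A) \<Longrightarrow> g \<in> carrier B
    \<Longrightarrow> pairing n z g = 1"
  unfolding pairing_def using B_apply by (intro prod.neutral) (auto simp: trivial_character_def)

lemma nontrivial_pairing:
  assumes "z \<in> Labels" "i \<in> {1..n}" "z i \<noteq> trivial_character A"
  obtains y where "y \<in> carrier B" "pairing n z y \<noteq> 1"
proof -
  have zi: "z i \<in> characters A" using assms by (auto simp: PiE_iff)
  then obtain a where a: "a \<in> carrier A" "z i a \<noteq> 1" using nontrivial_char assms(3) by blast
  define y where "y = (\<lambda>j\<in>{1..n}. if j = i then a else \<one>)"
  have "y \<in> carrier B" using a(1) by (auto simp: y_def)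
  moreover have "pairing n z y = (\<Prod>j\<in>{1..n}. if j = i then z i a else 1)"
    unfolding pairing_def using assms(1) by (intro prod.cong refl)
        (auto simp: y_def char_one PiE_iff)
  then have "pairing n z y = z i a" using assms(2) by simp
  ultimately show thesis using that a(2) by auto
qed

text \<open>Translating the sum by an element on which the character is not 1 multiplies it by that
  value.\<close>

lemma sum_pairing_eq_0:
  assumes "z \<in> Labels" "i \<in> {1..n}" "z i \<noteq> trivial_character A"
  shows "(\<Sum>g\<in>carrier B. pairing n z g) = 0"
proof -
  interpret B: group B by (rule group_B)
  obtain y where y: "y \<in> carrier B" "pairing n z y \<noteq> 1" using nontrivial_pairing assms by blast
  have "(\<Sum>g\<in>carrier B. pairing n z g) = (\<Sum>g\<in>carrier B. pairing n z (y \<otimes>\<^bsub>B\<^esub> g))"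
    by (rule sum.reindex_bij_witness[where i = "\<lambda>g. y \<otimes>\<^bsub>B\<^esub> g" and j = "\<lambda>g. inv\<^bsub>B\<^esub> y \<otimes>\<^bsub>B\<^esub> g"])
      (use y(1) in \<open>simp_all add: B.m_assoc[symmetric] B.r_inv B.l_inv B.l_one
        del: product_group_simps\<close>)
  also have "\<dots> = pairing n z y * (\<Sum>g\<in>carrier B. pairing n z g)"
    using assms(1) y(1) by (simp add: pairing_mult sum_distrib_left del: product_group_simps)
  finally show ?thesis using y(2) by simp
qed

text \<open>The dual of a power is the power of the dual: \<open>z i\<close> is
  \<open>\<chi>\<close> restricted to the \<open>i\<close>-th factor, and \<open>part J\<close>
  rebuilds \<open>g\<close> from its coordinates one index at a time.\<close>

lemma hom_B_eq_pairing:
  assumes \<chi>: "\<chi> \<in> hom B complex_units"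
  obtains z where "z \<in> Labels" "\<And>g. g \<in> carrier B \<Longrightarrow> \<chi> g = pairing n z g"
proof -
  interpret B: group B by (rule group_B)
  have mult: "\<chi> (g \<otimes>\<^bsub>B\<^esub> h) = \<chi> g * \<chi> h" if "g \<in> carrier B" "h \<in> carrier B" for g h
    using hom_mult[OF \<chi> that] by (simp add: complex_units_def)
  have nz: "\<chi> g \<noteq> 0" if "g \<in> carrier B" for g
    using hom_in_carrier[OF \<chi> that] by (simp add: complex_units_def)
  have one: "\<chi> \<one>\<^bsub>B\<^esub> = 1"
    using mult[OF B.one_closed B.one_closed] nz[OF B.one_closed] B.l_one[OF B.one_closed] by simp
  define single where "single i a = (\<lambda>j\<in>{1..n}. if j = i then a else \<one>)" for i a
  define z where "z = (\<lambda>i\<in>{1..n}. \<lambda>a\<in>carrier A. \<chi> (single i a))"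
  have single: "single i a \<in> carrier B" if "a \<in> carrier A" for i a
    using that by (auto simp: single_def)
  have "z i \<in> characters A" if "i \<in> {1..n}" for i
  proof -
    have "single i (a \<otimes> b) = single i a \<otimes>\<^bsub>B\<^esub> single i b" if "a \<in> carrier A" "b \<in> carrier A" for a b
      using that by (auto simp: single_def intro!: restrict_ext)
    then show ?thesis
      using that mult single nz
      by (simp add: z_def characters_def hom_def complex_units_def del: mult_product_group)
  qed
  then have "z \<in> Labels" by (auto simp: z_def)
  moreover have "\<chi> g = pairing n z g" if g: "g \<in> carrier B" for g
  proof -
    define part where "part J = (\<lambda>j\<in>{1..n}. if j \<in> J then g j else \<one>)" for J
    have part: "part J \<in> carrier B" for J using B_apply[OF g] by (auto simp: part_def)
    have "\<chi> (part J) = (\<Prod>j\<in>J. z j (g j))" if "J \<subseteq> {1..n}" for J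
      using finite_subset[OF that finite_atLeastAtMost] that
    proof (induction J rule: finite_induct)
      case empty
      have "part {} = \<one>\<^bsub>B\<^esub>" by (auto simp: part_def)
      then show ?case by (simp add: one del: one_product_group)
    next
      case (insert i J)
      have gi: "g i \<in> carrier A" using B_apply[OF g] insert.prems by auto
      have "part (insert i J) = single i (g i) \<otimes>\<^bsub>B\<^esub> part J"
        using B_apply[OF g] insert.hyps(2) by (auto simp: part_def single_def intro!: restrict_ext)
      then have "\<chi> (part (insert i J)) = \<chi> (single i (g i)) * \<chi> (part J)"
        using mult[OF single[OF gi] part] by simp
      then show ?case using insert gi by (simp add: z_def)
    qed
    from this[OF subset_refl] have "\<chi> (part {1..n}) = pairing n z g" by (simp add: pairing_def)
    moreover have "part {1..n} = g" by (rule B_eqI[OF part g]) (simp add: part_def)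
    ultimately show ?thesis by simp
  qed
  ultimately show thesis using that by blast
qed

lemma Omega_Labels: "z \<in> Omega A n \<kappa> \<Longrightarrow> z \<in> Labels"
  by (simp add: Omega_def)

lemma finite_Omega: "finite (Omega A n \<kappa>)"
  by (rule finite_subset[of _ Labels])
    (auto simp: Omega_def intro!: finite_PiE finite_characters)

lemma perm_act_Omega:
  assumes "\<pi> \<in> Perms" "z \<in> Omega A n \<kappa>"
  shows "perm_act n \<pi> z \<in> Omega A n \<kappa>"
proof -
  have "card {i \<in> {1..n}. perm_act n \<pi> z i = \<chi>} = card {i \<in> {1..n}. z i = \<chi>}" for \<chi>
  proof (rule bij_betw_same_card[OF bij_betw_byWitness[where f = "inv' \<pi>" and f' = \<pi>]])
    show "\<forall>a\<in>{i \<in> {1..n}. perm_act n \<pi> z i = \<chi>}. \<pi> (inv' \<pi> a) = a"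
      "\<forall>a'\<in>{i \<in> {1..n}. z i = \<chi>}. inv' \<pi> (\<pi> a') = a'"
      using assms(1) by (auto simp: permutes_inverses)
    show "inv' \<pi> ` {i \<in> {1..n}. perm_act n \<pi> z i = \<chi>} \<subseteq> {i \<in> {1..n}. z i = \<chi>}"
      using perm_inv_in[OF assms(1)] by (auto simp: perm_act_apply simp del: atLeastAtMost_iff)
    show "\<pi> ` {i \<in> {1..n}. z i = \<chi>} \<subseteq> {i \<in> {1..n}. perm_act n \<pi> z i = \<chi>}"
      using perm_in[OF assms(1)] assms(1)
      by (auto simp: perm_act_apply permutes_inverses simp del: atLeastAtMost_iff)
  qed
  moreover have "perm_act n \<pi> z \<in> Labels"
    using assms by (intro perm_act_PiE Omega_Labels)
  ultimately show ?thesis using assms(2) by (simp add: Omega_def)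
qed

lemma Omega_nonempty: "\<kappa> \<in> multiplicity_vectors A n \<Longrightarrow> Omega A n \<kappa> \<noteq> {}"
  using ex_labelling_with_fibre_cards[OF finite_characters, of "{1..n}" \<kappa>]
  by (auto simp: multiplicity_vectors_def Omega_def)

lemma Omega_trivial_iff:
  assumes "z \<in> Omega A n \<kappa>"
  shows "\<kappa> (trivial_character A) = n \<longleftrightarrow> (\<forall>i\<in>{1..n}. z i = trivial_character A)"
proof -
  have "\<kappa> (trivial_character A) = card {i \<in> {1..n}. z i = trivial_character A}"
    using assms trivial_character_in by (simp add: Omega_def)
  moreover have "card {i \<in> {1..n}. z i = trivial_character A} = n
      \<longleftrightarrow> {i \<in> {1..n}. z i = trivial_character A} = {1..n}"
  proof
    assume "card {i \<in> {1..n}. z i = trivial_character A} = n"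
    then show "{i \<in> {1..n}. z i = trivial_character A} = {1..n}"
      by (intro card_subset_eq) auto
  qed simp
  moreover have "{i \<in> {1..n}. z i = trivial_character A} = {1..n}
      \<longleftrightarrow> (\<forall>i\<in>{1..n}. z i = trivial_character A)"
    by blast
  ultimately show ?thesis by simp
qed

lemma ex_multiplicity_vector:
  assumes "z \<in> Labels"
  obtains \<kappa> where "\<kappa> \<in> multiplicity_vectors A n" "z \<in> Omega A n \<kappa>"
proof -
  define \<kappa> where "\<kappa> = (\<lambda>\<chi>\<in>characters A. card {i \<in> {1..n}. z i = \<chi>})"
  have "(\<Sum>\<chi>\<in>characters A. \<kappa> \<chi>) = (\<Sum>\<chi>\<in>characters A. \<Sum>i\<in>{i \<in> {1..n}. z i = \<chi>}. 1)"
    by (simp add: \<kappa>_def)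
  also have "\<dots> = (\<Sum>i\<in>{1..n}. 1)"
    by (rule sum.group) (use assms finite_characters in auto)
  finally have "\<kappa> \<in> multiplicity_vectors A n"
    by (simp add: multiplicity_vectors_def \<kappa>_def)
  moreover have "z \<in> Omega A n \<kappa>" using assms by (simp add: Omega_def \<kappa>_def)
  ultimately show thesis by (rule that)
qed

text \<open>If all labels are trivial, the inducing subgroup is the whole group with trivial
  character, and the induced space consists of the constants. Conversely, a nonzero invariant vector
  is a nonzero constant on the group, and its transformation rule under the elements
  \<open>(g; 1)\<close> forces the pairing of \<open>z\<close> with every \<open>g\<close> to be
  1.\<close>

lemma V_trivial_iff:
  assumes "\<kappa> \<in> multiplicity_vectors A n"
  shows "V_trivial A n \<kappa> \<longleftrightarrow> \<kappa> (trivial_character A) = n"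
proof -
  interpret B: group B by (rule group_B)
  interpret G: group G by (rule group_G)
  define z where "z = (SOME z. z \<in> Omega A n \<kappa>)"
  have z: "z \<in> Omega A n \<kappa>" unfolding z_def using Omega_nonempty[OF assms] by (simp add: some_in_eq)
  define V where "V = induced_space G (block_subgroup A n z) (\<lambda>(g, \<pi>). pairing n z g)"
  have V: "V_space A n \<kappa> = V" by (simp add: V_space_def V_def z_def Let_def)
  define u :: "(nat \<Rightarrow> 'a) \<times> (nat \<Rightarrow> nat) \<Rightarrow> complex" where "u x = of_bool (x \<in> carrier G)" for x
  show ?thesis
  proof
    assume "\<kappa> (trivial_character A) = n"
    then have triv: "z i = trivial_character A" if "i \<in> {1..n}" for i
      using Omega_trivial_iff[OF z] that by simp
    have "block_subgroup A n z = carrier G"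
      using perm_in triv by (auto simp: block_subgroup_def carrier_G
        simp del: carrier_product_group)
    moreover have "(case k of (g, \<pi>) \<Rightarrow> pairing n z g) = 1" if "k \<in> carrier G" for k
      using that pairing_trivial[of z] triv by
          (auto simp: carrier_G simp del: carrier_product_group)
    ultimately have V_eq: "V = {F \<in> fun_space (carrier G). \<forall>x\<in>carrier G. \<forall>k\<in>carrier G. F (x \<otimes>\<^bsub>G\<^esub>
        k) = F x}"
      by (simp add: V_def induced_space_def)
    have const: "v = (\<lambda>x. v \<one>\<^bsub>G\<^esub> * u x)" if "v \<in> V" for v
    proof
      fix x
      show "v x = v \<one>\<^bsub>G\<^esub> * u x"
      proof (cases "x \<in> carrier G")
        case True
        then have "v (\<one>\<^bsub>G\<^esub> \<otimes>\<^bsub>G\<^esub> x) = v \<one>\<^bsub>G\<^esub>" using that V_eq by blast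
        then show ?thesis using True by (simp add: u_def)
      next
        case False
        then show ?thesis using that unfolding V_eq fun_space_def u_def by (cases x) simp
      qed
    qed
    have "u \<in> V" by (auto simp: V_eq u_def fun_space_def)
    moreover have "u \<noteq> (\<lambda>_. 0)"
    proof
      assume "u = (\<lambda>_. 0)"
      then have "u \<one>\<^bsub>G\<^esub> = 0" by simp
      then show False using G.one_closed unfolding u_def by simp
    qed
    moreover have "left_translate G h v = v" if "h \<in> carrier G" "v \<in> V" for h v
      by (subst (1 2) const[OF that(2)]) (use that
          in \<open>auto simp: left_translate_def u_def fun_eq_iff\<close>)
    ultimately show "V_trivial A n \<kappa>"
      unfolding V_trivial_def V is_trivial_rep_def using const by blast
  next
    assume "V_trivial A n \<kappa>"
    then obtain v where v: "v \<in> V" "v \<noteq> (\<lambda>_. 0)" "\<And>h. h \<in> carrier G \<Longrightarrow> left_translate G h v = v"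
      unfolding V_trivial_def V is_trivial_rep_def by blast
    have const: "v x = v \<one>\<^bsub>G\<^esub>" if "x \<in> carrier G" for x
      using fun_cong[OF v(3)[OF that], of x] that by (simp add: left_translate_def)
    have "v \<one>\<^bsub>G\<^esub> \<noteq> 0"
    proof
      assume 0: "v \<one>\<^bsub>G\<^esub> = 0"
      have "v x = 0" for x
      proof (cases "x \<in> carrier G")
        case True then show ?thesis using const 0 by simp
      next
        case False then show ?thesis using v(1) by (cases x)
            (simp add: V_def induced_space_def fun_space_def)
      qed
      then show False using v(2) by auto
    qed
    have "pairing n z g = 1" if "g \<in> carrier B" for g
    proof -
      have gG: "(g, id) \<in> carrier G" using that id_Perms by
          (simp add: carrier_G del: carrier_product_group)
      then have "(g, id) \<in> block_subgroup A n z" by (simp add: block_subgroup_def)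
      then have "v (\<one>\<^bsub>G\<^esub> \<otimes>\<^bsub>G\<^esub> (g, id)) = inverse (pairing n z g) * v \<one>\<^bsub>G\<^esub>"
        using v(1) G.one_closed unfolding V_def induced_space_def by fastforce
      then show ?thesis using gG const[OF gG] \<open>v \<one>\<^bsub>G\<^esub> \<noteq> 0\<close> by simp
    qed
    then have "\<forall>i\<in>{1..n}. z i = trivial_character A"
      using nontrivial_pairing[OF Omega_Labels[OF z]] by blast
    then show "\<kappa> (trivial_character A) = n" using Omega_trivial_iff[OF z] by simp
  qed
qed

section \<open>The Laplacian of the wreath product in coordinates\<close>

lemma wreath_laplacian:
  assumes "(g, \<pi>) \<in> carrier G"
  shows "group_laplacian G (wreath_weight A n a c) f (g, \<pi>) =
    (\<Sum>(i, j)\<in>ordered_pairs n. of_real (a i j)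
        * (f (g, \<pi>) - f (perm_act n (transpose i j) g, transpose i j \<circ> \<pi>)))
    + (\<Sum>y\<in>carrier B. of_real (c y) * (f (g, \<pi>) - f (inv\<^bsub>B\<^esub> y \<otimes>\<^bsub>B\<^esub> g, \<pi>)))"
proof -
  interpret B: group B by (rule group_B)
  define D where "D h = f (g, \<pi>) - left_translate G h f (g, \<pi>)" for h
  have pairs: "i \<in> {1..n}" "j \<in> {1..n}" if "(i, j) \<in> ordered_pairs n" for i j
    using that by (auto simp: ordered_pairs_def)
  have "group_laplacian G (wreath_weight A n a c) f (g, \<pi>)
      = (\<Sum>h\<in>carrier G. (\<Sum>(i, j)\<in>ordered_pairs n. of_real (a i j * of_bool (h
          = (\<one>\<^bsub>B\<^esub>, transpose i j))) * D h)
         + (\<Sum>y\<in>carrier B. of_real (c y * of_bool (h = (y, id))) * D h))"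
    unfolding group_laplacian_def wreath_weight_def D_def[symmetric] sym_group_one
    by (simp add: distrib_right sum_distrib_right case_prod_unfold del: of_real_mult)
  also have "\<dots> = (\<Sum>(i, j)\<in>ordered_pairs n. \<Sum>h\<in>carrier G. of_real (a i j * of_bool (h
      = (\<one>\<^bsub>B\<^esub>, transpose i j))) * D h)
      + (\<Sum>y\<in>carrier B. \<Sum>h\<in>carrier G. of_real (c y * of_bool (h = (y, id))) * D h)"
    unfolding sum.distrib case_prod_unfold by (simp only: sum.swap[of _ _ "carrier G"])
  also have "(\<Sum>y\<in>carrier B. \<Sum>h\<in>carrier G. of_real (c y * of_bool (h = (y, id))) * D h)
      = (\<Sum>y\<in>carrier B. of_real (c y) * D (y, id))"
    by (intro sum.cong refl sum_of_bool_eq_mult finite_G)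
      (use id_Perms in \<open>simp add: carrier_G del: carrier_product_group\<close>)
  also have "\<dots> = (\<Sum>y\<in>carrier B. of_real (c y) * (f (g, \<pi>) - f (inv\<^bsub>B\<^esub> y \<otimes>\<^bsub>B\<^esub> g, \<pi>)))"
    unfolding D_def by (intro sum.cong refl) (simp only: left_translate_base assms)
  also have "(\<Sum>(i, j)\<in>ordered_pairs n. \<Sum>h\<in>carrier G. of_real (a i j * of_bool (h
      = (\<one>\<^bsub>B\<^esub>, transpose i j))) * D h)
      = (\<Sum>(i, j)\<in>ordered_pairs n. of_real (a i j) * D (\<one>\<^bsub>B\<^esub>, transpose i j))"
  proof (intro sum.cong refl, clarify, rule sum_of_bool_eq_mult[OF finite_G])
    fix i j assume "(i, j) \<in> ordered_pairs n"
    then show "(\<one>\<^bsub>B\<^esub>, transpose i j) \<in> carrier G"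
      using pairs transpose_Perms B.one_closed
      by (simp add: carrier_G del: product_group_simps)
  qed
  also have "\<dots> = (\<Sum>(i, j)\<in>ordered_pairs n. of_real (a i j)
        * (f (g, \<pi>) - f (perm_act n (transpose i j) g, transpose i j \<circ> \<pi>)))"
    unfolding D_def
    by (intro sum.cong refl, clarify) (simp only: left_translate_transpose assms pairs)
  finally show ?thesis .
qed

end

section \<open>Dirichlet forms\<close>

text \<open>Each involution permutes \<open>P\<close>, so composition with it is self-adjoint; the
  potential is a multiplication operator.\<close>

lemma pair_form_symmetric:
  fixes f g q :: "'p \<Rightarrow> real"
  assumes "\<And>i j p. (i, j) \<in> E \<Longrightarrow> p \<in> P \<Longrightarrow> t i j p \<in> P \<and> t i j (t i j p) = p"
  shows "(\<Sum>p\<in>P. f p * ((\<Sum>(i, j)\<in>E. a i j * (g p - g (t i j p))) + q p * g p))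
    = (\<Sum>p\<in>P. ((\<Sum>(i, j)\<in>E. a i j * (f p - f (t i j p))) + q p * f p) * g p)"
proof -
  have expand: "(\<Sum>p\<in>P. f p * ((\<Sum>(i, j)\<in>E. a i j * (g p - g (t i j p))) + q p * g p))
      = (\<Sum>(i, j)\<in>E. a i j * (\<Sum>p\<in>P. f p * (g p - g (t i j p)))) + (\<Sum>p\<in>P. q p * (f p * g p))"
    for f g :: "'p \<Rightarrow> real"
  proof -
    have "(\<Sum>p\<in>P. f p * ((\<Sum>(i, j)\<in>E. a i j * (g p - g (t i j p))) + q p * g p))
        = (\<Sum>p\<in>P. \<Sum>(i, j)\<in>E. a i j * (f p * (g p - g (t i j p)))) + (\<Sum>p\<in>P. q p * (f p * g p))"
      by (simp only: distrib_left sum.distrib sum_distrib_left case_prod_unfold mult.left_commute)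
    then show ?thesis
      by (subst (asm) sum.swap) (simp only: case_prod_unfold sum_distrib_left)
  qed
  have "(\<Sum>p\<in>P. f p * (g p - g (t i j p))) = (\<Sum>p\<in>P. g p * (f p - f (t i j p)))"
    if "(i, j) \<in> E" for i j
  proof -
    have "(\<Sum>p\<in>P. f p * g (t i j p)) = (\<Sum>p\<in>P. g p * f (t i j p))"
      by (rule sum.reindex_bij_witness[where i = "t i j" and j = "t i j"]) (use assms that in auto)
    then show ?thesis by (simp add: right_diff_distrib sum_subtractf mult.commute)
  qed
  then have "(\<Sum>(i, j)\<in>E. a i j * (\<Sum>p\<in>P. f p * (g p - g (t i j p))))
      = (\<Sum>(i, j)\<in>E. a i j * (\<Sum>p\<in>P. g p * (f p - f (t i j p))))"
    by (intro sum.cong refl) auto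
  moreover have "(\<Sum>p\<in>P. ((\<Sum>(i, j)\<in>E. a i j * (f p - f (t i j p))) + q p * f p) * g p)
      = (\<Sum>p\<in>P. g p * ((\<Sum>(i, j)\<in>E. a i j * (f p - f (t i j p))) + q p * f p))"
    by (intro sum.cong refl mult.commute)
  moreover have "(\<Sum>p\<in>P. q p * (f p * g p)) = (\<Sum>p\<in>P. q p * (g p * f p))"
    by (simp only: mult.commute)
  ultimately show ?thesis by (simp only: expand)
qed

text \<open>Abstract in the involutions and the potential, so as to cover both coordinate swaps of
  labellings and left multiplication of permutations. Halving corrects for \<open>p\<close> and
  \<open>t i j p\<close> giving the same square.\<close>

lemma pair_form_energy:
  fixes f q :: "'p \<Rightarrow> real"
  assumes "\<And>i j p. (i, j) \<in> E \<Longrightarrow> p \<in> P \<Longrightarrow> t i j p \<in> P \<and> t i j (t i j p) = p"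
  shows "(\<Sum>p\<in>P. f p * ((\<Sum>(i, j)\<in>E. a i j * (f p - f (t i j p))) + q p * f p))
    = (\<Sum>(i, j)\<in>E. a i j * ((\<Sum>p\<in>P. (f p - f (t i j p))^2) / 2)) + (\<Sum>p\<in>P. q p * (f p)^2)"
proof -
  have "(\<Sum>p\<in>P. f p * (f p - f (t i j p))) = (\<Sum>p\<in>P. (f p - f (t i j p))^2) / 2" if "(i, j) \<in> E"
      for i j
    using sum_product_diff_swap[of P "t i j" f] assms that by simp
  note half = this
  have "(\<Sum>p\<in>P. f p * ((\<Sum>(i, j)\<in>E. a i j * (f p - f (t i j p))) + q p * f p))
      = (\<Sum>p\<in>P. \<Sum>(i, j)\<in>E. a i j * (f p * (f p - f (t i j p)))) + (\<Sum>p\<in>P. q p * (f p * f p))"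
    by (simp only: distrib_left sum.distrib sum_distrib_left case_prod_unfold mult.left_commute)
  also have "(\<Sum>p\<in>P. \<Sum>(i, j)\<in>E. a i j * (f p * (f p - f (t i j p))))
      = (\<Sum>(i, j)\<in>E. a i j * (\<Sum>p\<in>P. f p * (f p - f (t i j p))))"
    by (subst sum.swap) (simp only: case_prod_unfold sum_distrib_left)
  also have "\<dots> = (\<Sum>(i, j)\<in>E. a i j * ((\<Sum>p\<in>P. (f p - f (t i j p))^2) / 2))"
    by (intro sum.cong refl) (auto simp: half)
  finally show ?thesis by (simp add: power2_eq_square)
qed

text \<open>The reverse triangle inequality. It is the reason why replacing a function by its norms
  on fibres does not increase the energy.\<close>

lemma L2_set_diff_square_le:
  "(L2_set f S - L2_set g S)^2 \<le> (\<Sum>x\<in>S. (f x - g x)^2)"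
proof -
  have "L2_set f S \<le> L2_set (\<lambda>x. f x - g x) S + L2_set g S"
    using L2_set_triangle_ineq[of "\<lambda>x. f x - g x" g S] by simp
  moreover have "L2_set g S \<le> L2_set (\<lambda>x. f x - g x) S + L2_set f S"
    using L2_set_triangle_ineq[of "\<lambda>x. g x - f x" f S] by (simp add: L2_set_def power2_commute)
  ultimately have "\<bar>L2_set f S - L2_set g S\<bar> \<le> L2_set (\<lambda>x. f x - g x) S" by linarith
  then have "(L2_set f S - L2_set g S)^2 \<le> (L2_set (\<lambda>x. f x - g x) S)^2"
    by (rule power2_le_iff_abs_le[THEN iffD2, rotated]) simp
  then show ?thesis by (simp add: L2_set_def sum_nonneg)
qed

text \<open>Only pairs containing \<open>y\<close> contribute. In the double sum each occurs as
  \<open>(y, j)\<close> and as \<open>(j, y)\<close>, which the halving compensates.\<close>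

lemma sum_transpose_diff:
  fixes g :: "nat \<Rightarrow> 'b::real_field" and a :: "nat \<Rightarrow> nat \<Rightarrow> real"
  assumes sym: "\<And>i j. i \<in> {1..n} \<Longrightarrow> j \<in> {1..n} \<Longrightarrow> a j i = a i j" and y: "y \<in> {1..n}"
  shows "(\<Sum>(i, j)\<in>ordered_pairs n. of_real (a i j) * (g y - g (transpose i j y)))
    = (\<Sum>j\<in>{1..n} - {y}. of_real (a y j) * (g y - g j))"
proof -
  let ?I = "{1..n}"
  define X where "X j = of_real (a y j) * (g y - g j)" for j
  have X0: "X y = 0" by (simp add: X_def)
  have "(\<Sum>(i, j)\<in>ordered_pairs n. of_real (a i j) * (g y - g (transpose i j y)))
      = (\<Sum>i\<in>?I. \<Sum>j\<in>?I. of_real (a i j) * (g y - g (transpose i j y))) / 2"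
    by (rule sum_ordered_pairs) (auto simp: sym transpose_commute)
  also have "(\<Sum>i\<in>?I. \<Sum>j\<in>?I. of_real (a i j) * (g y - g (transpose i j y)))
      = (\<Sum>i\<in>?I. \<Sum>j\<in>?I. (if i = y then X j else 0) + (if j = y then X i else 0))"
  proof (intro sum.cong refl)
    fix i j assume "i \<in> ?I" "j \<in> ?I"
    then show "of_real (a i j) * (g y - g (transpose i j y))
        = (if i = y then X j else 0) + (if j = y then X i else 0)"
      using X0 sym[OF y, of i] by (cases "i = y"; cases "j = y") (auto simp: X_def)
  qed
  also have "\<dots> = (\<Sum>j\<in>?I. X j) + (\<Sum>i\<in>?I. X i)"
    using y by (simp add: sum.distrib sum.swap[of "\<lambda>i j. if i = y then X j else 0"])
  also have "\<dots> / 2 = (\<Sum>j\<in>?I. X j)" by simp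
  also have "\<dots> = (\<Sum>j\<in>?I - {y}. X j)" using y X0 by (simp add: sum.remove)
  finally show ?thesis by (simp add: X_def)
qed

text \<open>Turns \<open>lambda_rw\<close> into a variational bound: a real minimal eigenvector,
  read as a complex one, shows that \<open>l\<close> is among the eigenvalues whose infimum is
  taken. The factor 2 reflects the ordered pairs in \<open>rw_energy\<close>.\<close>

lemma rw_minimal_eigenvalue:
  fixes a :: "nat \<Rightarrow> nat \<Rightarrow> real"
  assumes "n \<ge> 2" and sym: "\<And>i j. i \<in> {1..n} \<Longrightarrow> j \<in> {1..n} \<Longrightarrow> a j i = a i j"
  obtains l where "lambda_rw n a \<le> ereal l"
    "\<And>g. (\<Sum>y\<in>{1..n}. g y) = 0 \<Longrightarrow> 2 * l * (\<Sum>y\<in>{1..n}. (g y)^2) \<le> rw_energy {1..n} a g"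
proof -
  let ?I = "{1..n}"
  define T where "T g i = (if i \<in> ?I then \<Sum>j\<in>?I. a i j * (g i - g j) else 0)"
      for g :: "nat \<Rightarrow> real" and i
  define W where "W = {f::nat \<Rightarrow> real. (\<forall>x. x \<notin> ?I \<longrightarrow> f x = 0) \<and> (\<Sum>x\<in>?I. 1 * f x) = 0}"
  have form: "(\<Sum>i\<in>?I. f i * T g i) = (\<Sum>i\<in>?I. \<Sum>j\<in>?I. a i j * (f i * g i)) - (\<Sum>i\<in>?I. \<Sum>j\<in>?I. a i j *
      (f i * g j))"
    for f g
  proof -
    have "(\<Sum>i\<in>?I. f i * T g i) = (\<Sum>i\<in>?I. \<Sum>j\<in>?I. a i j * (f i * g i) - a i j * (f i * g j))"
      by (intro sum.cong refl) (simp add: T_def sum_distrib_left algebra_simps)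
    then show ?thesis by (simp only: sum_subtractf)
  qed
  have swap: "(\<Sum>i\<in>?I. \<Sum>j\<in>?I. a i j * (f i * g j)) = (\<Sum>i\<in>?I. \<Sum>j\<in>?I. a i j * (g i * f j))" for f g
    by (subst sum.swap) (intro sum.cong refl, simp add: sym mult.commute)
  have swap2: "(\<Sum>i\<in>?I. \<Sum>j\<in>?I. a i j * (g j * g j)) = (\<Sum>i\<in>?I. \<Sum>j\<in>?I. a i j * (g i * g i))" for g
    by (subst sum.swap) (intro sum.cong refl, simp add: sym)
  have T_sym: "(\<Sum>x\<in>?I. f x * T g x) = (\<Sum>x\<in>?I. T f x * g x)" for f g
  proof -
    have "(\<Sum>x\<in>?I. T f x * g x) = (\<Sum>x\<in>?I. g x * T f x)" by (simp only: mult.commute)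
    then show ?thesis unfolding form swap[of f g] by (simp only: mult.commute[of "f _"])
  qed
  have energy: "rw_energy ?I a g = 2 * (\<Sum>x\<in>?I. g x * T g x)" for g
  proof -
    have "rw_energy ?I a g = (\<Sum>i\<in>?I. \<Sum>j\<in>?I. a i j * (g i * g i)
        + a i j * (g j * g j) - 2 * (a i j * (g i * g j)))"
      unfolding rw_energy_def by (intro sum.cong refl) (simp add: power2_eq_square algebra_simps)
    also have "\<dots> = (\<Sum>i\<in>?I. \<Sum>j\<in>?I. a i j * (g i * g i)) + (\<Sum>i\<in>?I. \<Sum>j\<in>?I. a i j * (g j * g j))
        - 2 * (\<Sum>i\<in>?I. \<Sum>j\<in>?I. a i j * (g i * g j))"
      by (simp only: sum.distrib sum_subtractf sum_distrib_left)
    finally show ?thesis unfolding swap2 form by simp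
  qed
  obtain l f where lf: "f \<in> W" "f \<noteq> (\<lambda>_. 0)" "T f = (\<lambda>x. l * f x)"
    "\<And>g. g \<in> W \<Longrightarrow> (\<Sum>x\<in>?I. g x * T g x) \<ge> l * (\<Sum>x\<in>?I. (g x)^2)"
  proof (rule symmetric_operator_has_minimal_eigenvector[of ?I "\<lambda>_. 1" T, folded W_def])
    fix f assume "f \<in> W"
    have "T (\<lambda>_. 1) = (\<lambda>_. 0)" by (simp add: T_def fun_eq_iff)
    then have "(\<Sum>x\<in>?I. 1 * T f x) = 0" using T_sym[of "\<lambda>_. 1" f] by simp
    then show "T f \<in> W" by (auto simp: W_def T_def)
  next
    fix f g t x
    show "T (\<lambda>x. f x + t * g x) x = T f x + t * T g x"
      by (simp add: T_def sum_distrib_left sum.distrib[symmetric] algebra_simps)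
  next
    fix i
    have "continuous_on UNIV (\<lambda>f::nat \<Rightarrow> real. f j)" for j by simp
    then show "continuous_on UNIV (\<lambda>f. T f i)"
      unfolding T_def by (cases "i \<in> ?I") (auto intro!: continuous_intros)
  next
    \<comment> \<open>A difference of two point masses: for \<open>n \<ge> 2\<close> there is a
      nonzero function of sum zero.\<close>
    define f where "f i = (if i = 1 then 1 else if i = 2 then - 1 else 0 :: real)" for i :: nat
    have "(\<Sum>x\<in>?I. f x) = (\<Sum>x\<in>{1, 2}. f x)"
      using \<open>n \<ge> 2\<close> by (intro sum.mono_neutral_right) (auto simp: f_def)
    then have "(\<Sum>x\<in>?I. f x) = 0" by (simp add: f_def)
    then have "f \<in> W" using \<open>n \<ge> 2\<close> by (auto simp: W_def f_def)
    moreover have "f 1 \<noteq> 0" by (simp add: f_def)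
    ultimately show "\<exists>f\<in>W. f \<noteq> (\<lambda>_. 0)" by (metis (full_types))
  qed (use T_sym in auto)
  show thesis
  proof (rule that[of l])
    define F where "F i = complex_of_real (f i)" for i
    have "(\<Sum>x\<in>?I. F x) = complex_of_real (\<Sum>x\<in>?I. f x)" by (simp add: F_def)
    also have "(\<Sum>x\<in>?I. f x) = 0" using lf(1) by (simp add: W_def)
    finally have "F \<in> orth_compl ?I {\<lambda>i. of_bool (i \<in> ?I)}"
      using lf(1) by (simp add: orth_compl_def fun_space_def W_def F_def)
    moreover have "F \<noteq> (\<lambda>_. 0)" using lf(2) by (auto simp: F_def fun_eq_iff)
    moreover have "graph_laplacian n a F = (\<lambda>x. of_real l * F x)"
    proof
      fix i
      show "graph_laplacian n a F i = of_real l * F i"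
      proof (cases "i \<in> ?I")
        case True
        have "graph_laplacian n a F i = complex_of_real (\<Sum>j\<in>?I - {i}. a i j * (f i - f j))"
          using True by (simp add: graph_laplacian_def F_def)
        also have "(\<Sum>j\<in>?I - {i}. a i j * (f i - f j)) = T f i"
          unfolding T_def using True by (simp only: if_True) (rule sum.mono_neutral_left, auto)
        also have "T f i = l * f i" by (rule fun_cong[OF lf(3)])
        also have "complex_of_real (l * f i) = of_real l * F i" by (simp add: F_def)
        finally show ?thesis .
      next
        case False
        then have "F i = 0" using lf(1) by (simp add: W_def F_def)
        then show ?thesis using False unfolding graph_laplacian_def by (simp del: atLeastAtMost_iff)
      qed
    qed
    ultimately show "lambda_rw n a \<le> ereal l"
      unfolding lambda_rw_def least_eigenvalue_def by (intro INF_lower) blast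
  next
    fix g assume g: "(\<Sum>y\<in>?I. g y) = (0::real)"
    define g' where "g' i = (if i \<in> ?I then g i else 0)" for i
    have "g' \<in> W" using g by (simp add: W_def g'_def)
    then have "l * (\<Sum>x\<in>?I. (g' x)^2) \<le> (\<Sum>x\<in>?I. g' x * T g' x)" by (rule lf(4))
    then have "2 * l * (\<Sum>x\<in>?I. (g' x)^2) \<le> rw_energy ?I a g'" unfolding energy by linarith
    then show "2 * l * (\<Sum>x\<in>?I. (g x)^2) \<le> rw_energy ?I a g"
      by (simp add: g'_def rw_energy_def)
  qed
qed

section \<open>Reduction to the fibres over the characters of the base group\<close>

locale weighted_wreath = finite_wreath +
  fixes a :: "nat \<Rightarrow> nat \<Rightarrow> real" and c :: "(nat \<Rightarrow> 'a) \<Rightarrow> real"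
  assumes n_ge_2: "n \<ge> 2"
    and a_sym: "\<And>i j. i \<in> {1..n} \<Longrightarrow> j \<in> {1..n} \<Longrightarrow> a j i = a i j"
    and a_nonneg: "\<And>i j. (i, j) \<in> ordered_pairs n \<Longrightarrow> a i j \<ge> 0"
    and c_sym: "\<And>x. x \<in> carrier B \<Longrightarrow> c x = c (inv\<^bsub>B\<^esub> x)"
begin

abbreviation "lap \<equiv> group_laplacian G (wreath_weight A n a c)"
abbreviation "Q \<equiv> Q_potential A n c"

lemma ordered_pairs_in: "(i, j) \<in> ordered_pairs n \<Longrightarrow> i \<in> {1..n} \<and> j \<in> {1..n}"
  by (auto simp: ordered_pairs_def)

lemma a_nonneg': "i \<in> {1..n} \<Longrightarrow> j \<in> {1..n} \<Longrightarrow> i \<noteq> j \<Longrightarrow> 0 \<le> a i j"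
  using a_nonneg[of i j] a_nonneg[of j i] a_sym[of i j]
  by (cases i j rule: linorder_cases) (auto simp: ordered_pairs_def)

lemma transpose_comp_Perms:
  "(i, j) \<in> ordered_pairs n \<Longrightarrow> p \<in> Perms
    \<Longrightarrow> transpose i j \<circ> p \<in> Perms \<and> transpose i j \<circ> (transpose i j \<circ> p) = p"
  using ordered_pairs_in transpose_Perms comp_Perms by (auto simp: comp_assoc[symmetric])

lemma perm_act_transpose:
  assumes "(i, j) \<in> ordered_pairs n" "\<pi> \<in> Perms"
  shows "perm_act n (transpose i j \<circ> \<pi>) y = perm_act n (transpose i j) (perm_act n \<pi> y)"
  using assms ordered_pairs_in transpose_Perms by (intro perm_act_comp) auto

lemma Q_complex:
  assumes z: "z \<in> Labels"
  shows "(\<Sum>y\<in>carrier B. of_real (c y) * (1 - pairing n z (inv\<^bsub>B\<^esub> y))) = of_real (Q z)"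
proof -
  interpret B: group B by (rule group_B)
  define S where "S = (\<Sum>y\<in>carrier B. of_real (c y) * pairing n z (inv\<^bsub>B\<^esub> y))"
  have "S = (\<Sum>y\<in>carrier B. of_real (c y) * pairing n z y)"
    unfolding S_def
    by (rule sum.reindex_bij_witness[where i = "\<lambda>y. inv\<^bsub>B\<^esub> y" and j = "\<lambda>y. inv\<^bsub>B\<^esub> y"])
      (simp_all add: B.inv_closed B.inv_inv c_sym[symmetric] del: product_group_simps)
  moreover have "S = cnj (\<Sum>y\<in>carrier B. of_real (c y) * pairing n z y)"
    unfolding S_def cnj_sum
    by (intro sum.cong refl) (simp add: pairing_inv[OF z] del: product_group_simps)
  ultimately have "S = cnj S" by simp
  then have "S = of_real (Re S)" by (simp add: complex_eq_iff)
  moreover have "Re S = (\<Sum>y\<in>carrier B. c y * Re (pairing n z y))"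
    unfolding \<open>S = (\<Sum>y\<in>carrier B. of_real (c y) * pairing n z y)\<close> by simp
  ultimately have "S = of_real (\<Sum>y\<in>carrier B. c y * Re (pairing n z y))" by simp
  then have "(\<Sum>y\<in>carrier B. of_real (c y)) - S
      = of_real (\<Sum>y\<in>carrier B. c y * (1 - Re (pairing n z y)))"
    by (simp add: right_diff_distrib sum_subtractf del: carrier_product_group)
  then show ?thesis
    unfolding S_def Q_potential_def
    by (simp add: right_diff_distrib sum_subtractf del: product_group_simps)
qed

text \<open>The interchange generator plus the potential pulled back along
  \<open>\<pi> \<mapsto> \<pi> y\<close>. It is generic in the scalars because eigenfunctions arrive
  complex, while the energy comparison works with a real or imaginary part.\<close>

definition fibre_op :: "(nat \<Rightarrow> 'a \<Rightarrow> complex) \<Rightarrow> ((nat \<Rightarrow> nat) \<Rightarrow> 'f::real_field) \<Rightarrow> (nat \<Rightarrow> nat) \<Rightarrow> 'f"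
    where
  "fibre_op y \<phi> \<pi> =
     (\<Sum>(i, j)\<in>ordered_pairs n. of_real (a i j) * (\<phi> \<pi> - \<phi> (transpose i j \<circ> \<pi>)))
       + of_real (Q (perm_act n \<pi> y)) * \<phi> \<pi>"

text \<open>The Laplacian on functions \<open>(g; \<pi>) \<mapsto> \<langle>\<pi> y, g\<rangle> \<phi>(\<pi>)\<close>.\<close>

lemma lap_separated:
  assumes y: "y \<in> Labels" and g: "(g, \<pi>) \<in> carrier G"
    and f: "\<And>g \<pi>. (g, \<pi>) \<in> carrier G \<Longrightarrow> f (g, \<pi>) = pairing n (perm_act n \<pi> y) g * \<phi> \<pi>"
  shows "lap f (g, \<pi>) = pairing n (perm_act n \<pi> y) g * fibre_op y \<phi> \<pi>"
proof -
  interpret B: group B by (rule group_B)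
  have gB: "g \<in> carrier B" and \<pi>: "\<pi> \<in> Perms"
    using g by (simp_all add: carrier_G del: carrier_product_group)
  define z where "z = perm_act n \<pi> y"
  have z: "z \<in> Labels" unfolding z_def using \<pi> y by (rule perm_act_PiE)
  \<comment> \<open>The swap acts on the labels and on \<open>g\<close> simultaneously, so the
    pairing is unchanged and factors out.\<close>
  have "f (g, \<pi>) - f (perm_act n (transpose i j) g, transpose i j \<circ> \<pi>)
      = pairing n z g * (\<phi> \<pi> - \<phi> (transpose i j \<circ> \<pi>))" if ij: "(i, j) \<in> ordered_pairs n" for i j
  proof -
    have t: "transpose i j \<in> Perms" using ordered_pairs_in[OF ij] by (intro transpose_Perms) auto
    have "(perm_act n (transpose i j) g, transpose i j \<circ> \<pi>) \<in> carrier G"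
      using perm_act_B[OF t gB] comp_Perms[OF t \<pi>] by
          (simp add: carrier_G del: carrier_product_group)
    then have "f (perm_act n (transpose i j) g, transpose i j \<circ> \<pi>)
        = pairing n (perm_act n (transpose i j) z) (perm_act n (transpose i j) g) * \<phi> (transpose i
            j \<circ> \<pi>)"
      unfolding z_def perm_act_transpose[OF ij \<pi>, symmetric] by (rule f)
    then show ?thesis
      using f[OF g] by (simp add: pairing_perm_act[OF t] right_diff_distrib z_def)
  qed
  then have "(\<Sum>(i, j)\<in>ordered_pairs n. of_real (a i j)
        * (f (g, \<pi>) - f (perm_act n (transpose i j) g, transpose i j \<circ> \<pi>)))
      = (\<Sum>(i, j)\<in>ordered_pairs n. pairing n z g * (of_real (a i j) * (\<phi> \<pi> - \<phi> (transpose i j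
          \<circ> \<pi>))))"
    by (intro sum.cong refl) (auto simp: mult.left_commute)
  moreover have "f (g, \<pi>) - f (inv\<^bsub>B\<^esub> x \<otimes>\<^bsub>B\<^esub> g, \<pi>)
      = pairing n z g * ((1 - pairing n z (inv\<^bsub>B\<^esub> x)) * \<phi> \<pi>)"
    if x: "x \<in> carrier B" for x
  proof -
    have ix: "inv\<^bsub>B\<^esub> x \<in> carrier B" using x by (rule B.inv_closed)
    have "(inv\<^bsub>B\<^esub> x \<otimes>\<^bsub>B\<^esub> g, \<pi>) \<in> carrier G"
      using B.m_closed[OF ix gB] \<pi> by (simp add: carrier_G del: product_group_simps)
    from f[OF this] f[OF g] show ?thesis
      unfolding z_def[symmetric] pairing_mult[OF z ix gB] by
          (simp add: algebra_simps del: inv_product_group)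
  qed
  then have "(\<Sum>x\<in>carrier B. of_real (c x) * (f (g, \<pi>) - f (inv\<^bsub>B\<^esub> x \<otimes>\<^bsub>B\<^esub> g, \<pi>)))
      = (\<Sum>x\<in>carrier B. pairing n z g * (of_real (c x) * (1 - pairing n z (inv\<^bsub>B\<^esub> x)) * \<phi> \<pi>))"
    by (intro sum.cong refl) (simp add: mult_ac del: product_group_simps)
  then have "(\<Sum>x\<in>carrier B. of_real (c x) * (f (g, \<pi>) - f (inv\<^bsub>B\<^esub> x \<otimes>\<^bsub>B\<^esub> g, \<pi>)))
      = pairing n z g * (of_real (Q z) * \<phi> \<pi>)"
    unfolding Q_complex[OF z, symmetric] sum_distrib_right sum_distrib_left .
  ultimately show ?thesis
    unfolding wreath_laplacian[OF g] fibre_op_def z_def[symmetric]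
    by (simp add: distrib_left sum_distrib_left case_prod_unfold)
qed

text \<open>The last condition encodes orthogonality to the fixed vectors. For nontrivial
  \<open>y\<close> the lift of \<open>\<phi>\<close> sums to zero over the base group on its own;
  for trivial \<open>y\<close> the sum of the lift is a multiple of the sum of
  \<open>\<phi>\<close>.\<close>

definition fibre_eigenvalue :: "real \<Rightarrow> bool" where
  "fibre_eigenvalue l \<longleftrightarrow> (\<exists>y\<in>Labels. \<exists>\<phi>::(nat \<Rightarrow> nat) \<Rightarrow> complex.
     (\<exists>\<pi>\<in>Perms. \<phi> \<pi> \<noteq> 0) \<and> (\<forall>\<pi>\<in>Perms. fibre_op y \<phi> \<pi> = of_real l * \<phi> \<pi>) \<and>
     ((\<exists>i\<in>{1..n}. y i \<noteq> trivial_character A) \<or> (\<Sum>\<pi>\<in>Perms. \<phi> \<pi>) = 0))"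

lemma psi_le_fibre_eigenvalue:
  assumes "fibre_eigenvalue l"
  shows "psi G (wreath_weight A n a c) \<le> ereal l"
proof -
  interpret B: group B by (rule group_B)
  from assms obtain y \<phi> \<pi>0 where y: "y \<in> Labels" and \<pi>0: "\<pi>0 \<in> Perms" "\<phi> \<pi>0 \<noteq> 0"
    and eig: "\<And>\<pi>. \<pi> \<in> Perms \<Longrightarrow> fibre_op y \<phi> \<pi> = complex_of_real l * \<phi> \<pi>"
    and orth: "(\<exists>i\<in>{1..n}. y i \<noteq> trivial_character A) \<or> (\<Sum>\<pi>\<in>Perms. \<phi> \<pi>) = 0"
    unfolding fibre_eigenvalue_def by blast
  define f where "f x = (if x \<in> carrier G then pairing n (perm_act n (snd x) y) (fst x) * \<phi> (snd
      x) else 0)" for x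
  have f: "f (g, \<pi>) = pairing n (perm_act n \<pi> y) g * \<phi> \<pi>" if "(g, \<pi>) \<in> carrier G" for g \<pi>
    using that by (simp add: f_def)
  have "(\<Sum>x\<in>carrier G. f x) = (\<Sum>g\<in>carrier B. \<Sum>\<pi>\<in>Perms. pairing n (perm_act n \<pi> y) g * \<phi> \<pi>)"
    unfolding sum.cartesian_product carrier_G[symmetric] by (intro sum.cong refl) (auto simp: f)
  also have "\<dots> = (\<Sum>\<pi>\<in>Perms. \<phi> \<pi> * (\<Sum>g\<in>carrier B. pairing n (perm_act n \<pi> y) g))"
    by (subst sum.swap) (simp only: sum_distrib_left mult.commute)
  also have "\<dots> = 0"
  proof (cases "\<exists>i\<in>{1..n}. y i \<noteq> trivial_character A")
    case False
    then have "pairing n (perm_act n \<pi> y) g = 1" if "\<pi> \<in> Perms" "g \<in> carrier B" for \<pi> g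
      using that perm_inv_in
      by (intro pairing_trivial) (auto simp: perm_act_apply simp del: atLeastAtMost_iff)
    moreover have "(\<Sum>\<pi>\<in>Perms. \<phi> \<pi>) = 0" using orth False by blast
    ultimately show ?thesis by (simp add: sum_distrib_right[symmetric] del: carrier_product_group)
  next
    case True
    then obtain i where i: "i \<in> {1..n}" "y i \<noteq> trivial_character A" by blast
    show ?thesis
    proof (intro sum.neutral ballI)
      fix \<pi> assume \<pi>: "\<pi> \<in> Perms"
      have "\<pi> i \<in> {1..n}" using perm_in[OF \<pi> i(1)] .
      moreover have "perm_act n \<pi> y (\<pi> i) \<noteq> trivial_character A"
        using \<open>\<pi> i \<in> {1..n}\<close> i(2) \<pi> by (simp add: perm_act_apply permutes_inverses del:
            atLeastAtMost_iff)
      ultimately have "(\<Sum>g\<in>carrier B. pairing n (perm_act n \<pi> y) g) = 0"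
        by (rule sum_pairing_eq_0[OF perm_act_PiE[OF \<pi> y]])
      then show "\<phi> \<pi> * (\<Sum>g\<in>carrier B. pairing n (perm_act n \<pi> y) g) = 0" by
          (simp only: mult_zero_right)
    qed
  qed
  finally have "f \<in> orth_compl (carrier G) (fixed_vectors G)"
    unfolding orth_compl_fixed_vectors[OF group_G] by (auto simp: fun_space_def f_def)
  moreover have "f \<noteq> (\<lambda>_. 0)"
  proof
    assume "f = (\<lambda>_. 0)"
    have c: "(\<one>\<^bsub>B\<^esub>, \<pi>0) \<in> carrier G"
      using \<pi>0 B.one_closed by (simp add: carrier_G del: product_group_simps)
    have "pairing n (perm_act n \<pi>0 y) \<one>\<^bsub>B\<^esub> * \<phi> \<pi>0 = 0"
      unfolding f[OF c, symmetric] \<open>f = (\<lambda>_. 0)\<close> ..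
    then show False
      using \<pi>0(2) pairing_one[OF perm_act_PiE[OF \<pi>0(1) y]] by (simp del: one_product_group)
  qed
  moreover have "lap f = (\<lambda>x. of_real l * f x)"
  proof
    fix x
    show "lap f x = of_real l * f x"
    proof (cases "x \<in> carrier G")
      case True
      obtain g \<pi> where x: "x = (g, \<pi>)" by (cases x)
      have \<pi>: "\<pi> \<in> Perms" using True by (simp add: x carrier_G)
      have "lap f (g, \<pi>) = pairing n (perm_act n \<pi> y) g * fibre_op y \<phi> \<pi>"
        by (rule lap_separated[OF y True[unfolded x] f])
      then show ?thesis
        unfolding x f[OF True[unfolded x]] eig[OF \<pi>] by (simp only: mult.left_commute)
    next
      case False
      then show ?thesis by (simp add: group_laplacian_def left_translate_def f_def)
    qed
  qed
  ultimately show ?thesis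
    unfolding psi_def least_eigenvalue_def by (intro INF_lower) blast
qed

lemma fibre_eigenvalue_of_psi:
  assumes f: "f \<in> orth_compl (carrier G) (fixed_vectors G)" "f \<noteq> (\<lambda>_. 0)"
    and eig: "lap f = (\<lambda>x. of_real l * f x)"
  shows "fibre_eigenvalue l"
proof -
  interpret B: group B by (rule group_B)
  interpret G: group G by (rule group_G)
  define R where "R y f x = (if x \<in> carrier G then f (x \<otimes>\<^bsub>G\<^esub> (y, id)) else 0)"
    for y and f :: "(nat \<Rightarrow> 'a) \<times> (nat \<Rightarrow> nat) \<Rightarrow> complex" and x
  define N where "N = {f \<in> fun_space (carrier G). (\<Sum>x\<in>carrier G. f x) = 0 \<and> lap f
      = (\<lambda>x. of_real l * f x)}"
  have base: "(y, id) \<in> carrier G" if "y \<in> carrier B" for y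
    using that id_Perms by (simp add: carrier_G del: carrier_product_group)
  have lt_R: "left_translate G h (R y f) = R y (left_translate G h f)"
    if "h \<in> carrier G" "y \<in> carrier B" for h y f
    using that base[OF that(2)]
    by (auto simp: left_translate_def R_def fun_eq_iff G.m_assoc G.inv_closed
        simp del: carrier_product_group)
  have lap_R: "lap (R y f) = R y (lap f)" if "y \<in> carrier B" for y f
  proof
    fix x
    show "lap (R y f) x = R y (lap f) x"
      using lt_R[OF _ that, of _ f]
      by (cases "x \<in> carrier G") (simp_all add: group_laplacian_def R_def left_translate_def)
  qed
  have lap_lin: "lap (\<lambda>x. s * f x + t * g x) = (\<lambda>x. s * lap f x + t * lap g x)" for s t f g
    unfolding group_laplacian_def left_translate_def sum_distrib_left sum.distrib[symmetric]
    by (intro ext sum.cong refl) (simp add: algebra_simps)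
  have "\<exists>v \<chi>. v \<in> N \<and> v \<noteq> (\<lambda>_. 0) \<and> \<chi> \<in> hom B complex_units \<and> (\<forall>h\<in>carrier B. R h v
      = (\<lambda>x. \<chi> h * v x))"
  proof (rule abelian_action_has_common_eigenvector[OF comm_group_B finite_B, of R N])
    show "R h (\<lambda>x. s * f x + t * g x) = (\<lambda>x. s * R h f x + t * R h g x)" for h f g s t
      by (auto simp: R_def)
    show "(\<lambda>x. s * f x + t * g x) \<in> N" if "f \<in> N" "g \<in> N" for f g s t
    proof -
      have "(\<Sum>x\<in>carrier G. s * f x + t * g x) = s * (\<Sum>x\<in>carrier G. f x) + t * (\<Sum>x\<in>carrier G. g x)"
        by (simp add: sum.distrib sum_distrib_left)
      then show ?thesis using that by (auto simp: N_def fun_space_def lap_lin algebra_simps)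
    qed
    show "R h f \<in> N" if h: "h \<in> carrier B" and "f \<in> N" for h f
    proof -
      have "(\<Sum>x\<in>carrier G. R h f x) = (\<Sum>x\<in>carrier G. f (x \<otimes>\<^bsub>G\<^esub> (h, id)))" by (simp add: R_def)
      also have "\<dots> = (\<Sum>x\<in>carrier G. f x)"
        by (rule sum.reindex_bij_witness[where i = "\<lambda>x. x \<otimes>\<^bsub>G\<^esub> inv\<^bsub>G\<^esub> (h, id)" and j
            = "\<lambda>x. x \<otimes>\<^bsub>G\<^esub> (h, id)"])
          (use base[OF h] in \<open>simp_all add: G.m_assoc G.l_inv G.r_inv\<close>)
      finally have "(\<Sum>x\<in>carrier G. R h f x) = 0" using \<open>f \<in> N\<close> by (simp add: N_def)
      moreover have "lap (R h f) = (\<lambda>x. of_real l * R h f x)"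
        using \<open>f \<in> N\<close> unfolding lap_R[OF h] by (auto simp: N_def R_def)
      ultimately show ?thesis by (auto simp: N_def fun_space_def R_def)
    qed
    show "R (g \<otimes>\<^bsub>B\<^esub> h) f = R g (R h f)" if gh: "g \<in> carrier B" "h \<in> carrier B" and "f \<in> N" for g h f
    proof
      fix x
      have "perm_act n id h = h" using gh(2) unfolding carrier_product_group by (rule perm_act_id)
      then have "(g, id) \<otimes>\<^bsub>G\<^esub> (h, id) = (g \<otimes>\<^bsub>B\<^esub> h, id)"
        unfolding mult_G by (simp del: mult_product_group)
      then show "R (g \<otimes>\<^bsub>B\<^esub> h) f x = R g (R h f) x"
        using base[OF gh(1)] base[OF gh(2)]
        by (simp add: R_def G.m_assoc del: mult_product_group)
    qed
    show "R \<one>\<^bsub>B\<^esub> f = f" if "f \<in> N" for f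
      using that by (auto simp: R_def N_def fun_space_def one_G[symmetric] fun_eq_iff simp del:
          one_product_group)
    show "\<exists>f\<in>N. f \<noteq> (\<lambda>_. 0)"
      using f eig unfolding orth_compl_fixed_vectors[OF group_G] N_def by blast
  qed blast
  then obtain v \<chi> where v: "v \<in> N" "v \<noteq> (\<lambda>_. 0)" and \<chi>: "\<chi> \<in> hom B complex_units"
    "\<And>h. h \<in> carrier B \<Longrightarrow> R h v = (\<lambda>x. \<chi> h * v x)" by blast
  obtain y where y: "y \<in> Labels" "\<And>g. g \<in> carrier B \<Longrightarrow> \<chi> g = pairing n y g"
    using hom_B_eq_pairing[OF \<chi>(1)] by blast
  define \<phi> where "\<phi> \<pi> = v (\<one>\<^bsub>B\<^esub>, \<pi>)" for \<pi>
  have v_eq: "v (g, \<pi>) = pairing n (perm_act n \<pi> y) g * \<phi> \<pi>" if "(g, \<pi>) \<in> carrier G" for g \<pi>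
  proof -
    have gB: "g \<in> carrier B" and \<pi>: "\<pi> \<in> Perms"
      using that by (simp_all add: carrier_G del: carrier_product_group)
    \<comment> \<open>Chosen so that \<open>(1; \<pi>)(h; 1) = (g; \<pi>)\<close>: the value of
      \<open>v\<close> at \<open>(g; \<pi>)\<close> is that of a right translate at
      \<open>(1; \<pi>)\<close>. The character then gives
      \<open>\<langle>y, h\<rangle> = \<langle>\<pi> y, g\<rangle>\<close>.\<close>
    define h where "h = perm_act n (inv' \<pi>) g"
    have hB: "h \<in> carrier B" unfolding h_def by (rule perm_act_B[OF inv_Perms[OF \<pi>] gB])
    have \<pi>h: "perm_act n \<pi> h = g" unfolding h_def using perm_act_inverse[OF \<pi>] gB by simp
    have c: "(\<one>\<^bsub>B\<^esub>, \<pi>) \<in> carrier G"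
      using \<pi> B.one_closed by (simp add: carrier_G del: product_group_simps)
    have "(\<one>\<^bsub>B\<^esub>, \<pi>) \<otimes>\<^bsub>G\<^esub> (h, id) = (g, \<pi>)"
      unfolding mult_G \<pi>h B.l_one[OF gB] by simp
    then have "v (g, \<pi>) = R h v (\<one>\<^bsub>B\<^esub>, \<pi>)" using c by (simp add: R_def del: one_product_group)
    also have "\<dots> = pairing n y h * \<phi> \<pi>" by (simp add: \<chi>(2)[OF hB] y(2)[OF hB] \<phi>_def del:
        one_product_group)
    also have "pairing n y h = pairing n (perm_act n \<pi> y) g"
      using pairing_perm_act[OF \<pi>, of y h] by (simp add: \<pi>h)
    finally show ?thesis .
  qed
  have "\<exists>\<pi>\<in>Perms. \<phi> \<pi> \<noteq> 0"
  proof -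
    obtain x where "v x \<noteq> 0" using v(2) unfolding fun_eq_iff by blast
    then have "x \<in> carrier G" using v(1) by (cases x) (auto simp: N_def fun_space_def)
    then show ?thesis using \<open>v x \<noteq> 0\<close> v_eq by (cases x) (auto simp: carrier_G)
  qed
  moreover have "fibre_op y \<phi> \<pi> = of_real l * \<phi> \<pi>" if \<pi>: "\<pi> \<in> Perms" for \<pi>
  proof -
    have c: "(\<one>\<^bsub>B\<^esub>, \<pi>) \<in> carrier G"
      using \<pi> B.one_closed by (simp add: carrier_G del: product_group_simps)
    have "lap v (\<one>\<^bsub>B\<^esub>, \<pi>) = pairing n (perm_act n \<pi> y) \<one>\<^bsub>B\<^esub> * fibre_op y \<phi> \<pi>"
      by (rule lap_separated[OF y(1) c v_eq])
    also have "pairing n (perm_act n \<pi> y) \<one>\<^bsub>B\<^esub> = 1"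
      by (rule pairing_one[OF perm_act_PiE[OF \<pi> y(1)]])
    finally have "lap v (\<one>\<^bsub>B\<^esub>, \<pi>) = fibre_op y \<phi> \<pi>" by (simp only: mult_1_left)
    moreover have "lap v (\<one>\<^bsub>B\<^esub>, \<pi>) = of_real l * v (\<one>\<^bsub>B\<^esub>, \<pi>)" using v(1) by (simp add: N_def)
    ultimately show ?thesis by (simp only: \<phi>_def)
  qed
  moreover have "(\<exists>i\<in>{1..n}. y i \<noteq> trivial_character A) \<or> (\<Sum>\<pi>\<in>Perms. \<phi> \<pi>) = 0"
  proof (cases "\<exists>i\<in>{1..n}. y i \<noteq> trivial_character A")
    case False
    then have 1: "pairing n (perm_act n \<pi> y) g = 1" if "\<pi> \<in> Perms" "g \<in> carrier B" for \<pi> g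
      using that perm_inv_in by (intro pairing_trivial)
          (auto simp: perm_act_apply simp del: atLeastAtMost_iff)
    have "0 = (\<Sum>x\<in>carrier G. v x)" using v(1) by (simp add: N_def)
    also have "\<dots> = (\<Sum>(g, \<pi>)\<in>carrier B \<times> Perms. \<phi> \<pi>)"
      unfolding carrier_G
    proof (intro sum.cong refl, clarify)
      fix g \<pi> assume *: "g \<in> carrier B" "\<pi> permutes {1..n}"
      then have "(g, \<pi>) \<in> carrier G" by (simp add: carrier_G del: carrier_product_group)
      then show "v (g, \<pi>) = \<phi> \<pi>" using v_eq 1 * by (simp del: carrier_product_group)
    qed
    also have "\<dots> = of_nat (card (carrier B)) * (\<Sum>\<pi>\<in>Perms. \<phi> \<pi>)"
      by (simp add: sum.cartesian_product[symmetric] del: carrier_product_group)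
    finally have "(\<Sum>\<pi>\<in>Perms. \<phi> \<pi>) = 0"
      using finite_B B.one_closed by (auto simp del: product_group_simps)
    then show ?thesis ..
  qed simp
  ultimately show ?thesis unfolding fibre_eigenvalue_def using y(1) by blast
qed

end

section \<open>Fibre eigenvalues compared with the random walk and the operators on
  labellings\<close>

context weighted_wreath
begin

lemma Q_trivial:
  assumes "\<And>i. i \<in> {1..n} \<Longrightarrow> y i = trivial_character A" "\<pi> \<in> Perms"
  shows "Q (perm_act n \<pi> y) = 0"
  unfolding Q_potential_def
proof (intro sum.neutral ballI)
  fix x assume "x \<in> carrier B"
  then have "pairing n (perm_act n \<pi> y) x = 1"
    using assms(1) perm_inv_in[OF assms(2)]
    by (intro pairing_trivial) (auto simp: perm_act_apply simp del: atLeastAtMost_iff)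
  then show "c x * (1 - Re (pairing n (perm_act n \<pi> y) x)) = 0" by simp
qed

text \<open>Under the interchange process each single particle performs the random walk, so
  \<open>g\<close> evaluated at the position \<open>\<pi> 1\<close> is again an eigenfunction.
  Trivial labels make the potential vanish.\<close>

lemma fibre_eigenvalue_of_rw:
  assumes g: "g \<in> orth_compl {1..n} {\<lambda>i. of_bool (i \<in> {1..n})}" "g \<noteq> (\<lambda>_. 0)"
    and eig: "graph_laplacian n a g = (\<lambda>x. of_real l * g x)"
  shows "fibre_eigenvalue l"
proof -
  let ?I = "{1..n}"
  have one: "1 \<in> ?I" using n_ge_2 by simp
  have g0: "\<And>i. i \<notin> ?I \<Longrightarrow> g i = 0" and g_sum: "(\<Sum>i\<in>?I. g i) = 0"
    using g(1) by (simp_all add: orth_compl_def fun_space_def)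
  define y where "y = (\<lambda>i\<in>?I. trivial_character A)"
  define \<phi> where "\<phi> \<pi> = g (\<pi> 1)" for \<pi> :: "nat \<Rightarrow> nat"
  have "y \<in> Labels" using trivial_character_in by (auto simp: y_def)
  moreover have "\<exists>\<pi>\<in>Perms. \<phi> \<pi> \<noteq> 0"
  proof -
    obtain j where "g j \<noteq> 0" using g(2) by auto
    then have "j \<in> ?I" using g0 by blast
    then have "transpose 1 j \<in> Perms" using one by (intro transpose_Perms)
    then show ?thesis using \<open>g j \<noteq> 0\<close> by (intro bexI[of _ "transpose 1 j"]) (simp_all add: \<phi>_def)
  qed
  moreover have "fibre_op y \<phi> \<pi> = of_real l * \<phi> \<pi>" if \<pi>: "\<pi> \<in> Perms" for \<pi>
  proof -
    have "Q (perm_act n \<pi> y) = 0" using \<pi> by (intro Q_trivial) (simp_all add: y_def)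
    moreover have "(\<Sum>(i, j)\<in>ordered_pairs n. of_real (a i j) * (g (\<pi> 1) - g (transpose i j (\<pi> 1))))
        = graph_laplacian n a g (\<pi> 1)"
    proof -
      have "(\<Sum>(i, j)\<in>ordered_pairs n. of_real (a i j) * (g (\<pi> 1) - g (transpose i j (\<pi> 1))))
          = (\<Sum>j\<in>?I - {\<pi> 1}. of_real (a (\<pi> 1) j) * (g (\<pi> 1) - g j))"
        by (rule sum_transpose_diff) (use a_sym perm_in[OF \<pi> one] in auto)
      then show ?thesis using perm_in[OF \<pi> one] by (simp add: graph_laplacian_def)
    qed
    ultimately show ?thesis by (simp add: fibre_op_def \<phi>_def eig)
  qed
  moreover have "(\<Sum>\<pi>\<in>Perms. \<phi> \<pi>) = 0"
  proof -
    \<comment> \<open>Relabelling particles shows that the sum is the same whichever particle is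
      observed. Added over all particles, each permutation contributes the full sum of
      \<open>g\<close>, which is 0.\<close>
    have label: "(\<Sum>\<pi>\<in>Perms. \<phi> \<pi>) = (\<Sum>\<pi>\<in>Perms. g (\<pi> k))" if "k \<in> ?I" for k
      using sum_permutations_compose_right[OF permutes_swap_id[OF one that], of \<phi>] by
          (simp add: \<phi>_def)
    have "of_nat n * (\<Sum>\<pi>\<in>Perms. \<phi> \<pi>) = (\<Sum>k\<in>?I. \<Sum>\<pi>\<in>Perms. \<phi> \<pi>)" by simp
    also have "\<dots> = (\<Sum>k\<in>?I. \<Sum>\<pi>\<in>Perms. g (\<pi> k))" by (rule sum.cong[OF refl label])
    also have "\<dots> = (\<Sum>\<pi>\<in>Perms. \<Sum>k\<in>?I. g (\<pi> k))" by (rule sum.swap)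
    also have "\<dots> = (\<Sum>\<pi>\<in>Perms. 0)"
    proof (rule sum.cong[OF refl])
      fix \<pi> assume "\<pi> \<in> Perms"
      then show "(\<Sum>k\<in>?I. g (\<pi> k)) = 0"
        using sum.permute[of \<pi> ?I g] g_sum by (simp add: o_def)
    qed
    finally show ?thesis using n_ge_2 by simp
  qed
  ultimately show ?thesis unfolding fibre_eigenvalue_def by blast
qed

lemma fibre_eigenvalue_of_L_op:
  assumes \<kappa>: "\<kappa> (trivial_character A) \<noteq> n"
    and F: "F \<in> fun_space (Omega A n \<kappa>)" "F \<noteq> (\<lambda>_. 0)"
    and eig: "L_op A n a c \<kappa> F = (\<lambda>x. of_real l * F x)"
  shows "fibre_eigenvalue l"
proof -
  \<comment> \<open>The base point is taken where \<open>F\<close> does not vanish, so that the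
    pullback along \<open>\<pi> \<mapsto> \<pi> z\<close> is nonzero at the identity.\<close>
  obtain z where "F z \<noteq> 0" using F(2) by auto
  then have z: "z \<in> Omega A n \<kappa>" using F(1) by (auto simp: fun_space_def)
  define \<phi> where "\<phi> \<pi> = F (perm_act n \<pi> z)" for \<pi>
  have "z \<in> Labels" using z by (rule Omega_Labels)
  moreover have "\<phi> id \<noteq> 0" using \<open>F z \<noteq> 0\<close> perm_act_id[OF \<open>z \<in> Labels\<close>] by (simp add: \<phi>_def)
  moreover have "fibre_op z \<phi> \<pi> = of_real l * \<phi> \<pi>" if \<pi>: "\<pi> \<in> Perms" for \<pi>
  proof -
    have "(\<Sum>(i, j)\<in>ordered_pairs n. of_real (a i j) * (\<phi> \<pi> - \<phi> (transpose i j \<circ> \<pi>)))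
        = (\<Sum>(i, j)\<in>ordered_pairs n. of_real (a i j)
            * (F (perm_act n \<pi> z) - F (perm_act n (transpose i j) (perm_act n \<pi> z))))"
      by (intro sum.cong refl) (auto simp: \<phi>_def perm_act_transpose[OF _ \<pi>])
    then have "fibre_op z \<phi> \<pi> = L_op A n a c \<kappa> F (perm_act n \<pi> z)"
      using perm_act_Omega[OF \<pi> z] by (simp add: fibre_op_def L_op_def \<phi>_def)
    then show ?thesis by (simp add: eig \<phi>_def)
  qed
  moreover have "\<exists>i\<in>{1..n}. z i \<noteq> trivial_character A"
    using Omega_trivial_iff[OF z] \<kappa> by blast
  ultimately show ?thesis unfolding fibre_eigenvalue_def using id_Perms by blast
qed

text \<open>The variational bound for \<open>lambda_min\<close>. The constraint vector is 0 here, so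
  that \<open>W\<close> consists of all functions on the labellings.\<close>

lemma L_op_minimal_eigenvalue:
  assumes "Omega A n \<kappa> \<noteq> {}"
  obtains l where "lambda_min A n a c \<kappa> \<le> ereal l"
    "\<And>F :: _ \<Rightarrow> real. (\<And>z. z \<notin> Omega A n \<kappa> \<Longrightarrow> F z = 0) \<Longrightarrow>
      l * (\<Sum>z\<in>Omega A n \<kappa>. (F z)^2)
        \<le> (\<Sum>(i, j)\<in>ordered_pairs n. a i j * ((\<Sum>z\<in>Omega A n \<kappa>. (F z - F (perm_act n (transpose i j)
            z))^2) / 2))
          + (\<Sum>z\<in>Omega A n \<kappa>. Q z * (F z)^2)"
proof -
  let ?O = "Omega A n \<kappa>"
  let ?t = "\<lambda>i j z. perm_act n (transpose i j) z"
  have t: "?t i j z \<in> ?O \<and> ?t i j (?t i j z) = z" if "(i, j) \<in> ordered_pairs n" "z \<in> ?O" for i j z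
  proof -
    have p: "transpose i j \<in> Perms" using ordered_pairs_in[OF that(1)]
        by (intro transpose_Perms) auto
    have "?t i j (?t i j z) = perm_act n (transpose i j \<circ> transpose i j) z"
      using p by (simp only: perm_act_comp)
    then show ?thesis using perm_act_Omega[OF p that(2)] perm_act_id[OF Omega_Labels[OF that(2)]]
        by simp
  qed
  define T where "T F z = (if z \<in> ?O then
      (\<Sum>(i, j)\<in>ordered_pairs n. a i j * (F z - F (?t i j z))) + Q z * F z else 0)"
    for F :: "(nat \<Rightarrow> 'a \<Rightarrow> complex) \<Rightarrow> real" and z
  define W where "W = {f::(nat \<Rightarrow> 'a \<Rightarrow> complex) \<Rightarrow> real. (\<forall>x. x \<notin> ?O \<longrightarrow> f x = 0) \<and> (\<Sum>x\<in>?O. 0 * f x)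
      = 0}"
  have T_eq: "(\<Sum>z\<in>?O. f z * T g z)
      = (\<Sum>z\<in>?O. f z * ((\<Sum>(i, j)\<in>ordered_pairs n. a i j * (g z - g (?t i j z))) + Q z * g z))"
          for f g
    by (intro sum.cong refl) (simp add: T_def)
  obtain l f where lf: "f \<in> W" "f \<noteq> (\<lambda>_. 0)" "T f = (\<lambda>x. l * f x)"
    "\<And>g. g \<in> W \<Longrightarrow> (\<Sum>x\<in>?O. g x * T g x) \<ge> l * (\<Sum>x\<in>?O. (g x)^2)"
  proof (rule symmetric_operator_has_minimal_eigenvector[of ?O "\<lambda>_. 0" T, folded W_def])
    show "finite ?O" by (rule finite_Omega)
    show "T f \<in> W" for f by (simp add: W_def T_def)
    show "T (\<lambda>x. f x + t * g x) x = T f x + t * T g x" for f g t x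
    proof (cases "x \<in> ?O")
      case True
      have "(\<Sum>(i, j)\<in>ordered_pairs n. a i j * (f x + t * g x - (f (?t i j x) + t * g (?t i j x))))
          = (\<Sum>(i, j)\<in>ordered_pairs n. a i j * (f x - f (?t i j x)))
              + t * (\<Sum>(i, j)\<in>ordered_pairs n. a i j * (g x - g (?t i j x)))"
        unfolding sum_distrib_left sum.distrib[symmetric]
        by (intro sum.cong refl) (auto simp: algebra_simps)
      then show ?thesis using True by (simp add: T_def algebra_simps)
    qed (simp add: T_def)
    show "(\<Sum>x\<in>?O. f x * T g x) = (\<Sum>x\<in>?O. T f x * g x)" for f g
    proof -
      have "(\<Sum>x\<in>?O. T f x * g x) = (\<Sum>z\<in>?O. ((\<Sum>(i, j)\<in>ordered_pairs n. a i j * (f z - f (?t i j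
          z))) + Q z * f z) * g z)"
        by (intro sum.cong refl) (simp add: T_def)
      then show ?thesis unfolding T_eq using pair_form_symmetric[where t = ?t and P = ?O, OF t]
          by simp
    qed
    have cc: "continuous_on UNIV (\<lambda>f::(nat \<Rightarrow> 'a \<Rightarrow> complex) \<Rightarrow> real. f q)" for q by simp
    show "continuous_on UNIV (\<lambda>f. T f z)" for z
    proof (cases "z \<in> ?O")
      case True
      then show ?thesis unfolding T_def case_prod_unfold if_P[OF True]
        by (intro continuous_intros cc)
    qed (simp add: T_def)
    obtain z where "z \<in> ?O" using assms by blast
    then have "(\<lambda>x. of_bool (x = z)) \<in> W" by (auto simp: W_def)
    moreover have "(\<lambda>x. of_bool (x = z)) \<noteq> (\<lambda>_. 0::real)" by (auto simp: fun_eq_iff)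
    ultimately show "\<exists>f\<in>W. f \<noteq> (\<lambda>_. 0)" by blast
  qed blast
  show thesis
  proof (rule that[of l])
    define F where "F = (\<lambda>z. complex_of_real (f z))"
    have "F \<in> fun_space ?O" using lf(1) by (simp add: fun_space_def W_def F_def)
    moreover have "F \<noteq> (\<lambda>_. 0)" using lf(2) by (auto simp: F_def fun_eq_iff)
    moreover have "L_op A n a c \<kappa> F = (\<lambda>x. of_real l * F x)"
    proof
      fix z
      have "L_op A n a c \<kappa> F z = complex_of_real (T f z)"
        by (simp add: L_op_def T_def F_def case_prod_unfold)
      also have "T f z = l * f z" by (rule fun_cong[OF lf(3)])
      finally show "L_op A n a c \<kappa> F z = of_real l * F z" by (simp add: F_def)
    qed
    ultimately show "lambda_min A n a c \<kappa> \<le> ereal l"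
      unfolding lambda_min_def least_eigenvalue_def by (intro INF_lower) blast
  next
    fix F :: "_ \<Rightarrow> real" assume "\<And>z. z \<notin> ?O \<Longrightarrow> F z = 0"
    then have "F \<in> W" by (simp add: W_def)
    have "(\<Sum>z\<in>?O. F z * T F z) = (\<Sum>(i, j)\<in>ordered_pairs n. a i j * ((\<Sum>z\<in>?O. (F z - F (?t i j
        z))^2) / 2))
        + (\<Sum>z\<in>?O. Q z * (F z)^2)"
      unfolding T_eq by (rule pair_form_energy[where t = ?t]) (rule t)
    with lf(4)[OF \<open>F \<in> W\<close>] show "l * (\<Sum>z\<in>?O. (F z)^2)
        \<le> (\<Sum>(i, j)\<in>ordered_pairs n. a i j * ((\<Sum>z\<in>?O. (F z - F (?t i j z))^2) / 2))
            + (\<Sum>z\<in>?O. Q z * (F z)^2)"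
      by (simp only:)
  qed
qed

lemma fibre_eigenvalue_ge:
  assumes "fibre_eigenvalue l"
  shows "lambda_rw n a \<le> ereal l \<or>
    (\<exists>\<kappa>\<in>multiplicity_vectors A n. \<kappa> (trivial_character A) \<noteq> n \<and> lambda_min A n a c \<kappa> \<le> ereal l)"
proof -
  let ?I = "{1..n}"
  from assms obtain y \<phi> \<pi>0 where y: "y \<in> Labels" and \<pi>0: "\<pi>0 \<in> Perms" "\<phi> \<pi>0 \<noteq> 0"
    and eig: "\<And>\<pi>. \<pi> \<in> Perms \<Longrightarrow> fibre_op y \<phi> \<pi> = complex_of_real l * \<phi> \<pi>"
    and orth: "(\<exists>i\<in>?I. y i \<noteq> trivial_character A) \<or> (\<Sum>\<pi>\<in>Perms. \<phi> \<pi>) = 0"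
    unfolding fibre_eigenvalue_def by blast
  \<comment> \<open>The operator has real coefficients, so the real and imaginary parts satisfy the
    same equation, and one of them is nonzero at \<open>\<pi>0\<close>.\<close>
  have "\<exists>\<psi> :: (nat \<Rightarrow> nat) \<Rightarrow> real. \<psi> \<pi>0 \<noteq> 0 \<and> (\<forall>\<pi>\<in>Perms. fibre_op y \<psi> \<pi> = l * \<psi> \<pi>)
      \<and> ((\<exists>i\<in>?I. y i \<noteq> trivial_character A) \<or> (\<Sum>\<pi>\<in>Perms. \<psi> \<pi>) = 0)"
  proof (cases "Re (\<phi> \<pi>0) \<noteq> 0")
    case True
    have "fibre_op y (\<lambda>\<pi>. Re (\<phi> \<pi>)) \<pi> = Re (fibre_op y \<phi> \<pi>)" for \<pi>
      by (simp add: fibre_op_def case_prod_unfold)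
    moreover have "(\<Sum>\<pi>\<in>Perms. Re (\<phi> \<pi>)) = Re (\<Sum>\<pi>\<in>Perms. \<phi> \<pi>)" by simp
    ultimately show ?thesis using True eig orth
      by (intro exI[of _ "\<lambda>\<pi>. Re (\<phi> \<pi>)"]) (auto simp del: Re_sum)
  next
    case False
    have "fibre_op y (\<lambda>\<pi>. Im (\<phi> \<pi>)) \<pi> = Im (fibre_op y \<phi> \<pi>)" for \<pi>
      by (simp add: fibre_op_def case_prod_unfold)
    moreover have "(\<Sum>\<pi>\<in>Perms. Im (\<phi> \<pi>)) = Im (\<Sum>\<pi>\<in>Perms. \<phi> \<pi>)" by simp
    moreover have "Im (\<phi> \<pi>0) \<noteq> 0" using False \<pi>0(2) by (simp add: complex_eq_iff)
    ultimately show ?thesis using eig orth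
      by (intro exI[of _ "\<lambda>\<pi>. Im (\<phi> \<pi>)"]) (auto simp del: Im_sum)
  qed
  then obtain \<psi> :: "(nat \<Rightarrow> nat) \<Rightarrow> real" where \<psi>: "\<psi> \<pi>0 \<noteq> 0"
    and \<psi>_eig: "\<And>\<pi>. \<pi> \<in> Perms \<Longrightarrow> fibre_op y \<psi> \<pi> = l * \<psi> \<pi>"
    and \<psi>_orth: "(\<exists>i\<in>?I. y i \<noteq> trivial_character A) \<or> (\<Sum>\<pi>\<in>Perms. \<psi> \<pi>) = 0" by blast
  define S where "S = (\<Sum>\<pi>\<in>Perms. (\<psi> \<pi>)^2)"
  have "S > 0"
    unfolding S_def using finite_Perms \<pi>0(1) \<psi> by (intro sum_pos2[of _ \<pi>0]) auto
  have energy: "l * S = (\<Sum>(i, j)\<in>ordered_pairs n. a i j * (swap_energy ?I \<psi> i j / 2))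
      + (\<Sum>\<pi>\<in>Perms. Q (perm_act n \<pi> y) * (\<psi> \<pi>)^2)"
  proof -
    have "l * S = (\<Sum>\<pi>\<in>Perms. \<psi> \<pi> * fibre_op y \<psi> \<pi>)"
      unfolding S_def sum_distrib_left by (intro sum.cong refl) (simp add: \<psi>_eig power2_eq_square)
    also have "\<dots> = (\<Sum>\<pi>\<in>Perms. \<psi> \<pi> * ((\<Sum>(i, j)\<in>ordered_pairs n. a i j * (\<psi> \<pi> - \<psi> (transpose i j
        \<circ> \<pi>)))
        + Q (perm_act n \<pi> y) * \<psi> \<pi>))"
      by (simp add: fibre_op_def)
    also have "\<dots> = (\<Sum>(i, j)\<in>ordered_pairs n. a i j * ((\<Sum>\<pi>\<in>Perms. (\<psi> \<pi> - \<psi> (transpose i j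
        \<circ> \<pi>))^2) / 2))
        + (\<Sum>\<pi>\<in>Perms. Q (perm_act n \<pi> y) * (\<psi> \<pi>)^2)"
      by (rule pair_form_energy[where t = "\<lambda>i j p. transpose i j \<circ> p", OF transpose_comp_Perms])
    finally show ?thesis unfolding swap_energy_def .
  qed
  show ?thesis
  proof (cases "\<exists>i\<in>?I. y i \<noteq> trivial_character A")
    case False
    then have "(\<Sum>\<pi>\<in>Perms. \<psi> \<pi>) = 0" using \<psi>_orth by blast
    obtain l0 where l0: "lambda_rw n a \<le> ereal l0"
      "\<And>g. (\<Sum>y\<in>?I. g y) = 0 \<Longrightarrow> 2 * l0 * (\<Sum>y\<in>?I. (g y)^2) \<le> rw_energy ?I a g"
      using rw_minimal_eigenvalue[where a = a, OF n_ge_2 a_sym] by blast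
    \<comment> \<open>The gap theorem is applied with \<open>\<mu> = 2 * l0\<close>, matching the
      normalisation of \<open>rw_energy\<close>.\<close>
    have "2 * (2 * l0) * S \<le> ip_energy ?I a \<psi>"
      unfolding S_def
      by (rule aldous_spectral_gap)
        (use a_sym a_nonneg' l0(2) \<open>(\<Sum>\<pi>\<in>Perms. \<psi> \<pi>) = 0\<close> in auto)
    \<comment> \<open>One factor 2 comes from ordered pairs, the other from the halved swap
      energies.\<close>
    also have "ip_energy ?I a \<psi> = 4 * (\<Sum>(i, j)\<in>ordered_pairs n. a i j * (swap_energy ?I \<psi> i j / 2))"
    proof -
      have "(\<Sum>(i, j)\<in>ordered_pairs n. a i j * (swap_energy ?I \<psi> i j / 2))
          = (\<Sum>i\<in>?I. \<Sum>j\<in>?I. a i j * (swap_energy ?I \<psi> i j / 2)) / 2"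
        by (rule sum_ordered_pairs) (auto simp: a_sym swap_energy_commute)
      also have "\<dots> = ip_energy ?I a \<psi> / 4"
        by (simp add: ip_energy_def sum_divide_distrib)
      finally show ?thesis by simp
    qed
    also have "(\<Sum>(i, j)\<in>ordered_pairs n. a i j * (swap_energy ?I \<psi> i j / 2)) = l * S"
    proof -
      have "Q (perm_act n \<pi> y) = 0" if "\<pi> \<in> Perms" for \<pi> using that False by (intro Q_trivial) auto
      then show ?thesis unfolding energy by simp
    qed
    finally have "l0 * S \<le> l * S" by simp
    then have "l0 \<le> l" using \<open>S > 0\<close> by simp
    then show ?thesis using l0(1) by (meson ereal_less_eq(3) order_trans)
  next
    case True
    obtain \<kappa> where \<kappa>: "\<kappa> \<in> multiplicity_vectors A n" "y \<in> Omega A n \<kappa>"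
      using ex_multiplicity_vector[OF y] by blast
    let ?O = "Omega A n \<kappa>"
    obtain l0 where l0: "lambda_min A n a c \<kappa> \<le> ereal l0"
      "\<And>F :: _ \<Rightarrow> real. (\<And>z. z \<notin> ?O \<Longrightarrow> F z = 0) \<Longrightarrow>
        l0 * (\<Sum>z\<in>?O. (F z)^2)
          \<le> (\<Sum>(i, j)\<in>ordered_pairs n. a i j * ((\<Sum>z\<in>?O. (F z - F (perm_act n (transpose i j) z))^2)
              / 2))
            + (\<Sum>z\<in>?O. Q z * (F z)^2)"
      using L_op_minimal_eigenvalue[of \<kappa>] \<kappa>(2) by blast
    \<comment> \<open>The nonempty fibres are the left cosets of the stabiliser of \<open>y\<close>;
      left multiplication by a swap permutes them as the swap permutes labellings.\<close>
    define Fib where "Fib z = {\<pi> \<in> Perms. perm_act n \<pi> y = z}" for z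
    define F where "F z = L2_set \<psi> (Fib z)" for z
    have F_sq: "(F z)^2 = (\<Sum>\<pi>\<in>Fib z. (\<psi> \<pi>)^2)" for z
      by (simp add: F_def L2_set_def sum_nonneg)
    have group: "(\<Sum>z\<in>?O. \<Sum>\<pi>\<in>Fib z. h \<pi>) = (\<Sum>\<pi>\<in>Perms. h \<pi>)" for h :: "_ \<Rightarrow> real"
      unfolding Fib_def
      by (rule sum.group[OF finite_Perms finite_Omega]) (use perm_act_Omega[OF _ \<kappa>(2)] in blast)
    have "F z = 0" if "z \<notin> ?O" for z
    proof -
      have "Fib z = {}" using that perm_act_Omega[OF _ \<kappa>(2)] unfolding Fib_def by blast
      then show ?thesis by (simp add: F_def)
    qed
    from l0(2)[OF this] have "l0 * (\<Sum>z\<in>?O. (F z)^2)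
        \<le> (\<Sum>(i, j)\<in>ordered_pairs n. a i j * ((\<Sum>z\<in>?O. (F z - F (perm_act n (transpose i j) z))^2) /
            2))
          + (\<Sum>z\<in>?O. Q z * (F z)^2)" .
    also have "(\<Sum>z\<in>?O. (F z)^2) = S" unfolding F_sq group S_def ..
    \<comment> \<open>The potential depends on \<open>\<pi>\<close> only through
      \<open>\<pi> y\<close>, hence is constant on each fibre.\<close>
    also have "(\<Sum>z\<in>?O. Q z * (F z)^2) = (\<Sum>\<pi>\<in>Perms. Q (perm_act n \<pi> y) * (\<psi> \<pi>)^2)"
      unfolding F_sq sum_distrib_left group[symmetric]
      by (intro sum.cong refl) (simp add: Fib_def)
    also have "(\<Sum>(i, j)\<in>ordered_pairs n. a i j * ((\<Sum>z\<in>?O. (F z - F (perm_act n (transpose i j)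
        z))^2) / 2))
        \<le> (\<Sum>(i, j)\<in>ordered_pairs n. a i j * (swap_energy ?I \<psi> i j / 2))"
    proof (intro sum_mono, clarify, intro mult_left_mono divide_right_mono a_nonneg)
      fix i j assume ij: "(i, j) \<in> ordered_pairs n"
      have t: "transpose i j \<in> Perms" using ordered_pairs_in[OF ij] by (intro transpose_Perms) auto
      \<comment> \<open>The swap maps the fibre over \<open>z\<close> bijectively onto the fibre
        over the swapped labelling. Both norms can therefore be taken over \<open>Fib z\<close>,
        where the reverse triangle inequality compares them.\<close>
      have "F (perm_act n (transpose i j) z) = L2_set (\<lambda>\<pi>. \<psi> (transpose i j \<circ> \<pi>)) (Fib z)"
          if z: "z \<in> ?O" for z
      proof -
        have inv: "perm_act n (transpose i j) (perm_act n (transpose i j) z) = z"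
          using perm_act_comp[OF t t, of z] perm_act_id[OF Omega_Labels[OF z]] by simp
        have fib: "transpose i j \<circ> \<pi> \<in> Fib z" if "\<pi> \<in> Fib (perm_act n (transpose i j) z)" for \<pi>
          using that inv transpose_comp_Perms[OF ij, of \<pi>] perm_act_transpose[OF ij, of \<pi> y]
          by (simp add: Fib_def)
        have fib': "transpose i j \<circ> \<pi> \<in> Fib (perm_act n (transpose i j) z)" if "\<pi> \<in> Fib z" for \<pi>
          using that transpose_comp_Perms[OF ij, of \<pi>] perm_act_transpose[OF ij, of \<pi> y]
          by (simp add: Fib_def)
        have invol: "transpose i j \<circ> (transpose i j \<circ> \<pi>) = \<pi>" for \<pi> :: "nat \<Rightarrow> nat"
          by (simp add: comp_assoc[symmetric])
        have "(\<Sum>\<pi>\<in>Fib (perm_act n (transpose i j) z). (\<psi> \<pi>)^2)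
            = (\<Sum>\<pi>\<in>Fib z. (\<psi> (transpose i j \<circ> \<pi>))^2)"
          by (rule sum.reindex_bij_witness[where i = "\<lambda>\<pi>. transpose i j \<circ> \<pi>" and j
              = "\<lambda>\<pi>. transpose i j \<circ> \<pi>"])
            (use fib fib' invol in auto)
        then show ?thesis by (simp add: F_def L2_set_def)
      qed
      then have "(\<Sum>z\<in>?O. (F z - F (perm_act n (transpose i j) z))^2)
          \<le> (\<Sum>z\<in>?O. \<Sum>\<pi>\<in>Fib z. (\<psi> \<pi> - \<psi> (transpose i j \<circ> \<pi>))^2)"
        by (intro sum_mono) (simp add: F_def L2_set_diff_square_le)
      then show "(\<Sum>z\<in>?O. (F z - F (perm_act n (transpose i j) z))^2) \<le> swap_energy ?I \<psi> i j"
        unfolding group swap_energy_def .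
    qed simp_all
    finally have "l0 * S \<le> l * S" unfolding energy by simp
    then have "l0 \<le> l" using \<open>S > 0\<close> by simp
    then have "lambda_min A n a c \<kappa> \<le> ereal l" using l0(1) by (meson ereal_less_eq(3) order_trans)
    moreover have "\<kappa> (trivial_character A) \<noteq> n" using True Omega_trivial_iff[OF \<kappa>(2)] by blast
    ultimately show ?thesis using \<kappa>(1) by blast
  qed
qed

text \<open>Each quantity is an infimum over a set of eigenvalues, so both inequalities are proved
  for one eigenvalue at a time, with \<open>fibre_eigenvalue\<close> as the common middle
  term.\<close>

lemma psi_wreath:
  "psi G (wreath_weight A n a c) = min (lambda_rw n a)
     (INF \<kappa> \<in> {\<kappa> \<in> multiplicity_vectors A n. \<not> V_trivial A n \<kappa>}. lambda_min A n a c \<kappa>)"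
    (is "_ = min _ ?M")
proof (rule antisym)
  have "psi G (wreath_weight A n a c) \<le> lambda_rw n a"
    unfolding lambda_rw_def least_eigenvalue_def
    by (rule INF_greatest) (auto intro!: psi_le_fibre_eigenvalue fibre_eigenvalue_of_rw)
  moreover have "psi G (wreath_weight A n a c) \<le> ?M"
  proof (rule INF_greatest)
    fix \<kappa> assume "\<kappa> \<in> {\<kappa> \<in> multiplicity_vectors A n. \<not> V_trivial A n \<kappa>}"
    then have "\<kappa> (trivial_character A) \<noteq> n" using V_trivial_iff by blast
    then show "psi G (wreath_weight A n a c) \<le> lambda_min A n a c \<kappa>"
      unfolding lambda_min_def least_eigenvalue_def
      by (intro INF_greatest) (auto intro!: psi_le_fibre_eigenvalue fibre_eigenvalue_of_L_op)
  qed
  ultimately show "psi G (wreath_weight A n a c) \<le> min (lambda_rw n a) ?M" by simp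
next
  show "min (lambda_rw n a) ?M \<le> psi G (wreath_weight A n a c)"
    unfolding psi_def least_eigenvalue_def[of "orth_compl (carrier G) (fixed_vectors G)"]
  proof (rule INF_greatest, clarify)
    fix l f assume "f \<in> orth_compl (carrier G) (fixed_vectors G)" "f \<noteq> (\<lambda>_. 0)" "lap f
        = (\<lambda>x. of_real l * f x)"
    then have "fibre_eigenvalue l" by (rule fibre_eigenvalue_of_psi)
    from fibre_eigenvalue_ge[OF this] show "min (lambda_rw n a) ?M \<le> ereal l"
    proof
      assume "lambda_rw n a \<le> ereal l"
      then show ?thesis by (rule min.coboundedI1)
    next
      assume "\<exists>\<kappa>\<in>multiplicity_vectors A n. \<kappa> (trivial_character A) \<noteq> n \<and> lambda_min A n a c \<kappa>
          \<le> ereal l"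
      then obtain \<kappa> where \<kappa>: "\<kappa> \<in> multiplicity_vectors A n" "\<not> V_trivial A n \<kappa>" "lambda_min A n a
          c \<kappa> \<le> ereal l"
        by (auto simp: V_trivial_iff)
      then have "?M \<le> ereal l" by (intro INF_lower2[of \<kappa>]) auto
      then show ?thesis by (rule min.coboundedI2)
    qed
  qed
qed

end

theorem theorem5p2:
  fixes A :: "('a, 'm) monoid_scheme"
    and n :: nat
    and a :: "nat \<Rightarrow> nat \<Rightarrow> real"
    and c :: "(nat \<Rightarrow> 'a) \<Rightarrow> real"
  assumes "comm_group A" and "finite (carrier A)"
    and "n \<ge> 2"
    and "\<And>i j. i \<in> {1..n} \<Longrightarrow> j \<in> {1..n} \<Longrightarrow> a j i = a i j"
    and "\<And>i j. 1 \<le> i \<Longrightarrow> i < j \<Longrightarrow> j \<le> n \<Longrightarrow> a i j \<ge> 0"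
    and "\<And>x. x \<in> carrier (power_group A n) \<Longrightarrow> c x = c (inv\<^bsub>power_group A n\<^esub> x)"
    and "\<And>x. x \<in> carrier (power_group A n) \<Longrightarrow> c x \<ge> 0"
  shows "psi (wreath A n) (wreath_weight A n a c) =
           min (lambda_rw n a)
             (INF \<kappa> \<in> {\<kappa> \<in> multiplicity_vectors A n. \<not> V_trivial A n \<kappa>}. lambda_min A n a c \<kappa>)
         \<and> (\<forall>\<kappa>\<in>multiplicity_vectors A n.
              \<not> V_trivial A n \<kappa> \<longleftrightarrow> \<kappa> (trivial_character A) \<noteq> n)"
proof -
  interpret comm_group A by fact
  interpret weighted_wreath A n a c
    by unfold_locales (use assms in \<open>auto simp: ordered_pairs_def\<close>)
  show ?thesis using psi_wreath V_trivial_iff by blast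
qed

end
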